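(* Let $p=\frac{12}{7}$. There exist absolute constants $c\in(0,1)$, $C_0\ge 1$ and $C>0$ such that the following holds. Let $\delta\in 2^{\mathbb{N}}$ and $T>0$ satisfy $\delta\ge C_0$ and $\delta\le c\,T^{-1}$, let $\theta_1,\theta_2\in\mathcal{C}_\delta$ satisfy $\mathrm{dist}(\theta_1,\theta_2)\ge C_0\,\delta$, and let $f,g\in L^2(\mathbb{R}\times\mathbb{T})$ satisfy $\mathrm{supp}(\widehat f)\subset\theta_1$ and $\mathrm{supp}(\widehat g)\subset\theta_2$. Then $$\left\| e^{it\Delta}f\cdot e^{it\Delta}g\right\|_{L^2([0,T]\times\mathbb{R}\times\mathbb{T})}\le C\,\delta^{2-\frac4p}\,\|\widehat f\|_{L^p(\mathbb{R}\times\mathbb{Z})}\,\|\widehat g\|_{L^p(\mathbb{R}\times\mathbb{Z})}.$$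
   Context: $\mathbb{T}=\mathbb{R}/\mathbb{Z}$. For a function $f$ on $\mathbb{R}\times\mathbb{T}$ the Fourier transform is, for $(\xi,n)\in\mathbb{R}\times\mathbb{Z}$, $$\widehat f(\xi,n)=\int_{\mathbb{R}\times\mathbb{T}}e^{-2\pi i(x_1\xi+x_2n)}f(x_1,x_2)\,dx_1\,dx_2 .$$ The space $\mathbb{R}\times\mathbb{Z}$ carries the product of Lebesgue measure and counting measure, i.e. $\int_{\mathbb{R}\times\mathbb{Z}}F(y)\,dy:=\sum_{n\in\mathbb{Z}}\int_{\mathbb{R}}F(\xi,n)\,d\xi$, and $L^p(\mathbb{R}\times\mathbb{Z})$ is taken with respect to this measure. $e^{it\Delta}$ is the solution operator of the linear Schrödinger equation $iu_t+\Delta u=0$ on $\mathbb{R}\times\mathbb{T}$: $$e^{it\Delta}f(x)=\int_{\mathbb{R}\times\mathbb{Z}}e^{2\pi i(x\cdot y-2\pi t|y|^2)}\widehat f(y)\,dy ,$$ where $|y|$ is the Euclidean norm on $\mathbb{R}\times\mathbb{Z}\subset\mathbb{R}^2$. For $\delta\in 2^{\mathbb{N}}$, $$\mathcal{C}_\delta:=\big\{\theta:\ \theta=[m\delta,(m+1)\delta]\times\{n\delta,n\delta+1,\dots,(n+1)\delta\}\subset\mathbb{R}\times\mathbb{Z},\ m,n\in\mathbb{Z}\big\},$$ and $\mathrm{dist}$ denotes Euclidean distance between subsets of $\mathbb{R}\times\mathbb{Z}\subset\mathbb{R}^2$. The conditions $\delta\ge C_0$, $\delta\le cT^{-1}$ and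 $\mathrm{dist}(\theta_1,\theta_2)\ge C_0\delta$ express $1\ll\delta\ll T^{-1}$ and $\mathrm{dist}(\theta_1,\theta_2)\gg\delta$, where $A\ll B$ means $A\le cB$ for a sufficiently small absolute constant $c>0$. *)

theory Defs
  imports "HOL-Analysis.Analysis"
begin

subsection \<open>Lebesgue spaces\<close>

text \<open>The norm takes values in \<^typ>\<open>ennreal\<close>, so that it is \<open>\<infinity>\<close> (and not the default value
  of a divergent integral) for functions outside the space.\<close>

definition Lp_norm :: "real \<Rightarrow> 'a measure \<Rightarrow> ('a \<Rightarrow> complex) \<Rightarrow> ennreal" where
  "Lp_norm p M f =
     (let I = (\<integral>\<^sup>+ x. ennreal (norm (f x) powr p) \<partial>M)
      in if I = \<infinity> then \<infinity> else ennreal (enn2real I powr (1 / p)))"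

definition in_Lp :: "real \<Rightarrow> 'a measure \<Rightarrow> ('a \<Rightarrow> complex) \<Rightarrow> bool" where
  "in_Lp p M f \<longleftrightarrow> f \<in> borel_measurable M \<and> Lp_norm p M f < \<infinity>"

text \<open>The support of the almost-everywhere class of \<open>f\<close>: the complement of the union of all open
  sets on which \<open>f\<close> vanishes almost everywhere.\<close>

definition ess_support :: "'a::topological_space measure \<Rightarrow> ('a \<Rightarrow> complex) \<Rightarrow> 'a set" where
  "ess_support M f = - \<Union> {U. open U \<and> (AE x in M. x \<in> U \<longrightarrow> f x = 0)}"

subsection \<open>\<open>\<real> \<times> \<T>\<close> and \<open>\<real> \<times> \<int>\<close>\<close>

text \<open>Functions on \<open>\<real> \<times> \<T>\<close>, \<open>\<T> = \<real> / \<int>\<close>, are functions on \<open>\<real> \<times> \<real>\<close> that are 1-periodic in the second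
  variable; they are integrated over the fundamental domain \<open>\<real> \<times> [0,1)\<close>.\<close>

definition RT :: "(real \<times> real) measure" where
  "RT = lborel \<Otimes>\<^sub>M restrict_space lborel {0..<1}"

definition L2_RT :: "(real \<times> real \<Rightarrow> complex) set" where
  "L2_RT = {f. (\<forall>x\<^sub>1 x\<^sub>2. f (x\<^sub>1, x\<^sub>2 + 1) = f (x\<^sub>1, x\<^sub>2)) \<and> in_Lp 2 RT f}"

definition RZ :: "(real \<times> int) measure" where
  "RZ = lborel \<Otimes>\<^sub>M count_space UNIV"

definition embed_RZ :: "real \<times> int \<Rightarrow> real \<times> real" where
  "embed_RZ y = (fst y, real_of_int (snd y))"

subsection \<open>Fourier transform and Schroedinger evolution\<close>

definition fourier_integral :: "(real \<times> real \<Rightarrow> complex) \<Rightarrow> real \<times> int \<Rightarrow> complex" where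
  "fourier_integral f = (\<lambda>(\<xi>, n). \<integral>(x\<^sub>1, x\<^sub>2). cis (- 2 * pi * (x\<^sub>1 * \<xi> + x\<^sub>2 * real_of_int n)) * f (x\<^sub>1, x\<^sub>2) \<partial>RT)"

text \<open>For \<open>f \<in> L\<^sup>2\<close> the defining integral need not converge; \<open>F\<close> is (a representative of) the
  Fourier transform of \<open>f\<close> if it is the \<open>L\<^sup>2\<close>-limit of the transforms of the truncations of \<open>f\<close> to
  \<open>|x\<^sub>1| \<le> R\<close>, which are in \<open>L\<^sup>1\<close>. By Plancherel's theorem such an \<open>F\<close> exists for every \<open>f \<in> L\<^sup>2\<close>; it
  is unique up to null sets.\<close>

definition has_fourier_transform ::
  "(real \<times> real \<Rightarrow> complex) \<Rightarrow> (real \<times> int \<Rightarrow> complex) \<Rightarrow> bool"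
  (infix "has'_fourier'_transform" 50) where
  "f has_fourier_transform F \<longleftrightarrow>
     in_Lp 2 RZ F \<and>
     ((\<lambda>R. Lp_norm 2 RZ
        (\<lambda>y. F y - fourier_integral (\<lambda>x. if \<bar>fst x\<bar> \<le> R then f x else 0) y)) \<longlongrightarrow> 0) at_top"

text \<open>\<open>schroedinger F t\<close> is \<open>e\<^sup>i\<^sup>t\<^sup>\<Delta> f\<close> for a function \<open>f\<close> with Fourier transform \<open>F\<close>; it depends only on
  the almost-everywhere class of \<open>F\<close>. The inverse Fourier integral converges absolutely when
  \<open>F \<in> L\<^sup>2\<close> has compact support.\<close>

definition schroedinger :: "(real \<times> int \<Rightarrow> complex) \<Rightarrow> real \<Rightarrow> real \<times> real \<Rightarrow> complex" where
  "schroedinger F t x =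
     (\<integral>y. cis (2 * pi * (x \<bullet> embed_RZ y - 2 * pi * t * (norm (embed_RZ y))\<^sup>2)) * F y \<partial>RZ)"

subsection \<open>Squares at scale \<open>\<delta>\<close>\<close>

definition squares :: "nat \<Rightarrow> (real \<times> int) set set" where
  "squares \<delta> =
     {{real_of_int m * real \<delta> .. real_of_int (m + 1) * real \<delta>} \<times> {n * int \<delta> .. (n + 1) * int \<delta>} | m n. True}"

definition dist_RZ :: "(real \<times> int) set \<Rightarrow> (real \<times> int) set \<Rightarrow> real" where
  "dist_RZ A B = setdist (embed_RZ ` A) (embed_RZ ` B)"

end

(*
  By Plancherel in x, the square of the left-hand side is the time integral of the squared L^2 norm of
  the convolution of the modulated transforms, and carrying out the time integral (with a Gaussian
  majorant of [0,T]) bounds it by T times a form in |F|, |F|, |G|, |G| over near-rectangles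
  y1, y1', y2, y2': y1 + y2 = y1' + y2' and |(y1 - y1').(y1 - y2')| <= w, where w ~ 1/T >= delta.

  For indicator functions of sets of measures a, a' (in theta_1) and b, b' (in theta_2) this form is
  split at |y1 - y1'| = rho. The near part is at most rho w/delta times min(a,a') min(b,b'): fix two
  frequencies and count a third one in a strip. The far part is at most w (rho delta)^(-1/2) times
  (a a' b b')^(1/2) min(a,a',b,b')^(1/2): fix one frequency and apply Cauchy-Schwarz to the other
  three, which leaves the intersection of two transversal strips. Optimising rho gives
  w delta^(-2/3) m^(5/6) M^(1/3) n^(5/6) N^(1/3) with m = min(a,a'), M = max(a,a') and likewise n, N.
  The gain over (m M n N)^(7/12) when m << M or n << N makes the layer cake decomposition of |F| and
  |G| summable at the endpoint p = 12/7. In the integer direction, the discreteness is harmless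
  because w >= delta.
*)

theory Submission
  imports Defs "HOL-Probability.Characteristic_Functions" "HOL-Real_Asymp.Real_Asymp"
begin

section \<open>Measure theory of \<open>\<real> \<times> \<int>\<close>\<close>

text \<open>Homogeneity dictates the exponent: a and a' enter with total degree 5/6 + 1/3 = 7/6,
  while |F| occurs twice in the form. The power 7/6 of the integral of |F|^p is the square of the
  norm exactly when 7p/6 = 2, that is p = 12/7. The power -2/3 of \<delta> becomes -1/3 = 2 - 4/p
  after the final square root. The Gaussian is taken because its Fourier transform is again a
  positive Gaussian, which can be cut into dyadic layers |resonance| \<le> 2^l / T, each of width at
  least 1/T and so at least \<delta>. The form bound is linear in the width, hence weights 4^(-l)
  make the sum over l converge, and the factor T of the time integral cancels the 1/T of the widths.
  Once absolute values are inside there is no cancellation left to exploit, so the form is treated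
  for nonnegative functions in \<open>ennreal\<close>. Integrability matters only on the Fourier
  side, where it follows from the bounded supports. Plancherel is used as an inequality, since only
  an upper bound of the left-hand side is wanted.\<close>

lemma sigma_finite_RZ: "sigma_finite_measure RZ"
proof -
  interpret pair_sigma_finite lborel "count_space UNIV :: int measure"
    by (intro pair_sigma_finite.intro sigma_finite_measure_count_space sigma_finite_lborel)
  show ?thesis
    unfolding RZ_def by unfold_locales
qed

interpretation RZ: sigma_finite_measure RZ
  by (rule sigma_finite_RZ)

interpretation RZRZ: pair_sigma_finite RZ RZ
  by unfold_locales

lemma space_RZ [simp]: "space RZ = UNIV"
  by (simp add: RZ_def space_pair_measure)

lemma sets_RZ [measurable_cong]: "sets RZ = sets (borel \<Otimes>\<^sub>M count_space UNIV)"
  unfolding RZ_def by (rule sets_pair_measure_cong) auto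

lemma measurable_fst_RZ [measurable]: "fst \<in> borel_measurable RZ"
  and measurable_snd_RZ [measurable]: "snd \<in> measurable RZ (count_space UNIV)"
  by measurable

lemma measurable_RZ_diff [measurable]:
  assumes [measurable]: "f \<in> measurable M RZ" "g \<in> measurable M RZ"
  shows "(\<lambda>x. f x - g x) \<in> measurable M RZ"
proof -
  have [measurable]: "(\<lambda>x. fst (f x)) \<in> borel_measurable M" "(\<lambda>x. fst (g x)) \<in> borel_measurable M"
    "(\<lambda>x. snd (f x)) \<in> measurable M (count_space UNIV)"
    "(\<lambda>x. snd (g x)) \<in> measurable M (count_space UNIV)"
    by (auto intro: measurable_compose[OF assms(1)] measurable_compose[OF assms(2)])
  have "(\<lambda>x. (fst (f x) - fst (g x), snd (f x) - snd (g x))) \<in> measurable M RZ"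
    unfolding RZ_def by measurable
  then show ?thesis
    by (simp add: minus_prod_def)
qed

lemma measurable_RZ_add [measurable]:
  assumes [measurable]: "f \<in> measurable M RZ" "g \<in> measurable M RZ"
  shows "(\<lambda>x. f x + g x) \<in> measurable M RZ"
proof -
  have [measurable]: "(\<lambda>x. fst (f x)) \<in> borel_measurable M" "(\<lambda>x. fst (g x)) \<in> borel_measurable M"
    "(\<lambda>x. snd (f x)) \<in> measurable M (count_space UNIV)"
    "(\<lambda>x. snd (g x)) \<in> measurable M (count_space UNIV)"
    by (auto intro: measurable_compose[OF assms(1)] measurable_compose[OF assms(2)])
  have "(\<lambda>x. (fst (f x) + fst (g x), snd (f x) + snd (g x))) \<in> measurable M RZ"
    unfolding RZ_def by measurable
  then show ?thesis
    by (simp add: plus_prod_def)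
qed

lemma measurable_embed_RZ [measurable]: "embed_RZ \<in> measurable RZ borel"
  unfolding embed_RZ_def by measurable

section \<open>Iterated integration and invariance of the measure\<close>

lemma nn_integral_RZ_snd:
  assumes [measurable]: "f \<in> borel_measurable RZ"
  shows "(\<integral>\<^sup>+y. f y \<partial>RZ) = (\<integral>\<^sup>+n. \<integral>\<^sup>+x. f (x, n) \<partial>lborel \<partial>count_space UNIV)"
proof -
  interpret pair_sigma_finite lborel "count_space UNIV :: int measure"
    by (intro pair_sigma_finite.intro sigma_finite_measure_count_space sigma_finite_lborel)
  show ?thesis
    using assms unfolding RZ_def by (subst nn_integral_snd[symmetric]) auto
qed

lemma nn_integral_RZ_fst:
  assumes [measurable]: "f \<in> borel_measurable RZ"
  shows "(\<integral>\<^sup>+y. f y \<partial>RZ) = (\<integral>\<^sup>+x. \<integral>\<^sup>+n. f (x, n) \<partial>count_space UNIV \<partial>lborel)"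
proof -
  interpret sigma_finite_measure "count_space UNIV :: int measure"
    by (intro sigma_finite_measure_count_space)
  show ?thesis
    using assms unfolding RZ_def by (subst nn_integral_fst[symmetric]) auto
qed

text \<open>Reflection is the basic invariance here because y -> \<zeta> - y exchanges the two
  factors of a convolution.\<close>

lemma nn_integral_RZ_reflect:
  assumes [measurable]: "f \<in> borel_measurable RZ"
  shows "(\<integral>\<^sup>+y. f (c - y) \<partial>RZ) = (\<integral>\<^sup>+y. f y \<partial>RZ)"
proof -
  have "(\<integral>\<^sup>+y. f (c - y) \<partial>RZ)
      = (\<integral>\<^sup>+n. \<integral>\<^sup>+x. f (fst c - x, snd c - n) \<partial>lborel \<partial>count_space UNIV)"
    by (subst nn_integral_RZ_snd) (auto simp: minus_prod_def)
  also have "\<dots> = (\<integral>\<^sup>+n. \<integral>\<^sup>+x. f (x, snd c - n) \<partial>lborel \<partial>count_space UNIV)"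
    by (subst (2) nn_integral_real_affine[where c = "-1" and t = "fst c"]) auto
  also have "\<dots> = (\<integral>\<^sup>+n. \<integral>\<^sup>+x. f (x, n) \<partial>lborel \<partial>count_space UNIV)"
    by (rule nn_integral_bij_count_space)
       (rule bij_betw_byWitness[where f' = "\<lambda>n. snd c - n"], auto)
  finally show ?thesis
    by (simp add: nn_integral_RZ_snd)
qed

text \<open>A translation is the composition of the two reflections y -> -y and y -> c - y.\<close>

lemma nn_integral_RZ_shift:
  assumes [measurable]: "f \<in> borel_measurable RZ"
  shows "(\<integral>\<^sup>+y. f (y + c) \<partial>RZ) = (\<integral>\<^sup>+y. f y \<partial>RZ)"
proof -
  have "(\<integral>\<^sup>+y. f (y + c) \<partial>RZ) = (\<integral>\<^sup>+y. f (c - (0 - y)) \<partial>RZ)"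
    by (simp add: add.commute)
  also have "\<dots> = (\<integral>\<^sup>+y. f (c - y) \<partial>RZ)"
    by (rule nn_integral_RZ_reflect) measurable
  finally show ?thesis
    by (simp add: nn_integral_RZ_reflect)
qed

lemma nn_integral_RZ_shift':
  assumes [measurable]: "f \<in> borel_measurable RZ"
  shows "(\<integral>\<^sup>+y. f (y - c) \<partial>RZ) = (\<integral>\<^sup>+y. f y \<partial>RZ)"
  using nn_integral_RZ_shift[OF assms, of "- c"] by simp

section \<open>Measure of sets with short slices\<close>

lemma emeasure_lborel_le_diam:
  fixes S :: "real set"
  assumes "S \<in> sets borel" "\<And>s t. s \<in> S \<Longrightarrow> t \<in> S \<Longrightarrow> \<bar>s - t\<bar> \<le> l" "0 \<le> l"
  shows "emeasure lborel S \<le> ennreal (2 * l)"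
proof (cases "S = {}")
  case False
  then obtain s where "s \<in> S" by auto
  then have "S \<subseteq> {s - l .. s + l}"
    using assms(2) by (force simp: abs_le_iff)
  then have "emeasure lborel S \<le> emeasure lborel {s - l .. s + l}"
    using assms(1) by (intro emeasure_mono) auto
  then show ?thesis
    using assms(3) by simp
qed simp

text \<open>S lies in an integer interval of radius \<open>\<lfloor>l\<rfloor>\<close> about any of
  its points. The summand 1 is the cost of discreteness that each later count has to absorb.\<close>

lemma card_int_le_diam:
  fixes S :: "int set"
  assumes "\<And>s t. s \<in> S \<Longrightarrow> t \<in> S \<Longrightarrow> \<bar>of_int s - of_int t\<bar> \<le> l" "0 \<le> (l::real)"
  shows "emeasure (count_space UNIV) S \<le> ennreal (2 * l + 1)"
proof (cases "S = {}")
  case False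
  then obtain s where s: "s \<in> S" by auto
  have "S \<subseteq> {s - \<lfloor>l\<rfloor> .. s + \<lfloor>l\<rfloor>}"
  proof
    fix t assume "t \<in> S"
    then have "\<bar>of_int s - of_int t\<bar> \<le> l" using assms(1) s by auto
    then have "\<bar>s - t\<bar> \<le> \<lfloor>l\<rfloor>" by (simp add: le_floor_iff)
    then show "t \<in> {s - \<lfloor>l\<rfloor> .. s + \<lfloor>l\<rfloor>}" by auto
  qed
  then have "emeasure (count_space UNIV) S \<le> emeasure (count_space UNIV) {s - \<lfloor>l\<rfloor> .. s + \<lfloor>l\<rfloor>}"
    by (intro emeasure_mono) auto
  also have "\<dots> = ennreal (of_int (2 * \<lfloor>l\<rfloor> + 1))"
    using assms(2) by (subst emeasure_count_space_finite) (auto simp: ennreal_of_nat_eq_real_of_nat)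
  also have "\<dots> \<le> ennreal (2 * l + 1)"
    by (intro ennreal_leI) (simp add: algebra_simps)
  finally show ?thesis .
qed simp

text \<open>Slicing by rows: at most 2r + 1 integers occur, and each row has measure at most 2l. The
  discreteness term 1 falls here on the extent r across the rows, in the vertical version on the
  slice length l.\<close>

lemma emeasure_RZ_le_horizontal:
  assumes S [measurable]: "S \<in> sets RZ" and "0 \<le> l" "0 \<le> r"
    and snd: "\<And>p q. p \<in> S \<Longrightarrow> q \<in> S \<Longrightarrow> \<bar>of_int (snd p) - of_int (snd q)\<bar> \<le> r"
    and fst: "\<And>p q. p \<in> S \<Longrightarrow> q \<in> S \<Longrightarrow> snd p = snd q \<Longrightarrow> \<bar>fst p - fst q\<bar> \<le> l"
  shows "emeasure RZ S \<le> ennreal ((2 * r + 1) * (2 * l))"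
proof -
  have "emeasure RZ S = (\<integral>\<^sup>+n. \<integral>\<^sup>+x. indicator S (x, n) \<partial>lborel \<partial>count_space UNIV)"
    by (simp add: nn_integral_RZ_snd[symmetric])
  also have "\<dots> = (\<integral>\<^sup>+n. emeasure lborel {x. (x, n) \<in> S} \<partial>count_space UNIV)"
    by (intro nn_integral_cong, subst nn_integral_indicator[symmetric])
       (auto intro!: nn_integral_cong simp: indicator_def simp del: nn_integral_indicator)
  also have "\<dots> \<le> (\<integral>\<^sup>+n. ennreal (2 * l) * indicator (snd ` S) n \<partial>count_space UNIV)"
  proof (rule nn_integral_mono)
    fix n
    show "emeasure lborel {x. (x, n) \<in> S} \<le> ennreal (2 * l) * indicator (snd ` S) n"
    proof (cases "n \<in> snd ` S")
      case True
      have "emeasure lborel {x. (x, n) \<in> S} \<le> ennreal (2 * l)"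
        using fst \<open>0 \<le> l\<close> by (intro emeasure_lborel_le_diam) force+
      then show ?thesis using True by simp
    next
      case False
      then have "{x. (x, n) \<in> S} = {}" by force
      then show ?thesis by simp
    qed
  qed
  also have "\<dots> = ennreal (2 * l) * emeasure (count_space UNIV) (snd ` S)"
    by (simp add: nn_integral_cmult)
  also have "\<dots> \<le> ennreal (2 * l) * ennreal (2 * r + 1)"
    using snd \<open>0 \<le> r\<close> by (intro mult_left_mono card_int_le_diam) auto
  also have "\<dots> = ennreal ((2 * r + 1) * (2 * l))"
    using assms(2,3) by (subst ennreal_mult[symmetric]) (auto simp: mult.commute)
  finally show ?thesis .
qed

lemma emeasure_RZ_le_vertical:
  assumes S [measurable]: "S \<in> sets RZ" and "0 \<le> l" "0 \<le> r"
    and fst: "\<And>p q. p \<in> S \<Longrightarrow> q \<in> S \<Longrightarrow> \<bar>fst p - fst q\<bar> \<le> r"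
    and snd: "\<And>p q. p \<in> S \<Longrightarrow> q \<in> S \<Longrightarrow> fst p = fst q \<Longrightarrow> \<bar>of_int (snd p) - of_int (snd q)\<bar> \<le> l"
  shows "emeasure RZ S \<le> ennreal (2 * r * (2 * l + 1))"
proof (cases "S = {}")
  case False
  then obtain p where p: "p \<in> S" by auto
  have "emeasure RZ S = (\<integral>\<^sup>+x. \<integral>\<^sup>+n. indicator S (x, n) \<partial>count_space UNIV \<partial>lborel)"
    by (simp add: nn_integral_RZ_fst[symmetric])
  also have "\<dots> = (\<integral>\<^sup>+x. emeasure (count_space UNIV) {n. (x, n) \<in> S} \<partial>lborel)"
    by (intro nn_integral_cong, subst nn_integral_indicator[symmetric])
       (auto intro!: nn_integral_cong simp: indicator_def simp del: nn_integral_indicator)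
  also have "\<dots> \<le> (\<integral>\<^sup>+x. ennreal (2 * l + 1) * indicator {fst p - r .. fst p + r} x \<partial>lborel)"
  proof (rule nn_integral_mono)
    fix x
    show "emeasure (count_space UNIV) {n. (x, n) \<in> S}
        \<le> ennreal (2 * l + 1) * indicator {fst p - r .. fst p + r} x"
    proof (cases "{n. (x, n) \<in> S} = {}")
      case False
      then obtain m where "(x, m) \<in> S" by auto
      then have "\<bar>fst p - x\<bar> \<le> r" using fst[OF p] by force
      then have "x \<in> {fst p - r .. fst p + r}" by (auto simp: abs_le_iff)
      moreover have "emeasure (count_space UNIV) {n. (x, n) \<in> S} \<le> ennreal (2 * l + 1)"
        using snd \<open>0 \<le> l\<close> by (intro card_int_le_diam) force+
      ultimately show ?thesis by simp
    qed simp
  qed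
  also have "\<dots> = ennreal (2 * l + 1) * ennreal (2 * r)"
    using \<open>0 \<le> r\<close> by (simp add: nn_integral_cmult)
  also have "\<dots> = ennreal (2 * r * (2 * l + 1))"
    using assms(2,3) by (subst ennreal_mult[symmetric]) (auto simp: mult.commute)
  finally show ?thesis .
qed simp

section \<open>Strips and near-rectangles\<close>

definition rz_inner :: "real \<times> int \<Rightarrow> real \<times> int \<Rightarrow> real" where
  "rz_inner p q = fst p * fst q + of_int (snd p) * of_int (snd q)"

text \<open>Half of the energy defect \<open>|y|\<^sup>2 + |\<zeta> - y|\<^sup>2 - |y'|\<^sup>2 - |\<zeta> - y'|\<^sup>2\<close>; it vanishes iff \<open>y\<close>, \<open>y'\<close>,
  \<open>\<zeta> - y\<close>, \<open>\<zeta> - y'\<close> are the vertices of a rectangle.\<close>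

definition resonance :: "(real \<times> int) \<times> (real \<times> int) \<times> (real \<times> int) \<Rightarrow> real" where
  "resonance = (\<lambda>(\<zeta>, y, y'). rz_inner (y - y') (y + y' - \<zeta>))"

text \<open>The geometric content of two distant squares of side \<delta>, kept symmetric in A and B
  so that the roles of the two functions can be exchanged. The factor 16 leaves 8 \<delta> in one
  coordinate and makes \<delta> small against the distance in the angle estimate of
  \<open>high_count\<close>.\<close>

definition separated :: "real \<Rightarrow> (real \<times> int) set \<Rightarrow> (real \<times> int) set \<Rightarrow> bool" where
  "separated \<delta> A B \<longleftrightarrow>
     (\<forall>p\<in>A. \<forall>q\<in>A. \<bar>fst p - fst q\<bar> \<le> \<delta> \<and> \<bar>of_int (snd p) - of_int (snd q)\<bar> \<le> \<delta>) \<and>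
     (\<forall>p\<in>B. \<forall>q\<in>B. \<bar>fst p - fst q\<bar> \<le> \<delta> \<and> \<bar>of_int (snd p) - of_int (snd q)\<bar> \<le> \<delta>) \<and>
     (\<forall>p\<in>A. \<forall>q\<in>B. 16 * \<delta> \<le> norm (embed_RZ (p - q)))"

lemma norm_embed_RZ: "norm (embed_RZ p) = sqrt ((fst p)\<^sup>2 + (of_int (snd p))\<^sup>2)"
  by (simp add: embed_RZ_def norm_Pair)

lemma norm_embed_RZ_sq: "(norm (embed_RZ p))\<^sup>2 = (fst p)\<^sup>2 + (of_int (snd p))\<^sup>2"
  by (simp add: norm_embed_RZ)

lemma fst_le_norm_embed_RZ: "\<bar>fst p\<bar> \<le> norm (embed_RZ p)"
  and snd_le_norm_embed_RZ: "\<bar>of_int (snd p)\<bar> \<le> norm (embed_RZ p)"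
  unfolding norm_embed_RZ by (metis real_sqrt_ge_abs1, metis real_sqrt_ge_abs2)

lemma norm_embed_RZ_le: "norm (embed_RZ p) \<le> \<bar>fst p\<bar> + \<bar>of_int (snd p)\<bar>"
  unfolding norm_embed_RZ by (rule sqrt_sum_squares_le_sum_abs)

lemma embed_RZ_minus: "embed_RZ (p - q) = embed_RZ p - embed_RZ q"
  by (simp add: embed_RZ_def)

lemma norm_embed_RZ_commute: "norm (embed_RZ (p - q)) = norm (embed_RZ (q - p))"
  by (simp add: embed_RZ_minus norm_minus_commute)

lemma separated_commute: "separated \<delta> A B \<Longrightarrow> separated \<delta> B A"
  unfolding separated_def by (subst norm_embed_RZ_commute) auto

lemma separated_fst: "separated \<delta> A B \<Longrightarrow> p \<in> A \<Longrightarrow> q \<in> A \<Longrightarrow> \<bar>fst p - fst q\<bar> \<le> \<delta>"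
  and separated_snd: "separated \<delta> A B \<Longrightarrow> p \<in> A \<Longrightarrow> q \<in> A \<Longrightarrow> \<bar>of_int (snd p) - of_int (snd q)\<bar> \<le> \<delta>"
  by (auto simp: separated_def)

text \<open>The sum of the coordinate distances dominates the Euclidean one, so one coordinate
  carries half of 16 \<delta>. Which one it is decides whether sets are sliced by rows or by
  columns.\<close>

lemma separated_cases:
  assumes "separated \<delta> A B" "p \<in> A" "q \<in> B"
  obtains "8 * \<delta> \<le> \<bar>fst p - fst q\<bar>" | "8 * \<delta> \<le> \<bar>of_int (snd p) - of_int (snd q)\<bar>"
proof -
  have "16 * \<delta> \<le> norm (embed_RZ (p - q))"
    using assms by (auto simp: separated_def)
  also have "\<dots> \<le> \<bar>fst p - fst q\<bar> + \<bar>of_int (snd p) - of_int (snd q)\<bar>"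
    using norm_embed_RZ_le[of "p - q"] by simp
  finally show ?thesis
    using that by linarith
qed

text \<open>Along the axis on which \<open>\<phi>\<close> expands with slope 6 \<delta>, a slice of
  the strip |\<phi>| \<le> w has diameter at most 2w / (6 \<delta>); across the slices S extends
  over O(\<rho>). The work is to keep the integer rounding out of the product \<rho> w /
  \<delta>.\<close>

lemma low_count:
  assumes S [measurable]: "S \<in> sets RZ" and "0 < \<rho>" "0 < \<delta>" "\<delta> \<le> w"
    and near: "\<And>p. p \<in> S \<Longrightarrow> norm (embed_RZ (y - p)) \<le> \<rho>"
    and small: "\<And>p. p \<in> S \<Longrightarrow> \<bar>\<phi> p\<bar> \<le> w"
    and expand: "(\<forall>p\<in>S. \<forall>q\<in>S. snd p = snd q \<longrightarrow> 6 * \<delta> * \<bar>fst p - fst q\<bar> \<le> \<bar>\<phi> p - \<phi> q\<bar>) \<or>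
      (\<forall>p\<in>S. \<forall>q\<in>S. fst p = fst q \<longrightarrow> 6 * \<delta> * \<bar>of_int (snd p) - of_int (snd q)\<bar> \<le> \<bar>\<phi> p - \<phi> q\<bar>)"
  shows "emeasure RZ S \<le> ennreal (8 * \<rho> * (w / \<delta>))"
proof -
  have near1: "\<bar>fst p - fst y\<bar> \<le> \<rho>" if "p \<in> S" for p
    using near[OF that] fst_le_norm_embed_RZ[of "y - p"] by simp
  have near2: "\<bar>of_int (snd p) - of_int (snd y)\<bar> \<le> \<rho>" if "p \<in> S" for p
    using near[OF that] snd_le_norm_embed_RZ[of "y - p"] by simp
  have pair1: "\<bar>fst p - fst q\<bar> \<le> 2 * \<rho>" if "p \<in> S" "q \<in> S" for p q
    using near1[OF that(1)] near1[OF that(2)] by linarith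
  have pair2: "\<bar>of_int (snd p) - of_int (snd q)\<bar> \<le> 2 * \<rho>" if "p \<in> S" "q \<in> S" for p q
    using near2[OF that(1)] near2[OF that(2)] by linarith
  have small2: "\<bar>\<phi> p - \<phi> q\<bar> \<le> 2 * w" if "p \<in> S" "q \<in> S" for p q
    using small[OF that(1)] small[OF that(2)] by linarith
  have wd: "1 \<le> w / \<delta>"
    using assms by simp
  have prod: "\<rho> \<le> \<rho> * (w / \<delta>)"
    using wd \<open>0 < \<rho>\<close> mult_left_mono[of 1 "w/\<delta>" \<rho>] by simp
  from expand show ?thesis
  proof
    assume H: "\<forall>p\<in>S. \<forall>q\<in>S. snd p = snd q \<longrightarrow> 6 * \<delta> * \<bar>fst p - fst q\<bar> \<le> \<bar>\<phi> p - \<phi> q\<bar>"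
    show ?thesis
    proof (cases "\<rho> < 1")
      \<comment> \<open>The bound for the number of rows is not O(\<rho>) when \<rho> < 1, but then
        S lies on the single row of y, and its trivial diameter 2 \<rho> suffices because 1 \<le> w
        / \<delta>.\<close>
      case True
      have "snd p = snd y" if "p \<in> S" for p
        using near2[OF that] True by linarith
      then have "emeasure RZ S \<le> ennreal ((2 * 0 + 1) * (2 * (2 * \<rho>)))"
        using pair1 \<open>0 < \<rho>\<close> by (intro emeasure_RZ_le_horizontal) auto
      also have "\<dots> \<le> ennreal (8 * \<rho> * (w / \<delta>))"
        using prod \<open>0 < \<rho>\<close> by (intro ennreal_leI) simp
      finally show ?thesis .
    next
      case False
      have "\<bar>fst p - fst q\<bar> \<le> w / (3 * \<delta>)" if "p \<in> S" "q \<in> S" "snd p = snd q" for p q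
      proof -
        have "6 * \<delta> * \<bar>fst p - fst q\<bar> \<le> 2 * w"
          using H small2 that by (meson order.trans)
        then show ?thesis using \<open>0 < \<delta>\<close> by (simp add: field_simps)
      qed
      then have "emeasure RZ S \<le> ennreal ((2 * (2 * \<rho>) + 1) * (2 * (w / (3 * \<delta>))))"
        using pair2 \<open>0 < \<rho>\<close> \<open>0 < \<delta>\<close> \<open>\<delta> \<le> w\<close> by (intro emeasure_RZ_le_horizontal) auto
      also have "\<dots> \<le> ennreal (8 * \<rho> * (w / \<delta>))"
      proof (intro ennreal_leI)
        have "(2 * (2 * \<rho>) + 1) * (2 * (w / (3 * \<delta>))) \<le> (5 * \<rho>) * (2 * (w / (3 * \<delta>)))"
          using False \<open>0 < \<delta>\<close> \<open>\<delta> \<le> w\<close> by (intro mult_right_mono) auto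
        also have "\<dots> = (10 / 3) * (\<rho> * (w / \<delta>))" by simp
        also have "\<dots> \<le> 8 * (\<rho> * (w / \<delta>))"
          using prod \<open>0 < \<rho>\<close> by (intro mult_right_mono) auto
        finally show "(2 * (2 * \<rho>) + 1) * (2 * (w / (3 * \<delta>))) \<le> 8 * \<rho> * (w / \<delta>)" by simp
      qed
      finally show ?thesis .
    qed
  next
    assume V: "\<forall>p\<in>S. \<forall>q\<in>S. fst p = fst q \<longrightarrow>
      6 * \<delta> * \<bar>of_int (snd p) - of_int (snd q)\<bar> \<le> \<bar>\<phi> p - \<phi> q\<bar>"
    have "\<bar>of_int (snd p) - of_int (snd q)\<bar> \<le> w / (3 * \<delta>)" if "p \<in> S" "q \<in> S" "fst p = fst q" for p q
    proof -
      have "6 * \<delta> * \<bar>of_int (snd p) - of_int (snd q)\<bar> \<le> 2 * w"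
        using V small2 that by (meson order.trans)
      then show ?thesis using \<open>0 < \<delta>\<close> by (simp add: field_simps)
    qed
    then have "emeasure RZ S \<le> ennreal (2 * (2 * \<rho>) * (2 * (w / (3 * \<delta>)) + 1))"
      using pair1 \<open>0 < \<rho>\<close> \<open>0 < \<delta>\<close> \<open>\<delta> \<le> w\<close> by (intro emeasure_RZ_le_vertical) auto
    also have "\<dots> \<le> ennreal (8 * \<rho> * (w / \<delta>))"
      using prod \<open>0 < \<rho>\<close> by (intro ennreal_leI) (simp add: algebra_simps)
    finally show ?thesis .
  qed
qed

text \<open>\<open>S\<close> lies in two strips, orthogonal to \<open>y - z\<close> and to \<open>y - y'\<close>. These two vectors are nearly
  orthogonal unless \<open>w\<close> is so large that the trivial bound \<open>\<delta>\<close> for the diameter of \<open>S\<close> suffices.\<close>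

lemma high_count:
  assumes sep: "separated \<delta> A B" and "0 < \<delta>" "\<delta> \<le> w"
    and S [measurable]: "S \<in> sets RZ" and "S \<subseteq> A" and y: "y \<in> A" "y' \<in> A" and z: "z \<in> B"
    and "0 < \<rho>" and far: "\<rho> < norm (embed_RZ (y - y'))"
    and small1: "\<And>p. p \<in> S \<Longrightarrow> \<bar>rz_inner (y - p) (y - z)\<bar> \<le> w"
    and small2: "\<And>p. p \<in> S \<Longrightarrow> \<bar>rz_inner (y - y') (y + y' - (z + p))\<bar> \<le> w"
  shows "emeasure RZ S \<le> ennreal (24 * w\<^sup>2 / (\<rho> * \<delta>))"
proof -
  define r where "r = norm (embed_RZ (y - y'))"
  define a b s k where "a = fst y - fst z" and "b = real_of_int (snd y) - of_int (snd z)"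
    and "s = fst y - fst y'" and "k = real_of_int (snd y) - of_int (snd y')"
  define Q where "Q = norm (embed_RZ (y - z))"
  have r2: "r\<^sup>2 = s\<^sup>2 + k\<^sup>2" and Q2: "Q\<^sup>2 = a\<^sup>2 + b\<^sup>2"
    by (simp_all add: r_def s_def k_def Q_def a_def b_def norm_embed_RZ_sq)
  have "0 < r" using far \<open>0 < \<rho>\<close> unfolding r_def by linarith
  have Q16: "16 * \<delta> \<le> Q"
    using sep y z by (auto simp: separated_def Q_def)
  then have "0 < Q" using \<open>0 < \<delta>\<close> by linarith
  have sk: "\<bar>s\<bar> \<le> \<delta>" "\<bar>k\<bar> \<le> \<delta>"
    using separated_fst[OF sep y] separated_snd[OF sep y] by (auto simp: s_def k_def)
  have r_le: "r \<le> 2 * \<delta>"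
    using norm_embed_RZ_le[of "y - y'"] sk by (simp add: r_def s_def k_def)
  have diam: "\<bar>fst p - fst q\<bar> \<le> 8 * w / r \<and> \<bar>of_int (snd p) - of_int (snd q)\<bar> \<le> 8 * w / r"
    if pq: "p \<in> S" "q \<in> S" for p q
  proof (cases "w \<le> r * Q / 4")
    case True
    define u v where "u = fst p - fst q" and "v = real_of_int (snd p) - of_int (snd q)"
    have uQ: "\<bar>u * a + v * b\<bar> \<le> 2 * w"
      using small1[OF pq(1)] small1[OF pq(2)]
      by (simp add: rz_inner_def u_def v_def a_def b_def algebra_simps)
    have uP: "\<bar>u * s + v * k\<bar> \<le> 2 * w"
      using small2[OF pq(1)] small2[OF pq(2)]
      by (simp add: rz_inner_def u_def v_def s_def k_def algebra_simps)
    \<comment> \<open>The determinant of the vectors (a, b) = y - z and (s, k) = y - y'. By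
      Lagrange's identity it is at least r Q / 2 once their inner product is at most 3/8 r Q, as
      9/64 + 1/4 \<le> 1. Cramer's rule then bounds the difference (u, v) of two points of
      S.\<close>
    define X where "X = a * k - s * b"
    \<comment> \<open>\<open>small2\<close> controls the inner product of y - y' with (y - z) + (y'
      - p). The part from y' - p is at most 2 r \<delta> \<le> r Q / 8, and w \<le> r Q / 4, so the
      cosine of the angle between y - y' and y - z is at most 3/8.\<close>
    have "\<bar>s * a + k * b\<bar> \<le> 3 / 8 * (r * Q)"
    proof -
      have p: "p \<in> A" using pq \<open>S \<subseteq> A\<close> by auto
      define c d where "c = fst y' - fst p" and "d = real_of_int (snd y') - of_int (snd p)"
      have cd: "\<bar>c\<bar> \<le> \<delta>" "\<bar>d\<bar> \<le> \<delta>"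
        using separated_fst[OF sep y(2) p] separated_snd[OF sep y(2) p] by (auto simp: c_def d_def)
      have "\<bar>(s * a + k * b) + (s * c + k * d)\<bar> \<le> w"
        using small2[OF pq(1)]
        by (simp add: rz_inner_def c_def d_def a_def b_def s_def k_def algebra_simps)
      moreover have "\<bar>s * c + k * d\<bar> \<le> r * (2 * \<delta>)"
      proof -
        have "\<bar>s\<bar> \<le> r" "\<bar>k\<bar> \<le> r"
          using fst_le_norm_embed_RZ[of "y - y'"] snd_le_norm_embed_RZ[of "y - y'"]
          by (auto simp: s_def k_def r_def)
        then have "\<bar>s * c\<bar> \<le> r * \<delta>" "\<bar>k * d\<bar> \<le> r * \<delta>"
          using cd unfolding abs_mult by (auto intro!: mult_mono)
        then show ?thesis by linarith
      qed
      moreover have "r * (2 * \<delta>) \<le> r * (Q / 8)"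
        using Q16 \<open>0 < r\<close> by (intro mult_left_mono) auto
      ultimately show ?thesis using True by (simp add: abs_if split: if_splits)
    qed
    then have "(s * a + k * b)\<^sup>2 \<le> (3 / 8 * (r * Q))\<^sup>2"
      by (intro abs_le_square_iff[THEN iffD1]) auto
    have "X\<^sup>2 + (s * a + k * b)\<^sup>2 = r\<^sup>2 * Q\<^sup>2"
      unfolding r2 Q2 X_def by (simp add: power2_eq_square algebra_simps)
    have "(r * Q / 2)\<^sup>2 \<le> X\<^sup>2"
    proof -
      have "(3 / 8 * (r * Q))\<^sup>2 = 9 / 64 * (r\<^sup>2 * Q\<^sup>2)" "(r * Q / 2)\<^sup>2 = 1 / 4 * (r\<^sup>2 * Q\<^sup>2)"
        by (simp_all add: power2_eq_square)
      moreover have "0 \<le> r\<^sup>2 * Q\<^sup>2" by simp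
      ultimately show ?thesis
        using \<open>(s * a + k * b)\<^sup>2 \<le> (3 / 8 * (r * Q))\<^sup>2\<close> \<open>X\<^sup>2 + (s * a + k * b)\<^sup>2 = r\<^sup>2 * Q\<^sup>2\<close> by linarith
    qed
    then have X: "r * Q / 2 \<le> \<bar>X\<bar>"
      using abs_le_square_iff[of "r * Q / 2" X] \<open>0 < r\<close> \<open>0 < Q\<close> by (simp add: abs_mult)
    have ab: "\<bar>a\<bar> \<le> Q" "\<bar>b\<bar> \<le> Q"
      using fst_le_norm_embed_RZ[of "y - z"] snd_le_norm_embed_RZ[of "y - z"]
      by (auto simp: Q_def a_def b_def)
    have bound: "\<bar>t\<bar> \<le> 8 * w / r" if "\<bar>t * X\<bar> \<le> 2 * w * (2 * Q)" for t
    proof -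
      have "\<bar>t\<bar> * (r * Q / 2) \<le> \<bar>t\<bar> * \<bar>X\<bar>"
        using X by (intro mult_left_mono) auto
      also have "\<dots> \<le> 2 * w * (2 * Q)"
        using that by (simp add: abs_mult)
      finally show ?thesis
        using \<open>0 < r\<close> \<open>0 < Q\<close> by (simp add: field_simps)
    qed
    have cross: "\<bar>c * g - d * h\<bar> \<le> 2 * w * (2 * Q)"
      if "\<bar>g\<bar> \<le> 2 * w" "\<bar>h\<bar> \<le> 2 * w" "\<bar>c\<bar> \<le> Q" "\<bar>d\<bar> \<le> Q" for c d g h
    proof -
      have "\<bar>c * g\<bar> \<le> Q * (2 * w)" "\<bar>d * h\<bar> \<le> Q * (2 * w)"
        unfolding abs_mult using that \<open>0 < Q\<close> by (auto intro!: mult_mono)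
      moreover have "2 * w * (2 * Q) = Q * (2 * w) + Q * (2 * w)" by simp
      ultimately show ?thesis by linarith
    qed
    have "v * X = a * (u * s + v * k) - s * (u * a + v * b)"
      "u * X = k * (u * a + v * b) - b * (u * s + v * k)"
      by (simp_all add: X_def algebra_simps)
    moreover have "\<bar>s\<bar> \<le> Q" "\<bar>k\<bar> \<le> Q"
      using sk Q16 \<open>0 < \<delta>\<close> by auto
    ultimately have "\<bar>v * X\<bar> \<le> 2 * w * (2 * Q)" "\<bar>u * X\<bar> \<le> 2 * w * (2 * Q)"
      using cross[OF uP uQ ab(1)] cross[OF uQ uP _ ab(2)] by auto
    then show ?thesis
      using bound by (auto simp: u_def v_def)
  next
    \<comment> \<open>Now 4 r \<delta> \<le> r Q / 4 < w, so the side \<delta> of A is already below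
      8 w / r.\<close>
    case False
    have "\<delta> \<le> 8 * w / r"
    proof -
      have "r * (4 * \<delta>) \<le> r * (Q / 4)"
        using Q16 \<open>0 < r\<close> by (intro mult_left_mono) auto
      then have "r * (4 * \<delta>) \<le> w" using False by simp
      moreover have "0 \<le> r * \<delta>" using \<open>0 < r\<close> \<open>0 < \<delta>\<close> by simp
      ultimately have "\<delta> * r \<le> 8 * w" by (simp add: algebra_simps)
      then show ?thesis using \<open>0 < r\<close> by (simp add: field_simps)
    qed
    moreover have "p \<in> A" "q \<in> A" using pq \<open>S \<subseteq> A\<close> by auto
    ultimately show ?thesis
      using separated_fst[OF sep, of p q] separated_snd[OF sep, of p q] by auto
  qed
  have one: "1 \<le> 2 * w / r"
    using r_le \<open>0 < r\<close> \<open>\<delta> \<le> w\<close> by (simp add: field_simps)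
  have wd: "1 \<le> w / \<delta>"
    using assms by simp
  \<comment> \<open>The strip orthogonal to the long vector y - z bounds the slices by w / (4
    \<delta>), while \<open>diam\<close> bounds the extent across them. The constant 24 = 16 * 3/2
    comes from the columns, where rounding gives 2 w / (4 \<delta>) + 1 \<le> 3/2 w /
    \<delta>.\<close>
  have "emeasure RZ S \<le> ennreal (24 * (w / r) * (w / \<delta>))"
    using sep y(1) z
  proof (cases rule: separated_cases)
    case 1
    have "\<bar>fst p - fst q\<bar> \<le> w / (4 * \<delta>)" if "p \<in> S" "q \<in> S" "snd p = snd q" for p q
    proof -
      have "\<bar>(fst p - fst q) * (fst y - fst z)\<bar> \<le> 2 * w"
        using small1[OF that(1)] small1[OF that(2)] that(3)
        by (simp add: rz_inner_def algebra_simps)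
      moreover have "\<bar>fst p - fst q\<bar> * (8 * \<delta>) \<le> \<bar>fst p - fst q\<bar> * \<bar>fst y - fst z\<bar>"
        using 1 by (intro mult_left_mono) auto
      ultimately have "\<bar>fst p - fst q\<bar> * (8 * \<delta>) \<le> 2 * w" unfolding abs_mult by linarith
      then show ?thesis using \<open>0 < \<delta>\<close> by (simp add: field_simps)
    qed
    then have "emeasure RZ S \<le> ennreal ((2 * (8 * w / r) + 1) * (2 * (w / (4 * \<delta>))))"
      using diam \<open>0 < r\<close> \<open>0 < \<delta>\<close> \<open>\<delta> \<le> w\<close> by (intro emeasure_RZ_le_horizontal) auto
    also have "\<dots> \<le> ennreal (24 * (w / r) * (w / \<delta>))"
    proof (intro ennreal_leI)
      have "(2 * (8 * w / r) + 1) * (2 * (w / (4 * \<delta>))) \<le> (18 * (w / r)) * (2 * (w / (4 * \<delta>)))"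
        using one \<open>0 < \<delta>\<close> \<open>\<delta> \<le> w\<close> by (intro mult_right_mono) auto
      also have "\<dots> = 9 * ((w / r) * (w / \<delta>))" by simp
      also have "\<dots> \<le> 24 * ((w / r) * (w / \<delta>))"
        using \<open>0 < \<delta>\<close> \<open>\<delta> \<le> w\<close> \<open>0 < r\<close> by (intro mult_right_mono) auto
      finally show "(2 * (8 * w / r) + 1) * (2 * (w / (4 * \<delta>))) \<le> 24 * (w / r) * (w / \<delta>)" by simp
    qed
    finally show ?thesis .
  next
    case 2
    have "\<bar>of_int (snd p) - of_int (snd q)\<bar> \<le> w / (4 * \<delta>)" if "p \<in> S" "q \<in> S" "fst p = fst q" for p q
    proof -
      let ?n = "\<bar>real_of_int (snd p) - of_int (snd q)\<bar>"
      have "\<bar>(of_int (snd p) - of_int (snd q)) * (real_of_int (snd y) - of_int (snd z))\<bar> \<le> 2 * w"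
        using small1[OF that(1)] small1[OF that(2)] that(3)
        by (simp add: rz_inner_def algebra_simps)
      moreover have "?n * (8 * \<delta>) \<le> ?n * \<bar>of_int (snd y) - of_int (snd z)\<bar>"
        using 2 by (intro mult_left_mono) auto
      ultimately have "?n * (8 * \<delta>) \<le> 2 * w" unfolding abs_mult by linarith
      then show ?thesis using \<open>0 < \<delta>\<close> by (simp add: field_simps)
    qed
    then have "emeasure RZ S \<le> ennreal (2 * (8 * w / r) * (2 * (w / (4 * \<delta>)) + 1))"
      using diam \<open>0 < r\<close> \<open>0 < \<delta>\<close> \<open>\<delta> \<le> w\<close> by (intro emeasure_RZ_le_vertical) auto
    also have "\<dots> \<le> ennreal (24 * (w / r) * (w / \<delta>))"
    proof (intro ennreal_leI)
      have "2 * (8 * w / r) * (2 * (w / (4 * \<delta>)) + 1) \<le> 2 * (8 * w / r) * (3 / 2 * (w / \<delta>))"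
      proof (intro mult_left_mono)
        have "2 * (w / (4 * \<delta>)) = 1 / 2 * (w / \<delta>)" by simp
        then show "2 * (w / (4 * \<delta>)) + 1 \<le> 3 / 2 * (w / \<delta>)" using wd by linarith
      qed (use \<open>0 < r\<close> \<open>0 < \<delta>\<close> \<open>\<delta> \<le> w\<close> in simp)
      also have "\<dots> = 24 * (w / r) * (w / \<delta>)" by (simp add: mult.commute)
      finally show "2 * (8 * w / r) * (2 * (w / (4 * \<delta>)) + 1) \<le> 24 * (w / r) * (w / \<delta>)" .
    qed
    finally show ?thesis .
  qed
  also have "\<dots> \<le> ennreal (24 * w\<^sup>2 / (\<rho> * \<delta>))"
  proof (intro ennreal_leI)
    have "24 * w\<^sup>2 / (r * \<delta>) \<le> 24 * w\<^sup>2 / (\<rho> * \<delta>)"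
      using far \<open>0 < \<rho>\<close> \<open>0 < \<delta>\<close> \<open>0 < r\<close>
      by (intro divide_left_mono mult_right_mono mult_pos_pos) (auto simp flip: r_def)
    then show "24 * (w / r) * (w / \<delta>) \<le> 24 * w\<^sup>2 / (\<rho> * \<delta>)"
      by (simp add: power2_eq_square)
  qed
  finally show ?thesis .
qed

section \<open>The quadrilinear form\<close>

abbreviation RZ3 :: "((real \<times> int) \<times> (real \<times> int) \<times> (real \<times> int)) measure" where
  "RZ3 \<equiv> RZ \<Otimes>\<^sub>M RZ \<Otimes>\<^sub>M RZ"

text \<open>The frequencies are \<open>y\<^sub>1 = y\<close>, \<open>y\<^sub>2 = \<zeta> - y\<close>, \<open>y\<^sub>1' = y'\<close>, \<open>y\<^sub>2' = \<zeta> - y'\<close>, with \<open>y\<^sub>1 + y\<^sub>2 = y\<^sub>1' + y\<^sub>2' = \<zeta>\<close>;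
  \<open>f\<close>, \<open>f'\<close>, \<open>g\<close>, \<open>g'\<close> are evaluated at \<open>y\<^sub>1\<close>, \<open>y\<^sub>1'\<close>, \<open>y\<^sub>2\<close>, \<open>y\<^sub>2'\<close>.\<close>

definition quad_form ::
  "((real \<times> int) \<times> (real \<times> int) \<times> (real \<times> int) \<Rightarrow> ennreal) \<Rightarrow> (real \<times> int \<Rightarrow> ennreal) \<Rightarrow> (real \<times> int \<Rightarrow> ennreal) \<Rightarrow>
    (real \<times> int \<Rightarrow> ennreal) \<Rightarrow> (real \<times> int \<Rightarrow> ennreal) \<Rightarrow> ennreal" where
  "quad_form K f f' g g' =
     (\<integral>\<^sup>+\<zeta>. \<integral>\<^sup>+y. \<integral>\<^sup>+y'. f y * g (\<zeta> - y) * (f' y' * g' (\<zeta> - y')) * K (\<zeta>, y, y') \<partial>RZ \<partial>RZ \<partial>RZ)"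

abbreviation set_form where
  "set_form K E E' H H' \<equiv> quad_form K (indicator E) (indicator E') (indicator H) (indicator H')"

lemma nn_integral_RZ_swap:
  assumes [measurable]: "(\<lambda>(y, z). f y z) \<in> borel_measurable (RZ \<Otimes>\<^sub>M RZ)"
  shows "(\<integral>\<^sup>+y. \<integral>\<^sup>+z. f y z \<partial>RZ \<partial>RZ) = (\<integral>\<^sup>+z. \<integral>\<^sup>+y. f y z \<partial>RZ \<partial>RZ)"
  using RZRZ.Fubini'[OF assms] by simp

lemma quad_form_swap_time:
  assumes [measurable]: "K \<in> borel_measurable RZ3"
    "f \<in> borel_measurable RZ" "f' \<in> borel_measurable RZ" "g \<in> borel_measurable RZ" "g' \<in> borel_measurable RZ"
    and K: "\<And>\<zeta> y y'. K (\<zeta>, y, y') = K (\<zeta>, y', y)"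
  shows "quad_form K f f' g g' = quad_form K f' f g' g"
  unfolding quad_form_def
  by (subst (2) nn_integral_RZ_swap) (auto intro!: nn_integral_cong simp: K ac_simps)

text \<open>The reflections y -> \<zeta> - y and y' -> \<zeta> - y' exchange the roles of the two
  functions. Together with the exchange of y and y' they bring any of the four slots to the front,
  so each estimate need be proved for one slot only.\<close>

lemma quad_form_swap_space:
  assumes [measurable]: "K \<in> borel_measurable RZ3"
    "f \<in> borel_measurable RZ" "f' \<in> borel_measurable RZ" "g \<in> borel_measurable RZ" "g' \<in> borel_measurable RZ"
    and K: "\<And>\<zeta> y y'. K (\<zeta>, \<zeta> - y, \<zeta> - y') = K (\<zeta>, y, y')"
  shows "quad_form K f f' g g' = quad_form K g g' f f'"
  unfolding quad_form_def
proof (rule nn_integral_cong)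
  fix \<zeta>
  have "(\<integral>\<^sup>+y. \<integral>\<^sup>+y'. f y * g (\<zeta> - y) * (f' y' * g' (\<zeta> - y')) * K (\<zeta>, y, y') \<partial>RZ \<partial>RZ)
      = (\<integral>\<^sup>+y. \<integral>\<^sup>+y'. f (\<zeta> - y) * g y * (f' y' * g' (\<zeta> - y')) * K (\<zeta>, \<zeta> - y, y') \<partial>RZ \<partial>RZ)"
    by (subst nn_integral_RZ_reflect[where c = \<zeta>, symmetric]) simp_all
  also have "\<dots> = (\<integral>\<^sup>+y. \<integral>\<^sup>+y'. f (\<zeta> - y) * g y * (f' (\<zeta> - y') * g' y') * K (\<zeta>, \<zeta> - y, \<zeta> - y') \<partial>RZ \<partial>RZ)"
    by (rule nn_integral_cong, subst nn_integral_RZ_reflect[where c = \<zeta>, symmetric]) simp_all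
  finally show "(\<integral>\<^sup>+y. \<integral>\<^sup>+y'. f y * g (\<zeta> - y) * (f' y' * g' (\<zeta> - y')) * K (\<zeta>, y, y') \<partial>RZ \<partial>RZ) =
      (\<integral>\<^sup>+y. \<integral>\<^sup>+y'. g y * f (\<zeta> - y) * (g' y' * f' (\<zeta> - y')) * K (\<zeta>, y, y') \<partial>RZ \<partial>RZ)"
    by (simp add: K ac_simps)
qed

lemma quad_form_add:
  assumes [measurable]: "K \<in> borel_measurable RZ3" "L \<in> borel_measurable RZ3"
    "f \<in> borel_measurable RZ" "f' \<in> borel_measurable RZ" "g \<in> borel_measurable RZ" "g' \<in> borel_measurable RZ"
  shows "quad_form (\<lambda>x. K x + L x) f f' g g' = quad_form K f f' g g' + quad_form L f f' g g'"
  unfolding quad_form_def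
  by (simp add: nn_integral_add[symmetric] distrib_left)

section \<open>Freezing two of the four frequencies\<close>

lemma nn_integral_indicator_convolution:
  assumes [measurable]: "E \<in> sets RZ" "H \<in> sets RZ"
  shows "(\<integral>\<^sup>+\<zeta>. \<integral>\<^sup>+y. indicator E y * indicator H (\<zeta> - y) \<partial>RZ \<partial>RZ) = emeasure RZ E * emeasure RZ H"
proof -
  have "(\<integral>\<^sup>+\<zeta>. \<integral>\<^sup>+y. indicator E y * indicator H (\<zeta> - y) \<partial>RZ \<partial>RZ)
      = (\<integral>\<^sup>+y. indicator E y * (\<integral>\<^sup>+\<zeta>. indicator H (\<zeta> - y) \<partial>RZ) \<partial>RZ)"
    by (subst nn_integral_RZ_swap) (auto simp: nn_integral_cmult)
  then show ?thesis
    by (simp add: nn_integral_RZ_shift'[where f = "indicator H"] nn_integral_multc)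
qed

text \<open>Freezing y_1 = y and y_2 = z fixes \<zeta> = y + z, so y' is the single free variable.
  Enlarging E' to A and dropping H' leaves a kernel integral that no longer sees the four
  sets.\<close>

lemma quad_form_fix_same_time:
  assumes [measurable]: "K \<in> borel_measurable RZ3"
    "E \<in> sets RZ" "E' \<in> sets RZ" "H \<in> sets RZ" "H' \<in> sets RZ" "A \<in> sets RZ"
    and "E \<subseteq> A" "E' \<subseteq> A" "H \<subseteq> B" "H' \<subseteq> B"
    and c: "\<And>y z. y \<in> A \<Longrightarrow> z \<in> B \<Longrightarrow> (\<integral>\<^sup>+y'. indicator A y' * K (y + z, y, y') \<partial>RZ) \<le> c"
  shows "set_form K E E' H H'
    \<le> c * (emeasure RZ E * emeasure RZ H)"
proof -
  have "set_form K E E' H H'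
      \<le> (\<integral>\<^sup>+\<zeta>. \<integral>\<^sup>+y. indicator E y * indicator H (\<zeta> - y) * c \<partial>RZ \<partial>RZ)"
    unfolding quad_form_def
  proof (intro nn_integral_mono)
    fix \<zeta> y
    have "(\<integral>\<^sup>+y'. indicator E y * indicator H (\<zeta> - y) * (indicator E' y' * indicator H' (\<zeta> - y')) * K (\<zeta>, y, y') \<partial>RZ)
        \<le> (\<integral>\<^sup>+y'. indicator E y * indicator H (\<zeta> - y) * (indicator A y' * K (\<zeta>, y, y')) \<partial>RZ)"
      using \<open>E' \<subseteq> A\<close> by (intro nn_integral_mono) (auto simp: indicator_def)
    also have "\<dots> = indicator E y * indicator H (\<zeta> - y) * (\<integral>\<^sup>+y'. indicator A y' * K (\<zeta>, y, y') \<partial>RZ)"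
      by (rule nn_integral_cmult) simp
    also have "\<dots> \<le> indicator E y * indicator H (\<zeta> - y) * c"
    proof (cases "y \<in> E \<and> \<zeta> - y \<in> H")
      case True
      then have "y \<in> A" "\<zeta> - y \<in> B" using assms(7-) by auto
      then show ?thesis using True c[of y "\<zeta> - y"] by simp
    qed auto
    finally show "(\<integral>\<^sup>+y'. indicator E y * indicator H (\<zeta> - y) * (indicator E' y' * indicator H' (\<zeta> - y')) * K (\<zeta>, y, y') \<partial>RZ)
        \<le> indicator E y * indicator H (\<zeta> - y) * c" .
  qed
  also have "\<dots> = (\<integral>\<^sup>+\<zeta>. \<integral>\<^sup>+y. indicator E y * indicator H (\<zeta> - y) \<partial>RZ \<partial>RZ) * c"
    by (simp add: nn_integral_multc)
  finally show ?thesis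
    by (simp add: nn_integral_indicator_convolution mult.commute)
qed

text \<open>The substitution \<zeta> = z + y' makes z = y_2' an independent variable in place of
  \<zeta>; y_2 = z + y' - y becomes the dependent one.\<close>

lemma quad_form_change_variables:
  assumes [measurable]: "K \<in> borel_measurable RZ3"
    "f \<in> borel_measurable RZ" "f' \<in> borel_measurable RZ" "g \<in> borel_measurable RZ" "g' \<in> borel_measurable RZ"
  shows "quad_form K f f' g g' =
    (\<integral>\<^sup>+y. \<integral>\<^sup>+z. \<integral>\<^sup>+y'. f y * g (z + y' - y) * (f' y' * g' z) * K (z + y', y, y') \<partial>RZ \<partial>RZ \<partial>RZ)"
proof -
  have "quad_form K f f' g g' =
     (\<integral>\<^sup>+y. \<integral>\<^sup>+\<zeta>. \<integral>\<^sup>+y'. f y * g (\<zeta> - y) * (f' y' * g' (\<zeta> - y')) * K (\<zeta>, y, y') \<partial>RZ \<partial>RZ \<partial>RZ)"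
    unfolding quad_form_def by (subst nn_integral_RZ_swap) simp_all
  also have "\<dots> = (\<integral>\<^sup>+y. \<integral>\<^sup>+y'. \<integral>\<^sup>+\<zeta>. f y * g (\<zeta> - y) * (f' y' * g' (\<zeta> - y')) * K (\<zeta>, y, y') \<partial>RZ \<partial>RZ \<partial>RZ)"
    by (rule nn_integral_cong, rule nn_integral_RZ_swap) measurable
  also have "\<dots> = (\<integral>\<^sup>+y. \<integral>\<^sup>+y'. \<integral>\<^sup>+z. f y * g (z + y' - y) * (f' y' * g' z) * K (z + y', y, y') \<partial>RZ \<partial>RZ \<partial>RZ)"
  proof (rule nn_integral_cong, rule nn_integral_cong)
    fix y y'
    show "(\<integral>\<^sup>+\<zeta>. f y * g (\<zeta> - y) * (f' y' * g' (\<zeta> - y')) * K (\<zeta>, y, y') \<partial>RZ)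
      = (\<integral>\<^sup>+z. f y * g (z + y' - y) * (f' y' * g' z) * K (z + y', y, y') \<partial>RZ)"
      using nn_integral_RZ_shift[of "\<lambda>\<zeta>. f y * g (\<zeta> - y) * (f' y' * g' (\<zeta> - y')) * K (\<zeta>, y, y')" y']
      by simp
  qed
  also have "\<dots> = (\<integral>\<^sup>+y. \<integral>\<^sup>+z. \<integral>\<^sup>+y'. f y * g (z + y' - y) * (f' y' * g' z) * K (z + y', y, y') \<partial>RZ \<partial>RZ \<partial>RZ)"
    by (rule nn_integral_cong, rule nn_integral_RZ_swap) measurable
  finally show ?thesis .
qed

text \<open>Here y_1 and y_2' are frozen, one from each side of y_1 + y_2 = y_1' + y_2'. It
  complements \<open>quad_form_fix_same_time\<close> because the minimum of a b, a b', a' b, a' b'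
  may be attained at any of the four products.\<close>

lemma quad_form_fix_cross_time:
  assumes [measurable]: "K \<in> borel_measurable RZ3"
    "E \<in> sets RZ" "E' \<in> sets RZ" "H \<in> sets RZ" "H' \<in> sets RZ" "A \<in> sets RZ"
    and "E \<subseteq> A" "E' \<subseteq> A" "H \<subseteq> B" "H' \<subseteq> B"
    and c: "\<And>y z. y \<in> A \<Longrightarrow> z \<in> B \<Longrightarrow> (\<integral>\<^sup>+y'. indicator A y' * K (z + y', y, y') \<partial>RZ) \<le> c"
  shows "set_form K E E' H H'
    \<le> c * (emeasure RZ E * emeasure RZ H')"
proof -
  have "set_form K E E' H H'
      \<le> (\<integral>\<^sup>+y. \<integral>\<^sup>+z. indicator E y * indicator H' z * c \<partial>RZ \<partial>RZ)"
    unfolding quad_form_change_variables[OF assms(1) borel_measurable_indicator[OF assms(2)]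
      borel_measurable_indicator[OF assms(3)] borel_measurable_indicator[OF assms(4)] borel_measurable_indicator[OF assms(5)]]
  proof (intro nn_integral_mono)
    fix y z
    have "(\<integral>\<^sup>+y'. indicator E y * indicator H (z + y' - y) * (indicator E' y' * indicator H' z) * K (z + y', y, y') \<partial>RZ)
        \<le> (\<integral>\<^sup>+y'. indicator E y * indicator H' z * (indicator A y' * K (z + y', y, y')) \<partial>RZ)"
      using \<open>E' \<subseteq> A\<close> by (intro nn_integral_mono) (auto simp: indicator_def)
    also have "\<dots> = indicator E y * indicator H' z * (\<integral>\<^sup>+y'. indicator A y' * K (z + y', y, y') \<partial>RZ)"
      by (rule nn_integral_cmult) simp
    also have "\<dots> \<le> indicator E y * indicator H' z * c"
    proof (cases "y \<in> E \<and> z \<in> H'")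
      case True
      then have "y \<in> A" "z \<in> B" using assms(7-) by auto
      then show ?thesis using True by (simp add: c)
    qed auto
    finally show "(\<integral>\<^sup>+y'. indicator E y * indicator H (z + y' - y) * (indicator E' y' * indicator H' z) * K (z + y', y, y') \<partial>RZ)
        \<le> indicator E y * indicator H' z * c" .
  qed
  also have "\<dots> = c * (emeasure RZ E * emeasure RZ H')"
    by (simp add: nn_integral_multc nn_integral_cmult mult_ac)
  finally show ?thesis .
qed

section \<open>Freezing one frequency: the Cauchy-Schwarz argument\<close>

lemma ennreal_two_mult_le_squares: "2 * a * b \<le> a\<^sup>2 + (b::ennreal)\<^sup>2"
proof (cases a; cases b)
  fix r s assume "a = ennreal r" "0 \<le> r" "b = ennreal s" "0 \<le> s"
  then show ?thesis
    using sum_squares_bound[of r s]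
    by (simp add: ennreal_mult[symmetric] ennreal_power ennreal_plus[symmetric] ennreal_numeral[symmetric]
        ennreal_leI del: ennreal_plus ennreal_numeral)
qed (auto simp: power2_eq_square ennreal_top_mult ennreal_mult_top)

text \<open>The inequality 2 f(x) f(y) \<le> f(x)^2 + f(y)^2 integrated over x and y in H; infinite
  values are allowed throughout.\<close>

lemma nn_integral_indicator_Cauchy_Schwarz:
  assumes [measurable]: "f \<in> borel_measurable RZ" "H \<in> sets RZ"
  shows "(\<integral>\<^sup>+x. indicator H x * f x \<partial>RZ)\<^sup>2 \<le> emeasure RZ H * (\<integral>\<^sup>+x. (f x)\<^sup>2 \<partial>RZ)"
proof -
  let ?I = "\<integral>\<^sup>+x. (f x)\<^sup>2 \<partial>RZ"
  have "2 * (\<integral>\<^sup>+x. indicator H x * f x \<partial>RZ)\<^sup>2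
      = 2 * (\<integral>\<^sup>+x. \<integral>\<^sup>+y. (indicator H x * f x) * (indicator H y * f y) \<partial>RZ \<partial>RZ)"
    by (simp add: nn_integral_cmult nn_integral_multc power2_eq_square)
  also have "\<dots> = (\<integral>\<^sup>+x. \<integral>\<^sup>+y. indicator H x * indicator H y * (2 * f x * f y) \<partial>RZ \<partial>RZ)"
    by (simp add: nn_integral_cmult[symmetric] mult_ac)
  also have "\<dots> \<le> (\<integral>\<^sup>+x. \<integral>\<^sup>+y. (f x)\<^sup>2 * indicator H y + indicator H x * (f y)\<^sup>2 \<partial>RZ \<partial>RZ)"
    using ennreal_two_mult_le_squares by (intro nn_integral_mono) (auto simp: indicator_def)
  also have "\<dots> = 2 * (emeasure RZ H * ?I)"
    by (simp add: nn_integral_add nn_integral_cmult nn_integral_multc mult_2 mult_ac)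
  finally show ?thesis
    by (subst (asm) ennreal_mult_le_mult_iff) auto
qed

lemma ennreal_le_sqrtI:
  assumes "x\<^sup>2 \<le> ennreal c" "0 \<le> c"
  shows "x \<le> ennreal (sqrt c)"
proof (cases x)
  case (real r)
  then have "r\<^sup>2 \<le> c" using assms by (simp add: ennreal_power)
  then show ?thesis using real by (auto intro!: ennreal_leI real_le_rsqrt)
next
  case top
  then show ?thesis using assms by (simp add: power2_eq_square ennreal_top_mult top_unique)
qed

text \<open>Freezing \<open>y\<close> and squaring the integral over \<open>y'\<close> leaves two copies \<open>y'\<close>, \<open>p\<close> of this variable. Once
  \<open>y'\<close> and \<open>z = \<zeta> - p\<close> are fixed as well, \<open>p\<close> is confined to the intersection of two transversal strips.\<close>

lemma quad_form_Cauchy_Schwarz: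
  assumes [measurable]: "K \<in> borel_measurable RZ3"
    "E \<in> sets RZ" "E' \<in> sets RZ" "H \<in> sets RZ" "H' \<in> sets RZ" "A \<in> sets RZ"
    and sub: "E \<subseteq> A" "E' \<subseteq> A" "H \<subseteq> B" "H' \<subseteq> B"
    and fin: "emeasure RZ E' < \<infinity>" "emeasure RZ H < \<infinity>" "emeasure RZ H' < \<infinity>" and "0 \<le> c"
    and c: "\<And>y y' z. y \<in> A \<Longrightarrow> y' \<in> A \<Longrightarrow> z \<in> B \<Longrightarrow>
      (\<integral>\<^sup>+p. indicator A p * (K (z + p, y, y') * K (z + p, y, p)) \<partial>RZ) \<le> ennreal c"
  shows "set_form K E E' H H'
    \<le> emeasure RZ E * ennreal (sqrt (c * measure RZ E' * measure RZ H * measure RZ H'))"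
proof -
  define I where "I y \<zeta> = (\<integral>\<^sup>+y'. (indicator E' y' * indicator H' (\<zeta> - y')) * K (\<zeta>, y, y') \<partial>RZ)" for y \<zeta>
  have [measurable]: "(\<lambda>(y, \<zeta>). I y \<zeta>) \<in> borel_measurable (RZ \<Otimes>\<^sub>M RZ)"
    unfolding I_def by measurable
  define J where "J y = (\<integral>\<^sup>+\<zeta>. indicator H (\<zeta> - y) * I y \<zeta> \<partial>RZ)" for y
  have I2: "(\<integral>\<^sup>+\<zeta>. (I y \<zeta>)\<^sup>2 \<partial>RZ) \<le> ennreal c * emeasure RZ E' * emeasure RZ H'" if "y \<in> A" for y
  proof -
    have "(\<integral>\<^sup>+\<zeta>. (I y \<zeta>)\<^sup>2 \<partial>RZ)
      = (\<integral>\<^sup>+\<zeta>. \<integral>\<^sup>+y'. \<integral>\<^sup>+p. ((indicator E' y' * indicator H' (\<zeta> - y')) * K (\<zeta>, y, y')) *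
          ((indicator E' p * indicator H' (\<zeta> - p)) * K (\<zeta>, y, p)) \<partial>RZ \<partial>RZ \<partial>RZ)"
      unfolding I_def power2_eq_square
      by (simp add: nn_integral_cmult nn_integral_multc)
    also have "\<dots> \<le> (\<integral>\<^sup>+\<zeta>. \<integral>\<^sup>+y'. \<integral>\<^sup>+p. indicator E' y' * indicator H' (\<zeta> - p) *
          (indicator A p * (K (\<zeta>, y, y') * K (\<zeta>, y, p))) \<partial>RZ \<partial>RZ \<partial>RZ)"
      using sub by (intro nn_integral_mono) (auto simp: indicator_def)
    \<comment> \<open>Of the four indicators only those of y' and z = \<zeta> - p were kept, and p
      was released to all of A. The constant 1 in the third slot makes the doubled integral a
      \<open>quad_form\<close> again, so the change of variables to z applies to it.\<close>
    also have "\<dots> = quad_form (\<lambda>(\<zeta>, y', p). K (\<zeta>, y, y') * K (\<zeta>, y, p)) (indicator E') (indicator A) (\<lambda>_. 1) (indicator H')"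
      unfolding quad_form_def by (simp add: mult_ac)
    also have "\<dots> = (\<integral>\<^sup>+y'. \<integral>\<^sup>+z. \<integral>\<^sup>+p. indicator E' y' * indicator H' z *
        (indicator A p * (K (z + p, y, y') * K (z + p, y, p))) \<partial>RZ \<partial>RZ \<partial>RZ)"
      by (subst quad_form_change_variables) (simp_all add: mult_ac)
    also have "\<dots> = (\<integral>\<^sup>+y'. \<integral>\<^sup>+z. indicator E' y' * indicator H' z *
        (\<integral>\<^sup>+p. indicator A p * (K (z + p, y, y') * K (z + p, y, p)) \<partial>RZ) \<partial>RZ \<partial>RZ)"
      by (intro nn_integral_cong nn_integral_cmult) measurable
    also have "\<dots> \<le> (\<integral>\<^sup>+y'. \<integral>\<^sup>+z. indicator E' y' * indicator H' z * ennreal c \<partial>RZ \<partial>RZ)"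
    proof (intro nn_integral_mono)
      fix y' z
      show "indicator E' y' * indicator H' z *
        (\<integral>\<^sup>+p. indicator A p * (K (z + p, y, y') * K (z + p, y, p)) \<partial>RZ)
        \<le> indicator E' y' * indicator H' z * ennreal c"
      proof (cases "y' \<in> E' \<and> z \<in> H'")
        case True
        then have "y' \<in> A" "z \<in> B" using sub by auto
        then show ?thesis using True by (simp add: c that)
      qed auto
    qed
    also have "\<dots> = ennreal c * emeasure RZ E' * emeasure RZ H'"
      by (simp add: nn_integral_multc nn_integral_cmult mult_ac)
    finally show ?thesis .
  qed
  have J: "J y \<le> ennreal (sqrt (c * measure RZ E' * measure RZ H * measure RZ H'))" if "y \<in> A" for y
  proof (rule ennreal_le_sqrtI)
    have [measurable]: "(\<lambda>\<zeta>. \<zeta> - y) -` H \<in> sets RZ"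
      using measurable_sets[of "\<lambda>\<zeta>. \<zeta> - y" RZ RZ H] by simp
    have "(J y)\<^sup>2 = (\<integral>\<^sup>+\<zeta>. indicator ((\<lambda>\<zeta>. \<zeta> - y) -` H) \<zeta> * I y \<zeta> \<partial>RZ)\<^sup>2"
      by (simp add: J_def indicator_def)
    also have "\<dots> \<le> emeasure RZ ((\<lambda>\<zeta>. \<zeta> - y) -` H) * (\<integral>\<^sup>+\<zeta>. (I y \<zeta>)\<^sup>2 \<partial>RZ)"
      by (rule nn_integral_indicator_Cauchy_Schwarz) measurable
    also have "emeasure RZ ((\<lambda>\<zeta>. \<zeta> - y) -` H) = (\<integral>\<^sup>+\<zeta>. indicator H (\<zeta> - y) \<partial>RZ)"
      by (subst nn_integral_indicator[symmetric]) (auto intro!: nn_integral_cong simp: indicator_def simp del: nn_integral_indicator)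
    also have "\<dots> = emeasure RZ H"
      by (subst nn_integral_RZ_shift') auto
    also have "emeasure RZ H * (\<integral>\<^sup>+\<zeta>. (I y \<zeta>)\<^sup>2 \<partial>RZ)
        \<le> emeasure RZ H * (ennreal c * emeasure RZ E' * emeasure RZ H')"
      using I2[OF that] by (intro mult_left_mono) auto
    also have "\<dots> = ennreal (c * measure RZ E' * measure RZ H * measure RZ H')"
      using fin \<open>0 \<le> c\<close> by (simp add: emeasure_eq_ennreal_measure less_top ennreal_mult[symmetric] mult_ac)
    finally show "(J y)\<^sup>2 \<le> ennreal (c * measure RZ E' * measure RZ H * measure RZ H')" .
  qed (use \<open>0 \<le> c\<close> in simp)
  have "set_form K E E' H H' =
      (\<integral>\<^sup>+y. \<integral>\<^sup>+\<zeta>. \<integral>\<^sup>+y'. indicator E y * indicator H (\<zeta> - y) * (indicator E' y' * indicator H' (\<zeta> - y')) * K (\<zeta>, y, y') \<partial>RZ \<partial>RZ \<partial>RZ)"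
    unfolding quad_form_def by (subst nn_integral_RZ_swap) simp_all
  also have "\<dots> = (\<integral>\<^sup>+y. indicator E y * J y \<partial>RZ)"
    unfolding J_def I_def by (simp add: nn_integral_cmult[symmetric] mult.assoc)
  also have "\<dots> \<le> (\<integral>\<^sup>+y. indicator E y * ennreal (sqrt (c * measure RZ E' * measure RZ H * measure RZ H')) \<partial>RZ)"
  proof (intro nn_integral_mono)
    fix y
    show "indicator E y * J y \<le> indicator E y * ennreal (sqrt (c * measure RZ E' * measure RZ H * measure RZ H'))"
      using J[of y] sub by (auto simp: indicator_def)
  qed
  also have "\<dots> = emeasure RZ E * ennreal (sqrt (c * measure RZ E' * measure RZ H * measure RZ H'))"
    by (simp add: nn_integral_multc)
  finally show ?thesis .
qed

section \<open>The resonant set and its splitting by the distance of y and y'\<close>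

lemma measurable_rz_inner [measurable]:
  assumes [measurable]: "f \<in> measurable M RZ" "g \<in> measurable M RZ"
  shows "(\<lambda>x. rz_inner (f x) (g x)) \<in> borel_measurable M"
proof -
  have [measurable]: "(\<lambda>x. fst (f x)) \<in> borel_measurable M" "(\<lambda>x. fst (g x)) \<in> borel_measurable M"
    "(\<lambda>x. snd (f x)) \<in> measurable M (count_space UNIV)"
    "(\<lambda>x. snd (g x)) \<in> measurable M (count_space UNIV)"
    by (auto intro: measurable_compose[OF assms(1)] measurable_compose[OF assms(2)])
  show ?thesis unfolding rz_inner_def by measurable
qed

lemma measurable_resonance [measurable]:
  "resonance \<in> borel_measurable RZ3"
  unfolding resonance_def by measurable

lemma rz_inner_minus_left: "rz_inner (- p) q = - rz_inner p q"
  by (simp add: rz_inner_def)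

lemma resonance_swap: "resonance (\<zeta>, y', y) = - resonance (\<zeta>, y, y')"
  using rz_inner_minus_left[of "y - y'" "y + y' - \<zeta>"] by (simp add: resonance_def add.commute)

lemma resonance_reflect: "resonance (\<zeta>, \<zeta> - y, \<zeta> - y') = resonance (\<zeta>, y, y')"
  by (simp add: resonance_def rz_inner_def algebra_simps)

text \<open>At \<rho> = (Q / P)^(2/3) the two terms agree, so each contributes half of the
  bound.\<close>

lemma le_balanced_power:
  fixes \<phi> P Q :: real
  assumes "\<And>\<rho>. 0 < \<rho> \<Longrightarrow> \<phi> \<le> P * \<rho> + Q / sqrt \<rho>" "0 < P" "0 < Q"
  shows "\<phi> \<le> 2 * (P powr (1/3) * Q powr (2/3))"
proof -
  define \<rho> where "\<rho> = (Q / P) powr (2/3)"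
  have "P * \<rho> = P powr 1 * (Q powr (2/3) * P powr (- (2/3)))"
    using assms by (simp add: \<rho>_def powr_divide powr_minus_divide)
  also have "\<dots> = (P powr 1 * P powr (- (2/3))) * Q powr (2/3)"
    by (simp only: mult_ac)
  also have "P powr 1 * P powr (- (2/3)) = P powr (1/3)"
    unfolding powr_add[symmetric] by simp
  finally have 1: "P * \<rho> = P powr (1/3) * Q powr (2/3)" .
  have "Q / sqrt \<rho> = Q powr 1 * (Q powr (- (1/3)) * P powr (1/3))"
    using assms by (simp add: \<rho>_def powr_half_sqrt[symmetric] powr_powr powr_divide powr_minus_divide)
  also have "\<dots> = P powr (1/3) * (Q powr 1 * Q powr (- (1/3)))"
    by (simp only: mult_ac)
  also have "Q powr 1 * Q powr (- (1/3)) = Q powr (2/3)"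
    unfolding powr_add[symmetric] by simp
  finally show ?thesis
    using assms(1)[of \<rho>] 1 assms(2,3) by (simp add: \<rho>_def)
qed

definition resonant :: "real \<Rightarrow> ((real \<times> int) \<times> (real \<times> int) \<times> (real \<times> int)) set" where
  "resonant w = {x. \<bar>resonance x\<bar> \<le> w}"

lemma resonant_iff: "(\<zeta>, y, y') \<in> resonant w \<longleftrightarrow> \<bar>rz_inner (y - y') (y + y' - \<zeta>)\<bar> \<le> w"
  by (simp add: resonant_def resonance_def)

definition near_pairs :: "real \<Rightarrow> ((real \<times> int) \<times> (real \<times> int) \<times> (real \<times> int)) set" where
  "near_pairs \<rho> = {(\<zeta>, y, y'). norm (embed_RZ (y - y')) \<le> \<rho>}"

lemma sets_resonant [measurable]: "resonant w \<in> sets RZ3"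
proof -
  have "{x \<in> space RZ3. \<bar>resonance x\<bar> \<le> w} \<in> sets RZ3"
    by measurable
  then show ?thesis by (simp add: resonant_def space_pair_measure)
qed

lemma sets_near_pairs [measurable]: "near_pairs \<rho> \<in> sets RZ3"
proof -
  have "{x \<in> space RZ3. norm (embed_RZ (fst (snd x) - snd (snd x))) \<le> \<rho>}
      \<in> sets RZ3"
    by measurable
  then show ?thesis
    by (simp add: near_pairs_def space_pair_measure case_prod_unfold)
qed

lemma resonant_sym:
  "(\<zeta>, y', y) \<in> resonant w \<longleftrightarrow> (\<zeta>, y, y') \<in> resonant w"
  "(\<zeta>, \<zeta> - y, \<zeta> - y') \<in> resonant w \<longleftrightarrow> (\<zeta>, y, y') \<in> resonant w"
  by (auto simp: resonant_def resonance_swap[of \<zeta> y y'] resonance_reflect)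

lemma near_pairs_sym:
  "(\<zeta>, y', y) \<in> near_pairs \<rho> \<longleftrightarrow> (\<zeta>, y, y') \<in> near_pairs \<rho>"
  "(\<zeta>, \<zeta> - y, \<zeta> - y') \<in> near_pairs \<rho> \<longleftrightarrow> (\<zeta>, y, y') \<in> near_pairs \<rho>"
  using norm_embed_RZ_commute[of y y'] by (auto simp: near_pairs_def)

lemma indicator_restrict_RZ:
  assumes [measurable]: "A \<in> sets RZ" "S \<in> sets RZ3"
    and [measurable]: "t \<in> measurable RZ RZ3"
  shows "{p \<in> A. t p \<in> S} \<in> sets RZ"
    "(\<integral>\<^sup>+p. indicator A p * indicator S (t p) \<partial>RZ) = emeasure RZ {p \<in> A. t p \<in> S}"
proof -
  have "{p \<in> space RZ. p \<in> A \<and> t p \<in> S} \<in> sets RZ"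
    by measurable
  then show *: "{p \<in> A. t p \<in> S} \<in> sets RZ"
    by simp
  show "(\<integral>\<^sup>+p. indicator A p * indicator S (t p) \<partial>RZ) = emeasure RZ {p \<in> A. t p \<in> S}"
    unfolding nn_integral_indicator[OF *, symmetric]
    by (intro nn_integral_cong) (auto simp: indicator_def)
qed

text \<open>With y and z frozen, a third frequency p has defect 0 iff it lies on the circle with
  diameter from y to z, when z = y_2, or on the line through y orthogonal to y - z, when z = y_2'.
  In both cases the defect has slope at least 6 \<delta> along the axis on which y and z are far
  apart, as \<open>low_count\<close> asks.\<close>

lemma low_part:
  assumes sep: "separated \<delta> A B" and "0 < \<delta>" "\<delta> \<le> w" "0 < \<rho>"
    and [measurable]: "A \<in> sets RZ"
      "E \<in> sets RZ" "E' \<in> sets RZ" "H \<in> sets RZ" "H' \<in> sets RZ"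
    and sub: "E \<subseteq> A" "E' \<subseteq> A" "H \<subseteq> B" "H' \<subseteq> B"
  shows "set_form (indicator (resonant w \<inter> near_pairs \<rho>)) E E' H H'
      \<le> ennreal (8 * \<rho> * (w / \<delta>)) * (emeasure RZ E * emeasure RZ H)" (is ?same)
    and "set_form (indicator (resonant w \<inter> near_pairs \<rho>)) E E' H H'
      \<le> ennreal (8 * \<rho> * (w / \<delta>)) * (emeasure RZ E * emeasure RZ H')" (is ?cross)
proof -
  let ?S = "resonant w \<inter> near_pairs \<rho>"
  show ?same
  proof (rule quad_form_fix_same_time[where A = A and B = B])
    fix y z assume yz: "y \<in> A" "z \<in> B"
    have res: "resonance (y + z, y, p) = (fst y - fst p) * (fst p - fst z) +
        (of_int (snd y) - of_int (snd p)) * (of_int (snd p) - of_int (snd z))" for p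
      by (simp add: resonance_def rz_inner_def)
    let ?R = "{p \<in> A. (y + z, y, p) \<in> ?S}" and ?\<phi> = "\<lambda>p. resonance (y + z, y, p)"
    have "emeasure RZ ?R \<le> ennreal (8 * \<rho> * (w / \<delta>))"
    proof (rule low_count[where y = y and \<phi> = ?\<phi>])
      \<comment> \<open>The difference quotient of (a - u) (u - b) between u and v is a + b - u - v.
        It differs from b - a by at most 2 \<delta> because u and v are \<delta>-close to a.\<close>
      have far: "6 * \<delta> * \<bar>u - v\<bar> \<le> \<bar>(u - v) * (a + b - u - v)\<bar>"
        if "8 * \<delta> \<le> \<bar>a - b\<bar>" "\<bar>a - u\<bar> \<le> \<delta>" "\<bar>a - v\<bar> \<le> \<delta>" for a b u v :: real
      proof -
        have "6 * \<delta> \<le> \<bar>a + b - u - v\<bar>" using that by linarith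
        then show ?thesis
          unfolding abs_mult by (subst mult.commute) (intro mult_left_mono, auto)
      qed
      from sep yz show
        "(\<forall>p\<in>?R. \<forall>q\<in>?R. snd p = snd q \<longrightarrow>
           6 * \<delta> * \<bar>fst p - fst q\<bar> \<le> \<bar>?\<phi> p - ?\<phi> q\<bar>) \<or>
         (\<forall>p\<in>?R. \<forall>q\<in>?R. fst p = fst q \<longrightarrow>
           6 * \<delta> * \<bar>of_int (snd p) - of_int (snd q)\<bar> \<le> \<bar>?\<phi> p - ?\<phi> q\<bar>)"
      proof (cases rule: separated_cases)
        case 1
        have "6 * \<delta> * \<bar>fst p - fst q\<bar> \<le> \<bar>?\<phi> p - ?\<phi> q\<bar>"
          if "p \<in> A" "q \<in> A" "snd p = snd q" for p q
        proof -
          have "?\<phi> p - ?\<phi> q = (fst p - fst q) * (fst y + fst z - fst p - fst q)"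
            unfolding res that(3) by (simp add: algebra_simps)
          then show ?thesis
            using far[OF 1 separated_fst[OF sep yz(1) that(1)] separated_fst[OF sep yz(1) that(2)]] by simp
        qed
        then show ?thesis by blast
      next
        case 2
        have "6 * \<delta> * \<bar>of_int (snd p) - of_int (snd q)\<bar> \<le> \<bar>?\<phi> p - ?\<phi> q\<bar>"
          if "p \<in> A" "q \<in> A" "fst p = fst q" for p q
        proof -
          have "?\<phi> p - ?\<phi> q =
              (of_int (snd p) - of_int (snd q)) * (of_int (snd y) + of_int (snd z) - of_int (snd p) - of_int (snd q))"
            unfolding res that(3) by (simp add: algebra_simps)
          then show ?thesis
            using far[OF 2 separated_snd[OF sep yz(1) that(1)] separated_snd[OF sep yz(1) that(2)]] by simp
        qed
        then show ?thesis by blast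
      qed
    qed (use assms(2-4) in \<open>auto simp: resonant_def near_pairs_def intro!: indicator_restrict_RZ\<close>)
    then show "(\<integral>\<^sup>+y'. indicator A y' * indicator ?S (y + z, y, y') \<partial>RZ) \<le> ennreal (8 * \<rho> * (w / \<delta>))"
      by (simp add: indicator_restrict_RZ(2)[where t = "\<lambda>p. (y + z, y, p)"])
  qed (use sub in auto)
  show ?cross
  proof (rule quad_form_fix_cross_time[where A = A and B = B])
    fix y z assume yz: "y \<in> A" "z \<in> B"
    have res: "resonance (z + p, y, p) = (fst y - fst p) * (fst y - fst z) +
        (of_int (snd y) - of_int (snd p)) * (of_int (snd y) - of_int (snd z))" for p
      by (simp add: resonance_def rz_inner_def)
    let ?R = "{p \<in> A. (z + p, y, p) \<in> ?S}" and ?\<phi> = "\<lambda>p. resonance (z + p, y, p)"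
    have "emeasure RZ ?R \<le> ennreal (8 * \<rho> * (w / \<delta>))"
    proof (rule low_count[where y = y and \<phi> = ?\<phi>])
      have far: "6 * \<delta> * \<bar>u - v\<bar> \<le> \<bar>(v - u) * (a - b)\<bar>"
        if "8 * \<delta> \<le> \<bar>a - b\<bar>" for a b u v :: real
      proof -
        have "6 * \<delta> \<le> \<bar>a - b\<bar>" using that \<open>0 < \<delta>\<close> by linarith
        then show ?thesis
          unfolding abs_mult abs_minus_commute[of v u]
          by (subst mult.commute) (intro mult_left_mono, auto)
      qed
      from sep yz show
        "(\<forall>p\<in>?R. \<forall>q\<in>?R. snd p = snd q \<longrightarrow>
           6 * \<delta> * \<bar>fst p - fst q\<bar> \<le> \<bar>?\<phi> p - ?\<phi> q\<bar>) \<or>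
         (\<forall>p\<in>?R. \<forall>q\<in>?R. fst p = fst q \<longrightarrow>
           6 * \<delta> * \<bar>of_int (snd p) - of_int (snd q)\<bar> \<le> \<bar>?\<phi> p - ?\<phi> q\<bar>)"
      proof (cases rule: separated_cases)
        case 1
        have "6 * \<delta> * \<bar>fst p - fst q\<bar> \<le> \<bar>?\<phi> p - ?\<phi> q\<bar>"
          if "snd p = snd q" for p q
        proof -
          have "?\<phi> p - ?\<phi> q = (fst q - fst p) * (fst y - fst z)"
            unfolding res that by (simp add: algebra_simps)
          then show ?thesis
            using far[OF 1] by simp
        qed
        then show ?thesis by blast
      next
        case 2
        have "6 * \<delta> * \<bar>of_int (snd p) - of_int (snd q)\<bar> \<le> \<bar>?\<phi> p - ?\<phi> q\<bar>"
          if "fst p = fst q" for p q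
        proof -
          have "?\<phi> p - ?\<phi> q =
              (of_int (snd q) - of_int (snd p)) * (of_int (snd y) - of_int (snd z))"
            unfolding res that by (simp add: algebra_simps)
          then show ?thesis
            using far[OF 2] by simp
        qed
        then show ?thesis by blast
      qed
    qed (use assms(2-4) in \<open>auto simp: resonant_def near_pairs_def intro!: indicator_restrict_RZ\<close>)
    then show "(\<integral>\<^sup>+y'. indicator A y' * indicator ?S (z + y', y, y') \<partial>RZ) \<le> ennreal (8 * \<rho> * (w / \<delta>))"
      by (simp add: indicator_restrict_RZ(2)[where t = "\<lambda>p. (z + p, y, p)"])
  qed (use sub in auto)
qed

text \<open>For frozen y, y', z the resonance of y' and that of its copy p are two strip conditions
  on p, orthogonal to y - y' and to y - z. The condition |y - y'| > \<rho> bounds the width w / |y -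
  y'| of the first strip, and \<open>high_count\<close> supplies the constant for
  Cauchy-Schwarz.\<close>

lemma high_part:
  assumes sep: "separated \<delta> A B" and "0 < \<delta>" "\<delta> \<le> w" "0 < \<rho>"
    and [measurable]: "A \<in> sets RZ"
      "E \<in> sets RZ" "E' \<in> sets RZ" "H \<in> sets RZ" "H' \<in> sets RZ"
    and sub: "E \<subseteq> A" "E' \<subseteq> A" "H \<subseteq> B" "H' \<subseteq> B"
    and fin: "emeasure RZ E < \<infinity>" "emeasure RZ E' < \<infinity>" "emeasure RZ H < \<infinity>" "emeasure RZ H' < \<infinity>"
  shows "set_form (indicator (resonant w - near_pairs \<rho>)) E E' H H'
      \<le> ennreal (measure RZ E * sqrt (24 * w\<^sup>2 / (\<rho> * \<delta>) * measure RZ E' * measure RZ H * measure RZ H'))"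
proof -
  let ?S = "resonant w - near_pairs \<rho>"
  have "set_form (indicator ?S) E E' H H'
      \<le> emeasure RZ E * ennreal (sqrt (24 * w\<^sup>2 / (\<rho> * \<delta>) * measure RZ E' * measure RZ H * measure RZ H'))"
  proof (rule quad_form_Cauchy_Schwarz[where A = A and B = B])
    fix y y' z assume y: "y \<in> A" "y' \<in> A" and z: "z \<in> B"
    show "(\<integral>\<^sup>+p. indicator A p * (indicator ?S (z + p, y, y') * indicator ?S (z + p, y, p)) \<partial>RZ)
        \<le> ennreal (24 * w\<^sup>2 / (\<rho> * \<delta>))"
    proof (cases "norm (embed_RZ (y - y')) \<le> \<rho>")
      case True
      then show ?thesis by (simp add: near_pairs_def)
    next
      case False
      let ?P = "{p \<in> {p \<in> A. (z + p, y, y') \<in> ?S}. (z + p, y, p) \<in> ?S}"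
      have P1 [measurable]: "{p \<in> A. (z + p, y, y') \<in> ?S} \<in> sets RZ"
        by (rule indicator_restrict_RZ) auto
      have "(\<integral>\<^sup>+p. indicator A p * (indicator ?S (z + p, y, y') * indicator ?S (z + p, y, p)) \<partial>RZ)
        = (\<integral>\<^sup>+p. indicator {p \<in> A. (z + p, y, y') \<in> ?S} p * indicator ?S (z + p, y, p) \<partial>RZ)"
        by (intro nn_integral_cong) (auto simp: indicator_def)
      also have "\<dots> = emeasure RZ ?P"
        by (rule indicator_restrict_RZ) auto
      also have "\<dots> \<le> ennreal (24 * w\<^sup>2 / (\<rho> * \<delta>))"
        using False
        by (intro high_count[OF sep assms(2,3) _ _ y z \<open>0 < \<rho>\<close>] indicator_restrict_RZ P1)
           (auto simp: resonant_iff)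
      finally show ?thesis .
    qed
  qed (use sub fin assms(2,3) \<open>0 < \<rho>\<close> in auto)
  then show ?thesis
    using fin by (simp add: emeasure_eq_ennreal_measure less_top ennreal_mult')
qed

section \<open>The estimate for indicator functions\<close>

definition layer_weight :: "real \<Rightarrow> real \<Rightarrow> real" where
  "layer_weight a b = min a b powr (5/6) * max a b powr (1/3)"

lemma layer_weight_nonneg [simp]: "0 \<le> layer_weight a b"
  by (simp add: layer_weight_def)

text \<open>Exponent arithmetic at the optimal \<rho>, with the constants 8 of the near part and 24
  of the far part: 2 * 8^(1/3) * 24^(1/3) \<le> 2 * 2 * 3 = 12.\<close>

lemma balanced_powers:
  fixes m M n N w \<delta> :: real
  assumes "0 < m" "0 < M" "0 < n" "0 < N" "0 < w" "0 < \<delta>"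
  shows "2 * ((8 * (w / \<delta>) * (m * n)) powr (1/3) *
      (w * sqrt (24 / \<delta>) * sqrt (m * M * (n * N)) * (m * n) powr (1/4)) powr (2/3))
    \<le> 12 * w * \<delta> powr (- (2/3)) * ((m powr (5/6) * M powr (1/3)) * (n powr (5/6) * N powr (1/3)))"
proof -
  have eight: "8 powr (1/3) = (2::real)"
    using powr_powr[of 2 3 "1/3"] by simp
  have twentyfour: "(24::real) powr (1/3) \<le> 3"
  proof -
    have "(24::real) powr (1/3) \<le> 27 powr (1/3)" by (rule powr_mono2) auto
    also have "(27::real) powr (1/3) = 3" using powr_powr[of 3 3 "1/3"] by simp
    finally show ?thesis .
  qed
  have "(8 * (w / \<delta>) * (m * n)) powr (1/3) *
      (w * sqrt (24 / \<delta>) * sqrt (m * M * (n * N)) * (m * n) powr (1/4)) powr (2/3)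
    = (8 powr (1/3) * w powr (1/3) * \<delta> powr (- (1/3)) * (m powr (1/3) * n powr (1/3))) *
      (w powr (2/3) * (24 powr (1/3) * \<delta> powr (- (1/3))) *
        (m powr (1/3) * M powr (1/3) * (n powr (1/3) * N powr (1/3))) * (m powr (1/6) * n powr (1/6)))"
    using assms
    by (simp add: powr_mult powr_divide powr_powr powr_half_sqrt[symmetric] powr_minus_divide)
  also have "\<dots> = 8 powr (1/3) * 24 powr (1/3) * (w powr (1/3) * w powr (2/3)) * (\<delta> powr (- (1/3)) * \<delta> powr (- (1/3))) *
      ((m powr (1/3) * m powr (1/3) * m powr (1/6)) * M powr (1/3) *
       ((n powr (1/3) * n powr (1/3) * n powr (1/6)) * N powr (1/3)))"
    by (simp only: mult_ac)
  also have "\<dots> = 8 powr (1/3) * 24 powr (1/3) * w * \<delta> powr (- (2/3)) *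
      ((m powr (5/6) * M powr (1/3)) * (n powr (5/6) * N powr (1/3)))"
    using assms by (simp only: powr_add[symmetric]) simp
  also have "\<dots> \<le> 2 * 3 * w * \<delta> powr (- (2/3)) *
      ((m powr (5/6) * M powr (1/3)) * (n powr (5/6) * N powr (1/3)))"
    unfolding eight using twentyfour assms by (intro mult_right_mono) auto
  finally show ?thesis by (simp add: mult_ac)
qed

theorem restricted_estimate:
  assumes sep: "separated \<delta> A B" and "0 < \<delta>" "\<delta> \<le> w"
    and AB [measurable]: "A \<in> sets RZ" "B \<in> sets RZ"
    and sets [measurable]: "E \<in> sets RZ" "E' \<in> sets RZ" "H \<in> sets RZ" "H' \<in> sets RZ"
    and sub: "E \<subseteq> A" "E' \<subseteq> A" "H \<subseteq> B" "H' \<subseteq> B"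
    and fin: "emeasure RZ E < \<infinity>" "emeasure RZ E' < \<infinity>" "emeasure RZ H < \<infinity>" "emeasure RZ H' < \<infinity>"
  shows "set_form (indicator (resonant w)) E E' H H'
    \<le> ennreal (12 * w * \<delta> powr (- (2/3)) *
         (layer_weight (measure RZ E) (measure RZ E') * layer_weight (measure RZ H) (measure RZ H')))"
proof -
  define \<alpha> \<alpha>' \<beta> \<beta>' where "\<alpha> = measure RZ E" and "\<alpha>' = measure RZ E'"
    and "\<beta> = measure RZ H" and "\<beta>' = measure RZ H'"
  have nn [simp]: "0 \<le> \<alpha>" "0 \<le> \<alpha>'" "0 \<le> \<beta>" "0 \<le> \<beta>'"
    by (simp_all add: \<alpha>_def \<alpha>'_def \<beta>_def \<beta>'_def)
  have em: "emeasure RZ E = ennreal \<alpha>" "emeasure RZ E' = ennreal \<alpha>'"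
    "emeasure RZ H = ennreal \<beta>" "emeasure RZ H' = ennreal \<beta>'"
    unfolding \<alpha>_def \<alpha>'_def \<beta>_def \<beta>'_def
    using fin by (auto intro!: emeasure_eq_ennreal_measure)
  have "0 < w" using assms(2,3) by linarith
  let ?q = "\<lambda>S. set_form (indicator S) E E' H H'"
  define m n M N where "m = min \<alpha> \<alpha>'" and "n = min \<beta> \<beta>'" and "M = max \<alpha> \<alpha>'" and "N = max \<beta> \<beta>'"
  define P Q where "P = 8 * (w / \<delta>) * (m * n)"
    and "Q = w * sqrt (24 / \<delta>) * sqrt (m * M * (n * N)) * (m * n) powr (1/4)"
  have mM: "m * M = \<alpha> * \<alpha>'" and nN: "n * N = \<beta> * \<beta>'" and [simp]: "0 \<le> m" "0 \<le> n" "0 \<le> M" "0 \<le> N"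
    by (auto simp: m_def M_def n_def N_def min_def max_def)
  have low: "?q (resonant w \<inter> near_pairs \<rho>) \<le> ennreal (P * \<rho>)" if "0 < \<rho>" for \<rho>
  proof -
    let ?S = "resonant w \<inter> near_pairs \<rho>"
    have sw: "?q ?S = quad_form (indicator ?S) (indicator E') (indicator E) (indicator H') (indicator H)"
      by (rule quad_form_swap_time) (auto simp: indicator_def resonant_sym near_pairs_sym)
    \<comment> \<open>Four bounds result: \<alpha> \<beta> and \<alpha> \<beta>' directly, \<alpha>'
      \<beta>' and \<alpha>' \<beta> after exchanging y and y'. The least of these products is m
      n.\<close>
    note l = low_part[OF sep assms(2,3) that AB(1) sets sub]
      low_part[OF sep assms(2,3) that AB(1) sets(2,1,4,3) sub(2,1,4,3), folded sw]
    have "?q ?S \<le> ennreal (8 * \<rho> * (w / \<delta>)) * (ennreal m * ennreal n)"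
      using l unfolding em m_def n_def by (auto simp: min_def)
    also have "\<dots> = ennreal (P * \<rho>)"
      using \<open>0 < w\<close> \<open>0 < \<delta>\<close> that by (simp add: P_def ennreal_mult[symmetric] mult_ac)
    finally show ?thesis .
  qed
  have high: "?q (resonant w - near_pairs \<rho>) \<le> ennreal (Q / sqrt \<rho>)" if "0 < \<rho>" for \<rho>
  proof -
    let ?S = "resonant w - near_pairs \<rho>"
    define R where "R = w * sqrt (24 / \<delta>) * sqrt (m * M * (n * N)) / sqrt \<rho>"
    have "0 \<le> R" using \<open>0 < w\<close> \<open>0 < \<delta>\<close> that by (simp add: R_def)
    have R: "a * sqrt (24 * w\<^sup>2 / (\<rho> * \<delta>) * b * c * d) = R * sqrt a"
      if "0 \<le> a" "0 \<le> b" "0 \<le> c" "0 \<le> d" "a * b * (c * d) = m * M * (n * N)" for a b c d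
    proof -
      have "a = sqrt a * sqrt a" using that by simp
      then have "a * sqrt (24 * w\<^sup>2 / (\<rho> * \<delta>) * b * c * d) = sqrt a * (sqrt a * sqrt (24 * w\<^sup>2 / (\<rho> * \<delta>) * b * c * d))"
        by (metis mult.assoc)
      also have "sqrt a * sqrt (24 * w\<^sup>2 / (\<rho> * \<delta>) * b * c * d) = sqrt (w\<^sup>2 * (24 / \<delta>) * (a * b * (c * d)) / \<rho>)"
        by (simp add: real_sqrt_mult[symmetric] mult_ac)
      also have "\<dots> = R"
        using \<open>0 < w\<close> unfolding that R_def by (simp add: real_sqrt_mult real_sqrt_divide)
      finally show ?thesis by simp
    qed
    have sw: "?q ?S = quad_form (indicator ?S) (indicator E') (indicator E) (indicator H') (indicator H)"
      by (rule quad_form_swap_time) (auto simp: indicator_def resonant_sym near_pairs_sym)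
    have sw2: "?q ?S = quad_form (indicator ?S) (indicator H) (indicator H') (indicator E) (indicator E')"
      by (rule quad_form_swap_space) (auto simp: indicator_def resonant_sym near_pairs_sym)
    have sw3: "?q ?S = quad_form (indicator ?S) (indicator H') (indicator H) (indicator E') (indicator E)"
      unfolding sw2
      by (rule quad_form_swap_time) (auto simp: indicator_def resonant_sym near_pairs_sym)
    have h: "?q ?S \<le> ennreal (R * sqrt \<alpha>)" "?q ?S \<le> ennreal (R * sqrt \<alpha>')"
      "?q ?S \<le> ennreal (R * sqrt \<beta>)" "?q ?S \<le> ennreal (R * sqrt \<beta>')"
    proof -
      have R1: "\<alpha> * sqrt (24 * w\<^sup>2 / (\<rho> * \<delta>) * \<alpha>' * \<beta> * \<beta>') = R * sqrt \<alpha>"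
        by (rule R[OF nn(1,2,3,4)], unfold mM nN, simp only: mult_ac)
      have R2: "\<alpha>' * sqrt (24 * w\<^sup>2 / (\<rho> * \<delta>) * \<alpha> * \<beta>' * \<beta>) = R * sqrt \<alpha>'"
        by (rule R[OF nn(2,1,4,3)], unfold mM nN, simp only: mult_ac)
      have R3: "\<beta> * sqrt (24 * w\<^sup>2 / (\<rho> * \<delta>) * \<beta>' * \<alpha> * \<alpha>') = R * sqrt \<beta>"
        by (rule R[OF nn(3,4,1,2)], unfold mM nN, simp only: mult_ac)
      have R5: "\<beta>' * sqrt (24 * w\<^sup>2 / (\<rho> * \<delta>) * \<beta> * \<alpha>' * \<alpha>) = R * sqrt \<beta>'"
        by (rule R[OF nn(4,3,2,1)], unfold mM nN, simp only: mult_ac)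
      note R4 = R1 R2 R3 R5
      show "?q ?S \<le> ennreal (R * sqrt \<alpha>)"
        using high_part[OF sep assms(2,3) that AB(1) sets sub fin] unfolding \<alpha>_def[symmetric] \<alpha>'_def[symmetric] \<beta>_def[symmetric] \<beta>'_def[symmetric] R4 .
      show "?q ?S \<le> ennreal (R * sqrt \<alpha>')"
        using high_part[OF sep assms(2,3) that AB(1) sets(2,1,4,3) sub(2,1,4,3) fin(2,1,4,3)]
        unfolding sw[symmetric] \<alpha>_def[symmetric] \<alpha>'_def[symmetric] \<beta>_def[symmetric] \<beta>'_def[symmetric] R4 .
      show "?q ?S \<le> ennreal (R * sqrt \<beta>)"
        using high_part[OF separated_commute[OF sep] assms(2,3) that AB(2) sets(3,4,1,2) sub(3,4,1,2) fin(3,4,1,2)]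
        unfolding sw2[symmetric] \<alpha>_def[symmetric] \<alpha>'_def[symmetric] \<beta>_def[symmetric] \<beta>'_def[symmetric] R4 .
      show "?q ?S \<le> ennreal (R * sqrt \<beta>')"
        using high_part[OF separated_commute[OF sep] assms(2,3) that AB(2) sets(4,3,2,1) sub(4,3,2,1) fin(4,3,2,1)]
        unfolding sw3[symmetric] \<alpha>_def[symmetric] \<alpha>'_def[symmetric] \<beta>_def[symmetric] \<beta>'_def[symmetric] R4 .
    qed
    have "?q ?S \<le> ennreal (R * sqrt (min m n))"
      using h unfolding m_def n_def by (auto simp: min_def)
    \<comment> \<open>The minimum over all four measures is weakened to a quantity that factors into
      a part for E, E' and a part for H, H'. The two pairs of levels can then be integrated
      separately.\<close>
    also have "\<dots> \<le> ennreal (R * (m * n) powr (1/4))"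
    proof (intro ennreal_leI mult_left_mono \<open>0 \<le> R\<close>)
      have "min m n * min m n \<le> m * n"
        by (intro mult_mono) auto
      then have "(min m n * min m n) powr (1/4) \<le> (m * n) powr (1/4)"
        by (intro powr_mono2) auto
      moreover have "(min m n * min m n) powr (1/4) = sqrt (min m n)"
        by (cases "min m n = 0") (simp_all add: powr_mult powr_add[symmetric] powr_half_sqrt)
      ultimately show "sqrt (min m n) \<le> (m * n) powr (1/4)" by simp
    qed
    also have "R * (m * n) powr (1/4) = Q / sqrt \<rho>"
      by (simp add: R_def Q_def)
    finally show ?thesis .
  qed
  have bound: "?q (resonant w) \<le> ennreal (P * \<rho> + Q / sqrt \<rho>)" if "0 < \<rho>" for \<rho>
  proof -
    have "?q (resonant w) = quad_form (\<lambda>x. indicator (resonant w \<inter> near_pairs \<rho>) x + indicator (resonant w - near_pairs \<rho>) x)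
        (indicator E) (indicator E') (indicator H) (indicator H')"
      by (rule arg_cong[where f = "\<lambda>K. quad_form K _ _ _ _"]) (auto simp: indicator_def fun_eq_iff)
    also have "\<dots> = ?q (resonant w \<inter> near_pairs \<rho>) + ?q (resonant w - near_pairs \<rho>)"
      by (rule quad_form_add) auto
    also have "\<dots> \<le> ennreal (P * \<rho>) + ennreal (Q / sqrt \<rho>)"
      by (intro add_mono low high that)
    also have "\<dots> = ennreal (P * \<rho> + Q / sqrt \<rho>)"
      using that \<open>0 < w\<close> \<open>0 < \<delta>\<close> by (intro ennreal_plus[symmetric]) (auto simp: P_def Q_def)
    finally show ?thesis .
  qed
  define \<phi> where "\<phi> = enn2real (?q (resonant w))"
  have "?q (resonant w) < \<infinity>"
    using bound[of 1] by (simp add: order.strict_trans1)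
  then have q: "?q (resonant w) = ennreal \<phi>"
    by (simp add: \<phi>_def)
  have PQ: "0 \<le> P" "0 \<le> Q"
    using \<open>0 < w\<close> \<open>0 < \<delta>\<close> by (auto simp: P_def Q_def)
  have \<phi>: "\<phi> \<le> P * \<rho> + Q / sqrt \<rho>" if "0 < \<rho>" for \<rho>
    using bound[OF that] that PQ unfolding q by (subst (asm) ennreal_le_iff) auto
  have "\<phi> \<le> 12 * w * \<delta> powr (- (2/3)) * (layer_weight \<alpha> \<alpha>' * layer_weight \<beta> \<beta>')"
  proof (cases "m = 0 \<or> n = 0")
    \<comment> \<open>Here \<open>P\<close> and \<open>Q\<close> both vanish, so there is nothing to
      balance and any \<rho> gives the bound 0.\<close>
    case True
    then have "\<phi> \<le> 0"
      using \<phi>[of 1] by (auto simp: P_def Q_def)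
    also have "0 \<le> 12 * w * \<delta> powr (- (2/3)) * (layer_weight \<alpha> \<alpha>' * layer_weight \<beta> \<beta>')"
      using \<open>0 < w\<close> by simp
    finally show ?thesis .
  next
    case False
    then have "0 < m" "0 < n"
      by (simp_all add: less_le)
    moreover have "m \<le> M" "n \<le> N"
      by (auto simp: m_def n_def M_def N_def)
    ultimately have pos: "0 < m" "0 < n" "0 < M" "0 < N"
      by linarith+
    then have "0 < P" "0 < Q"
      using \<open>0 < w\<close> \<open>0 < \<delta>\<close> by (auto simp: P_def Q_def)
    then have "\<phi> \<le> 2 * (P powr (1/3) * Q powr (2/3))"
      using \<phi> by (intro le_balanced_power)
    also have "\<dots> \<le> 12 * w * \<delta> powr (- (2/3)) * ((m powr (5/6) * M powr (1/3)) * (n powr (5/6) * N powr (1/3)))"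
      unfolding P_def Q_def using pos \<open>0 < w\<close> \<open>0 < \<delta>\<close> by (intro balanced_powers)
    finally show ?thesis
      by (simp add: layer_weight_def m_def n_def M_def N_def)
  qed
  then show ?thesis
    unfolding q \<alpha>_def \<alpha>'_def \<beta>_def \<beta>'_def by (intro ennreal_leI)
qed

section \<open>Layer cake decomposition\<close>

lemma nn_integral_powr_from_0:
  fixes e x :: real
  assumes "- 1 < e" "0 \<le> x"
  shows "(\<integral>\<^sup>+v. ennreal (v powr e) * indicator {0<..x} v \<partial>lborel) = ennreal (x powr (e + 1) / (e + 1))"
proof -
  have "(\<integral>\<^sup>+v. ennreal (v powr e) * indicator {0<..x} v \<partial>lborel)
      = (\<integral>\<^sup>+v. ennreal (v powr e) * indicator {0..x} v \<partial>lborel)"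
    by (intro nn_integral_cong) (auto simp: indicator_def)
  also have "\<dots> = ennreal (x powr (e + 1) / (e + 1))"
    by (rule nn_integral_has_integral_lebesgue'[OF _ has_integral_powr_from_0[OF assms]]) auto
  finally show ?thesis .
qed

lemma nn_integral_powr_to_inf:
  fixes e x :: real
  assumes "e < - 1" "0 < x"
  shows "(\<integral>\<^sup>+u. ennreal (u powr e) * indicator {x..} u \<partial>lborel) = ennreal (- (x powr (e + 1)) / (e + 1))"
  by (rule nn_integral_has_integral_lebesgue'[OF _ has_integral_powr_to_inf[OF assms]]) auto

text \<open>a and b stand for the measures at the levels u \<ge> v. One half b^(1/6) of b^(1/3) goes
  to Chebyshev. The rest, a^(5/6) b^(1/6), is a weighted geometric mean of \<open>X\<close> and
  \<open>Y\<close>, whose weights cancel since 1/2 * 5/6 = 5/2 * 1/6. They are inserted to make the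
  powers integrable: v^(-11/14) at 0 and u^(-5/2) at infinity.\<close>

lemma layer_weight_pointwise:
  fixes a b u v I :: real
  assumes "0 < v" "v \<le> u" "0 \<le> a" "0 \<le> b" "0 \<le> I" and b: "b \<le> I * v powr (- 12/7)"
  shows "a powr (5/6) * b powr (1/3) \<le>
    I powr (1/6) * (a * (u powr (1/2) * v powr (- 11/14)) + b * (v powr (31/14) * u powr (- 5/2)))"
proof (cases "a = 0 \<or> b = 0")
  case True
  then show ?thesis using assms by auto
next
  case False
  then have "0 < a" "0 < b" "0 < u" using assms by auto
  define X Y where "X = a * (u powr (1/2) * v powr (- 1/2))" and "Y = b * (v powr (5/2) * u powr (- 5/2))"
  have pos: "0 < X" "0 < Y"
    using \<open>0 < a\<close> \<open>0 < b\<close> \<open>0 < u\<close> \<open>0 < v\<close> by (auto simp: X_def Y_def)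
  have "a powr (5/6) * b powr (1/6) = X powr (5/6) * Y powr (1/6)"
  proof -
    have "X powr (5/6) = a powr (5/6) * (u powr (5/12) * v powr (- 5/12))"
      "Y powr (1/6) = b powr (1/6) * (v powr (5/12) * u powr (- 5/12))"
      using \<open>0 < a\<close> \<open>0 < b\<close> \<open>0 < u\<close> \<open>0 < v\<close> by (simp_all add: X_def Y_def powr_mult powr_powr)
    then have "X powr (5/6) * Y powr (1/6) = a powr (5/6) * b powr (1/6) *
        ((u powr (5/12) * u powr (- 5/12)) * (v powr (5/12) * v powr (- 5/12)))"
      by (simp only: mult_ac)
    also have "u powr (5/12) * u powr (- 5/12) = 1"
      using \<open>0 < u\<close> by (simp add: powr_add[symmetric])
    also have "v powr (5/12) * v powr (- 5/12) = 1"
      using \<open>0 < v\<close> by (simp add: powr_add[symmetric])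
    finally show ?thesis by simp
  qed
  also have "\<dots> \<le> max X Y powr (5/6) * max X Y powr (1/6)"
    using pos by (intro mult_mono powr_mono2) auto
  also have "\<dots> = max X Y"
    using pos by (simp add: powr_add[symmetric])
  also have "\<dots> \<le> X + Y"
    using pos by simp
  finally have AMGM: "a powr (5/6) * b powr (1/6) \<le> X + Y" .
  have "b powr (1/6) \<le> (I * v powr (- 12/7)) powr (1/6)"
    using b \<open>0 < b\<close> by (intro powr_mono2) auto
  also have "\<dots> = I powr (1/6) * v powr (- 2/7)"
    using \<open>0 \<le> I\<close> by (simp add: powr_mult powr_powr)
  finally have cheb: "b powr (1/6) \<le> I powr (1/6) * v powr (- 2/7)" .
  have "a powr (5/6) * b powr (1/3) = (a powr (5/6) * b powr (1/6)) * b powr (1/6)"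
    by (simp add: powr_add[symmetric] mult.assoc)
  also have "\<dots> \<le> (X + Y) * (I powr (1/6) * v powr (- 2/7))"
    using AMGM cheb pos by (intro mult_mono) auto
  also have "\<dots> = I powr (1/6) * (X * v powr (- 2/7) + Y * v powr (- 2/7))"
    by (simp add: algebra_simps)
  also have "X * v powr (- 2/7) = a * (u powr (1/2) * v powr (- 11/14))"
    by (simp add: X_def mult.assoc powr_add[symmetric])
  also have "Y * v powr (- 2/7) = b * ((v powr (5/2) * v powr (- 2/7)) * u powr (- 5/2))"
    by (simp add: Y_def mult_ac)
  also have "v powr (5/2) * v powr (- 2/7) = v powr (31/14)"
    by (simp add: powr_add[symmetric])
  finally show ?thesis .
qed

text \<open>Here the endpoint exponent is reached. The exponents of \<^const>\<open>layer_weight\<close> add up to \<open>7/6\<close>: the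
  excess \<open>1/6\<close> over \<open>1\<close> is spent on Chebyshev's inequality, and the asymmetry of \<open>5/6\<close> and \<open>1/3\<close>
  makes the remaining double integral decay geometrically away from \<open>s = s'\<close>.\<close>

lemma nn_integral_layer_weight:
  fixes \<phi> :: "real \<Rightarrow> real" and I :: real
  assumes [measurable]: "\<phi> \<in> borel_measurable borel" and nonneg: "\<And>s. 0 \<le> \<phi> s"
    and anti: "\<And>u v. 0 < v \<Longrightarrow> v \<le> u \<Longrightarrow> \<phi> u \<le> \<phi> v"
    and "0 \<le> I" and cheb: "\<And>v. 0 < v \<Longrightarrow> \<phi> v \<le> I * v powr (- 12/7)"
    and int: "(\<integral>\<^sup>+s. ennreal (\<phi> s * s powr (5/7)) * indicator {0<..} s \<partial>lborel) = ennreal (7/12 * I)"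
  shows "(\<integral>\<^sup>+s. \<integral>\<^sup>+s'. ennreal (layer_weight (\<phi> s) (\<phi> s')) * (indicator {0<..} s * indicator {0<..} s') \<partial>lborel \<partial>lborel)
    \<le> ennreal (7 * I powr (7/6))"
proof -
  \<comment> \<open>The two summands of \<open>layer_weight_pointwise\<close>, with 0 < v \<le> u
    written into the variable that is integrated first: v up to u in \<open>g1\<close>, u from v
    onwards in \<open>g2\<close>. Either way the power s^(5/7) = s^(p - 1) remains, as 1/2 + 3/14 =
    31/14 - 3/2 = 5/7.\<close>
  define g1 g2 where
    "g1 u v = ennreal (\<phi> u * u powr (1/2)) * (ennreal (v powr (- 11/14)) * indicator {0<..u} v)"
    and "g2 u v = ennreal (\<phi> v * v powr (31/14)) * indicator {0<..} v * (ennreal (u powr (- 5/2)) * indicator {v..} u)"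
    for u v :: real
  have joint [measurable]: "(\<lambda>(u, v). g1 u v) \<in> borel_measurable (borel \<Otimes>\<^sub>M borel)"
    "(\<lambda>(u, v). g2 u v) \<in> borel_measurable (borel \<Otimes>\<^sub>M borel)"
  proof -
    have "(\<lambda>(u, v). ennreal (\<phi> u * u powr (1/2)) * (if 0 < v \<and> v \<le> u then ennreal (v powr (- 11/14)) else 0))
        \<in> borel_measurable (borel \<Otimes>\<^sub>M borel)"
      by measurable
    then show "(\<lambda>(u, v). g1 u v) \<in> borel_measurable (borel \<Otimes>\<^sub>M borel)"
      by (rule measurable_cong[THEN iffD1, rotated]) (auto simp: g1_def indicator_def)
    have "(\<lambda>(u, v). ennreal (\<phi> v * v powr (31/14)) * (if 0 < v \<and> v \<le> u then ennreal (u powr (- 5/2)) else 0))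
        \<in> borel_measurable (borel \<Otimes>\<^sub>M borel)"
      by measurable
    then show "(\<lambda>(u, v). g2 u v) \<in> borel_measurable (borel \<Otimes>\<^sub>M borel)"
      by (rule measurable_cong[THEN iffD1, rotated]) (auto simp: g2_def indicator_def)
  qed
  have [measurable]: "(\<lambda>u. g1 u v) \<in> borel_measurable borel" "(\<lambda>v. g1 u v) \<in> borel_measurable borel"
    "(\<lambda>u. g2 u v) \<in> borel_measurable borel" "(\<lambda>v. g2 u v) \<in> borel_measurable borel" for u v
    using joint[THEN measurable_Pair1, of v] joint[THEN measurable_Pair2, of u] by simp_all
  define g where "g u v = ennreal (I powr (1/6)) * (g1 u v + g2 u v)" for u v
  have [measurable]: "(\<lambda>(u, v). g u v) \<in> borel_measurable (borel \<Otimes>\<^sub>M borel)"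
    unfolding g_def by measurable
  have [measurable]: "(\<lambda>u. g u v) \<in> borel_measurable borel" "(\<lambda>v. g u v) \<in> borel_measurable borel" for u v
    unfolding g_def by measurable
  have split: "ennreal (i * (x * (p * q) + y * (r * t))) = ennreal i * (ennreal (x * p) * ennreal q + ennreal (y * r) * ennreal t)"
    if "0 \<le> i" "0 \<le> x" "0 \<le> p" "0 \<le> q" "0 \<le> y" "0 \<le> r" "0 \<le> t" for i x p q y r t
    using that by (simp add: ennreal_mult ennreal_plus mult.assoc)
  have half: "ennreal (layer_weight (\<phi> u) (\<phi> v)) \<le> g u v" if "0 < v" "v \<le> u" for u v
  proof -
    have "layer_weight (\<phi> u) (\<phi> v) = \<phi> u powr (5/6) * \<phi> v powr (1/3)"
      using anti[OF that] by (simp add: layer_weight_def)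
    also have "\<dots> \<le> I powr (1/6) *
        (\<phi> u * (u powr (1/2) * v powr (- 11/14)) + \<phi> v * (v powr (31/14) * u powr (- 5/2)))"
      using that nonneg \<open>0 \<le> I\<close> cheb by (intro layer_weight_pointwise) auto
    finally have "ennreal (layer_weight (\<phi> u) (\<phi> v)) \<le> ennreal (I powr (1/6) *
        (\<phi> u * (u powr (1/2) * v powr (- 11/14)) + \<phi> v * (v powr (31/14) * u powr (- 5/2))))"
      by (rule ennreal_leI)
    also have "\<dots> = g u v"
      unfolding g_def g1_def g2_def using that
      by (subst split, auto simp: nonneg)
    finally show ?thesis .
  qed
  have "(\<integral>\<^sup>+s. \<integral>\<^sup>+s'. ennreal (layer_weight (\<phi> s) (\<phi> s')) * (indicator {0<..} s * indicator {0<..} s') \<partial>lborel \<partial>lborel)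
    \<le> (\<integral>\<^sup>+s. \<integral>\<^sup>+s'. g s s' + g s' s \<partial>lborel \<partial>lborel)"
  proof (intro nn_integral_mono)
    fix s s' :: real
    have comm: "layer_weight (\<phi> s) (\<phi> s') = layer_weight (\<phi> s') (\<phi> s)"
      by (simp add: layer_weight_def min.commute max.commute)
    show "ennreal (layer_weight (\<phi> s) (\<phi> s')) * (indicator {0<..} s * indicator {0<..} s') \<le> g s s' + g s' s"
    proof (cases "0 < s \<and> 0 < s'")
      case True
      then consider "s' \<le> s" | "s \<le> s'" by linarith
      then show ?thesis
      proof cases
        case 1
        then show ?thesis using True half[of s' s] by (simp add: add_increasing2)
      next
        case 2
        then show ?thesis using True half[of s s'] by (simp add: add_increasing comm)
      qed
    qed auto
  qed
  also have "\<dots> = (\<integral>\<^sup>+s. \<integral>\<^sup>+s'. g s s' \<partial>lborel \<partial>lborel) + (\<integral>\<^sup>+s. \<integral>\<^sup>+s'. g s' s \<partial>lborel \<partial>lborel)"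
    by (simp add: nn_integral_add)
  also have "(\<integral>\<^sup>+s. \<integral>\<^sup>+s'. g s' s \<partial>lborel \<partial>lborel) = (\<integral>\<^sup>+s. \<integral>\<^sup>+s'. g s s' \<partial>lborel \<partial>lborel)"
    by (rule lborel_pair.Fubini') simp
  also have "(\<integral>\<^sup>+s. \<integral>\<^sup>+s'. g s s' \<partial>lborel \<partial>lborel)
      = ennreal (I powr (1/6)) * ((\<integral>\<^sup>+u. \<integral>\<^sup>+v. g1 u v \<partial>lborel \<partial>lborel) + (\<integral>\<^sup>+u. \<integral>\<^sup>+v. g2 u v \<partial>lborel \<partial>lborel))"
    unfolding g_def by (simp add: nn_integral_cmult nn_integral_add)
  also have "(\<integral>\<^sup>+u. \<integral>\<^sup>+v. g1 u v \<partial>lborel \<partial>lborel) = ennreal (14/3) * ennreal (7/12 * I)"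
  proof -
    have "(\<integral>\<^sup>+v. g1 u v \<partial>lborel) = ennreal (14/3) * (ennreal (\<phi> u * u powr (5/7)) * indicator {0<..} u)" for u
    proof (cases "0 < u")
      case True
      have "(\<integral>\<^sup>+v. g1 u v \<partial>lborel) = ennreal (\<phi> u * u powr (1/2)) * ennreal (u powr (3/14) / (3/14))"
        unfolding g1_def using True by (simp add: nn_integral_cmult nn_integral_powr_from_0)
      also have "\<dots> = ennreal (14/3 * (\<phi> u * (u powr (1/2) * u powr (3/14))))"
        using nonneg by (simp add: ennreal_mult[symmetric] mult_ac)
      also have "u powr (1/2) * u powr (3/14) = u powr (5/7)"
        by (simp add: powr_add[symmetric])
      finally show ?thesis
        using True nonneg by (simp add: ennreal_mult[symmetric])
    qed (simp add: g1_def)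
    then show ?thesis
      unfolding int[symmetric] by (simp add: nn_integral_cmult)
  qed
  also have "(\<integral>\<^sup>+u. \<integral>\<^sup>+v. g2 u v \<partial>lborel \<partial>lborel) = ennreal (2/3) * ennreal (7/12 * I)"
  proof -
    have "(\<integral>\<^sup>+u. g2 u v \<partial>lborel) = ennreal (2/3) * (ennreal (\<phi> v * v powr (5/7)) * indicator {0<..} v)" for v
    proof (cases "0 < v")
      case True
      have "(\<integral>\<^sup>+u. g2 u v \<partial>lborel) = ennreal (\<phi> v * v powr (31/14)) * ennreal (- (v powr (- 3/2)) / (- 3/2))"
        unfolding g2_def using True by (simp add: nn_integral_cmult nn_integral_powr_to_inf)
      also have "\<dots> = ennreal (2/3 * (\<phi> v * (v powr (31/14) * v powr (- 3/2))))"
        using nonneg by (subst ennreal_mult[symmetric]) (auto simp: mult_ac)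
      also have "v powr (31/14) * v powr (- 3/2) = v powr (5/7)"
        by (simp add: powr_add[symmetric])
      finally show ?thesis
        using True nonneg by (simp add: ennreal_mult[symmetric])
    qed (simp add: g2_def)
    then have "(\<integral>\<^sup>+v. \<integral>\<^sup>+u. g2 u v \<partial>lborel \<partial>lborel) = ennreal (2/3) * ennreal (7/12 * I)"
      unfolding int[symmetric] by (simp add: nn_integral_cmult)
    then show ?thesis
      by (subst (asm) lborel_pair.Fubini') simp_all
  qed
  \<comment> \<open>56/9 = 2 * (14/3 + 2/3) * 7/12, where 2 counts the two orders of s and
    s'.\<close>
  also have "ennreal (I powr (1/6)) * (ennreal (14/3) * ennreal (7/12 * I) + ennreal (2/3) * ennreal (7/12 * I)) +
      ennreal (I powr (1/6)) * (ennreal (14/3) * ennreal (7/12 * I) + ennreal (2/3) * ennreal (7/12 * I))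
    = ennreal (56/9 * (I powr (1/6) * I powr 1))"
    using \<open>0 \<le> I\<close> by (simp add: ennreal_mult[symmetric] ennreal_plus[symmetric] algebra_simps del: ennreal_plus)
  also have "\<dots> \<le> ennreal (7 * I powr (7/6))"
    unfolding powr_add[symmetric] by (intro ennreal_leI) simp
  finally show ?thesis .
qed

section \<open>Layer cake in the slots of the form\<close>

text \<open>With y outermost the form becomes the integral of its first function against a density,
  which is the shape required by \<open>layer_cake_slot\<close>.\<close>

lemma quad_form_slot:
  assumes [measurable]: "K \<in> borel_measurable RZ3"
    "f \<in> borel_measurable RZ" "f' \<in> borel_measurable RZ" "g \<in> borel_measurable RZ" "g' \<in> borel_measurable RZ"
  shows "quad_form K f f' g g' =
    (\<integral>\<^sup>+y. f y * (\<integral>\<^sup>+\<zeta>. \<integral>\<^sup>+y'. g (\<zeta> - y) * (f' y' * g' (\<zeta> - y')) * K (\<zeta>, y, y') \<partial>RZ \<partial>RZ) \<partial>RZ)"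
  unfolding quad_form_def
  by (subst nn_integral_RZ_swap) (simp_all add: nn_integral_cmult[symmetric] mult.assoc)

definition superlevel :: "(real \<times> int \<Rightarrow> real) \<Rightarrow> real \<Rightarrow> (real \<times> int) set" where
  "superlevel a s = {y. s < a y}"

lemma sets_superlevel [measurable]:
  assumes [measurable]: "a \<in> borel_measurable RZ"
  shows "superlevel a s \<in> sets RZ"
proof -
  have "{y \<in> space RZ. s < a y} \<in> sets RZ" by measurable
  then show ?thesis by (simp add: superlevel_def)
qed

text \<open>The value a y is the length of the interval of levels 0 < s < a y; Tonelli moves the
  integral over the levels outside.\<close>

lemma layer_cake_slot:
  assumes a [measurable]: "a \<in> borel_measurable RZ" and k [measurable]: "k \<in> borel_measurable RZ"
    and nonneg: "\<And>y. 0 \<le> a y"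
  shows "(\<integral>\<^sup>+y. ennreal (a y) * k y \<partial>RZ)
    = (\<integral>\<^sup>+s. (\<integral>\<^sup>+y. indicator (superlevel a s) y * k y \<partial>RZ) * indicator {0<..} s \<partial>lborel)"
proof -
  interpret pair_sigma_finite lborel RZ ..
  have [measurable]: "(\<lambda>(s, y). indicator (superlevel a s) y * k y * indicator {0<..} s :: ennreal) \<in> borel_measurable (lborel \<Otimes>\<^sub>M RZ)"
  proof -
    have "(\<lambda>(s, y). (if 0 < s \<and> s < a y then k y else 0)) \<in> borel_measurable (lborel \<Otimes>\<^sub>M RZ)"
      by measurable
    then show ?thesis
      by (rule measurable_cong[THEN iffD1, rotated]) (auto simp: superlevel_def indicator_def)
  qed
  have "(\<integral>\<^sup>+y. ennreal (a y) * k y \<partial>RZ)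
      = (\<integral>\<^sup>+y. \<integral>\<^sup>+s. indicator (superlevel a s) y * k y * indicator {0<..} s \<partial>lborel \<partial>RZ)"
  proof (rule nn_integral_cong)
    fix y
    have "(\<integral>\<^sup>+s. indicator (superlevel a s) y * k y * indicator {0<..} s \<partial>lborel)
        = (\<integral>\<^sup>+s. indicator {0<..<a y} s * k y \<partial>lborel)"
      by (intro nn_integral_cong) (auto simp: superlevel_def indicator_def)
    also have "\<dots> = ennreal (a y) * k y"
      using nonneg by (simp add: nn_integral_multc)
    finally show "ennreal (a y) * k y = (\<integral>\<^sup>+s. indicator (superlevel a s) y * k y * indicator {0<..} s \<partial>lborel)" ..
  qed
  also have "\<dots> = (\<integral>\<^sup>+s. \<integral>\<^sup>+y. indicator (superlevel a s) y * k y * indicator {0<..} s \<partial>RZ \<partial>lborel)"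
    by (rule Fubini') measurable
  finally show ?thesis
    by (simp add: nn_integral_multc)
qed

lemma quad_form_layer_cake_first:
  assumes [measurable]: "K \<in> borel_measurable RZ3" "a \<in> borel_measurable RZ"
    "f' \<in> borel_measurable RZ" "g \<in> borel_measurable RZ" "g' \<in> borel_measurable RZ"
    and "\<And>y. 0 \<le> a y"
  shows "quad_form K (\<lambda>y. ennreal (a y)) f' g g' =
    (\<integral>\<^sup>+s. quad_form K (indicator (superlevel a s)) f' g g' * indicator {0<..} s \<partial>lborel)"
  by (simp add: quad_form_slot layer_cake_slot assms(6))

lemma emeasure_superlevel_Chebyshev:
  assumes [measurable]: "a \<in> borel_measurable RZ" and nonneg: "\<And>y. 0 \<le> a y" and "0 \<le> I" "0 < s" "0 < p"
    and I: "(\<integral>\<^sup>+y. ennreal (a y powr p) \<partial>RZ) = ennreal I"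
  shows "emeasure RZ (superlevel a s) \<le> ennreal (I * s powr (- p))"
proof -
  have "ennreal (s powr p) * emeasure RZ (superlevel a s) = (\<integral>\<^sup>+y. ennreal (s powr p) * indicator (superlevel a s) y \<partial>RZ)"
    by (simp add: nn_integral_cmult)
  also have "\<dots> \<le> ennreal I"
    unfolding I[symmetric] using \<open>0 < s\<close> \<open>0 < p\<close>
    by (intro nn_integral_mono) (auto simp: indicator_def superlevel_def intro!: ennreal_leI powr_mono2)
  finally have "ennreal (s powr (- p)) * (ennreal (s powr p) * emeasure RZ (superlevel a s)) \<le> ennreal (s powr (- p)) * ennreal I"
    by (rule mult_left_mono) simp
  moreover have "ennreal (s powr (- p)) * ennreal (s powr p) = 1"
    using \<open>0 < s\<close> by (simp add: ennreal_mult[symmetric] powr_add[symmetric])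
  ultimately show ?thesis
    using \<open>0 \<le> I\<close> by (simp add: mult.assoc[symmetric] ennreal_mult[symmetric] mult.commute)
qed

lemma nn_integral_layer_weight_superlevel:
  assumes [measurable]: "a \<in> borel_measurable RZ" and nonneg: "\<And>y. 0 \<le> a y" and "0 \<le> I"
    and I: "(\<integral>\<^sup>+y. ennreal (a y powr (12/7)) \<partial>RZ) = ennreal I"
  shows "(\<lambda>s. measure RZ (superlevel a s)) \<in> borel_measurable borel" (is ?meas)
    and "(\<integral>\<^sup>+s. \<integral>\<^sup>+s'. ennreal (layer_weight (measure RZ (superlevel a s)) (measure RZ (superlevel a s'))) *
        (indicator {0<..} s * indicator {0<..} s') \<partial>lborel \<partial>lborel) \<le> ennreal (7 * I powr (7/6))" (is ?bound)
proof -
  let ?\<phi> = "\<lambda>s. measure RZ (superlevel a s)"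
  interpret pair_sigma_finite lborel RZ ..
  have [measurable]: "(\<lambda>(s, y). indicator (superlevel a s) y :: ennreal) \<in> borel_measurable (lborel \<Otimes>\<^sub>M RZ)"
  proof -
    have "(\<lambda>(s, y). (if s < a y then 1 else 0 :: ennreal)) \<in> borel_measurable (lborel \<Otimes>\<^sub>M RZ)"
      by measurable
    then show ?thesis
      by (rule measurable_cong[THEN iffD1, rotated]) (auto simp: superlevel_def indicator_def)
  qed
  have "(\<lambda>s. enn2real (\<integral>\<^sup>+y. indicator (superlevel a s) y \<partial>RZ)) \<in> borel_measurable lborel"
    by measurable
  then show \<phi>_meas [measurable]: ?meas
    by (simp add: measure_def)
  have cheb: "emeasure RZ (superlevel a s) \<le> ennreal (I * s powr (- 12/7))" if "0 < s" for s
    using emeasure_superlevel_Chebyshev[of a I s "12/7"] assms that by simp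
  \<comment> \<open>At levels s \<le> 0 a superlevel set may have infinite measure, where
    \<open>measure\<close> returns 0. All identities are therefore confined to 0 < s.\<close>
  then have fin: "emeasure RZ (superlevel a s) < \<infinity>" if "0 < s" for s
    using that by (force simp: order.strict_trans1)
  then have em: "emeasure RZ (superlevel a s) = ennreal (?\<phi> s)" if "0 < s" for s
    using that by (intro emeasure_eq_ennreal_measure) force
  show ?bound
  proof (rule nn_integral_layer_weight)
    show "?\<phi> u \<le> ?\<phi> v" if "0 < v" "v \<le> u" for u v
    proof -
      have "emeasure RZ (superlevel a u) \<le> emeasure RZ (superlevel a v)"
        using that by (intro emeasure_mono sets_superlevel) (auto simp: superlevel_def)
      then show ?thesis using that by (simp add: em)
    qed
    show "?\<phi> v \<le> I * v powr (- 12/7)" if "0 < v" for v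
      using cheb[OF that] \<open>0 \<le> I\<close> that by (simp add: em)
    have "(\<integral>\<^sup>+s. ennreal (?\<phi> s * s powr (5/7)) * indicator {0<..} s \<partial>lborel)
        = (\<integral>\<^sup>+s. \<integral>\<^sup>+y. ennreal (s powr (5/7)) * indicator {0<..} s * indicator (superlevel a s) y \<partial>RZ \<partial>lborel)"
    proof (rule nn_integral_cong)
      fix s :: real
      show "ennreal (?\<phi> s * s powr (5/7)) * indicator {0<..} s
        = (\<integral>\<^sup>+y. ennreal (s powr (5/7)) * indicator {0<..} s * indicator (superlevel a s) y \<partial>RZ)"
        by (cases "0 < s") (simp_all add: nn_integral_cmult em ennreal_mult, simp add: mult.commute)
    qed
    also have "\<dots> = (\<integral>\<^sup>+y. \<integral>\<^sup>+s. ennreal (s powr (5/7)) * indicator {0<..} s * indicator (superlevel a s) y \<partial>lborel \<partial>RZ)"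
      by (rule Fubini'[symmetric]) measurable
    also have "\<dots> = (\<integral>\<^sup>+y. ennreal (7/12) * ennreal (a y powr (12/7)) \<partial>RZ)"
    proof (rule nn_integral_cong)
      fix y
      have "(\<integral>\<^sup>+s. ennreal (s powr (5/7)) * indicator {0<..} s * indicator (superlevel a s) y \<partial>lborel)
          = (\<integral>\<^sup>+s. ennreal (s powr (5/7)) * indicator {0<..a y} s \<partial>lborel)"
        by (rule nn_integral_cong_AE, rule AE_mp[OF AE_lborel_singleton[of "a y"]])
           (auto simp: superlevel_def indicator_def)
      also have "\<dots> = ennreal (7/12) * ennreal (a y powr (12/7))"
        using nonneg by (simp add: nn_integral_powr_from_0 ennreal_mult[symmetric])
      finally show "(\<integral>\<^sup>+s. ennreal (s powr (5/7)) * indicator {0<..} s * indicator (superlevel a s) y \<partial>lborel)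
          = ennreal (7/12) * ennreal (a y powr (12/7))" .
    qed
    also have "\<dots> = ennreal (7/12 * I)"
      using \<open>0 \<le> I\<close> by (subst nn_integral_cmult) (simp_all add: I ennreal_mult[symmetric])
    finally show "(\<integral>\<^sup>+s. ennreal (?\<phi> s * s powr (5/7)) * indicator {0<..} s \<partial>lborel) = ennreal (7/12 * I)" .
  qed (use \<phi>_meas \<open>0 \<le> I\<close> in auto)
qed

text \<open>The four functions are replaced by their superlevel sets one slot at a time, each being
  brought to the front by the symmetries. The constant is 588 = 12 * 7 * 7, from
  \<open>restricted_estimate\<close> and one double level integral for each function.\<close>

theorem resonant_form_estimate:
  assumes sep: "separated \<delta> A B" and "0 < \<delta>" "\<delta> \<le> w"
    and AB [measurable]: "A \<in> sets RZ" "B \<in> sets RZ"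
    and [measurable]: "a \<in> borel_measurable RZ" "b \<in> borel_measurable RZ"
    and nonneg: "\<And>y. 0 \<le> a y" "\<And>y. 0 \<le> b y"
    and supp: "\<And>y. y \<notin> A \<Longrightarrow> a y = 0" "\<And>y. y \<notin> B \<Longrightarrow> b y = 0"
    and "0 \<le> I" "0 \<le> J"
    and I: "(\<integral>\<^sup>+y. ennreal (a y powr (12/7)) \<partial>RZ) = ennreal I"
    and J: "(\<integral>\<^sup>+y. ennreal (b y powr (12/7)) \<partial>RZ) = ennreal J"
  shows "quad_form (indicator (resonant w)) (\<lambda>y. ennreal (a y)) (\<lambda>y. ennreal (a y)) (\<lambda>y. ennreal (b y)) (\<lambda>y. ennreal (b y))
    \<le> ennreal (588 * w * \<delta> powr (- (2/3)) * (I powr (7/6) * J powr (7/6)))"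
proof -
  let ?q = "quad_form (indicator (resonant w))"
  let ?a = "\<lambda>y. ennreal (a y)" and ?b = "\<lambda>y. ennreal (b y)"
  let ?A = "superlevel a" and ?B = "superlevel b"
  let ?pos = "\<lambda>s::real. indicator {0<..} s :: ennreal"
  have swap: "?q f f' g g' = ?q f' f g' g" "?q f f' g g' = ?q g g' f f'"
    if "f \<in> borel_measurable RZ" "f' \<in> borel_measurable RZ" "g \<in> borel_measurable RZ" "g' \<in> borel_measurable RZ"
    for f f' g g'
  proof -
    show "?q f f' g g' = ?q f' f g' g"
      using that by (intro quad_form_swap_time) (simp_all add: indicator_def resonant_sym)
    show "?q f f' g g' = ?q g g' f f'"
      using that by (intro quad_form_swap_space) (simp_all add: indicator_def resonant_sym)
  qed
  have first: "?q (\<lambda>y. ennreal (c y)) f' g g' = (\<integral>\<^sup>+s. ?q (indicator (superlevel c s)) f' g g' * ?pos s \<partial>lborel)"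
    if "c \<in> borel_measurable RZ" "\<And>y. 0 \<le> c y"
      "f' \<in> borel_measurable RZ" "g \<in> borel_measurable RZ" "g' \<in> borel_measurable RZ" for c f' g g'
    using that by (intro quad_form_layer_cake_first) auto
  define c where "c = 12 * w * \<delta> powr (- (2/3))"
  have "0 \<le> c" using assms(2,3) by (simp add: c_def)
  define \<psi> \<eta> where "\<psi> s s' = ennreal (layer_weight (measure RZ (?A s)) (measure RZ (?A s'))) * (?pos s * ?pos s')"
    and "\<eta> s s' = ennreal (layer_weight (measure RZ (?B s)) (measure RZ (?B s'))) * (?pos s * ?pos s')" for s s'
  note bound_a = nn_integral_layer_weight_superlevel[OF _ nonneg(1) \<open>0 \<le> I\<close> I]
  note bound_b = nn_integral_layer_weight_superlevel[OF _ nonneg(2) \<open>0 \<le> J\<close> J]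
  have [measurable]: "(\<lambda>s. measure RZ (?A s)) \<in> borel_measurable borel" "(\<lambda>s. measure RZ (?B s)) \<in> borel_measurable borel"
    by (rule bound_a bound_b; measurable)+
  have [measurable]: "(\<lambda>(s, s'). \<psi> s s') \<in> borel_measurable (borel \<Otimes>\<^sub>M borel)"
    "(\<lambda>(s, s'). \<eta> s s') \<in> borel_measurable (borel \<Otimes>\<^sub>M borel)"
    unfolding \<psi>_def \<eta>_def layer_weight_def by measurable
  have [measurable]: "(\<lambda>s'. \<psi> s s') \<in> borel_measurable borel" "(\<lambda>s'. \<eta> s s') \<in> borel_measurable borel" for s
    unfolding \<psi>_def \<eta>_def layer_weight_def by measurable
  have lev: "?A s \<in> sets RZ" "?B s \<in> sets RZ" for s
    by measurable
  have finite_level: "emeasure RZ (?A s) < \<infinity>" "emeasure RZ (?B s) < \<infinity>" if "0 < s" for s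
    using emeasure_superlevel_Chebyshev[of a I s "12/7"] emeasure_superlevel_Chebyshev[of b J s "12/7"] assms that
    by (force simp: order.strict_trans1)+
  have level_sub: "?A s \<subseteq> A" "?B s \<subseteq> B" if "0 < s" for s
    using supp that by (force simp: superlevel_def)+
  let ?l = "\<lambda>s s'. ennreal (layer_weight (measure RZ (?A s)) (measure RZ (?A s')))"
  \<comment> \<open>The bound for sets factors into weights in (s, s') and in (t, t'), so the
    integral over both levels of b enters the steps for a as a constant.\<close>
  define D where "D = (\<integral>\<^sup>+t. \<integral>\<^sup>+t'. \<eta> t t' \<partial>lborel \<partial>lborel)"
  have step4: "?q (indicator (?A s)) (indicator (?A s')) (indicator (?B t)) ?b
      \<le> ennreal c * ?l s s' * (\<integral>\<^sup>+t'. \<eta> t t' \<partial>lborel)" if "0 < s" "0 < s'" "0 < t" for s s' t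
  proof -
    have "?q (indicator (?A s)) (indicator (?A s')) (indicator (?B t)) ?b
        = ?q ?b (indicator (?B t)) (indicator (?A s')) (indicator (?A s))"
      by (subst swap(2), simp_all, subst swap(1), simp_all)
    also have "\<dots> = (\<integral>\<^sup>+t'. ?q (indicator (?B t')) (indicator (?B t)) (indicator (?A s')) (indicator (?A s)) * ?pos t' \<partial>lborel)"
      by (rule first) (auto simp: nonneg)
    also have "\<dots> \<le> (\<integral>\<^sup>+t'. ennreal c * ?l s s' * \<eta> t t' \<partial>lborel)"
    proof (rule nn_integral_mono)
      fix t' :: real
      show "?q (indicator (?B t')) (indicator (?B t)) (indicator (?A s')) (indicator (?A s)) * ?pos t'
          \<le> ennreal c * ?l s s' * \<eta> t t'"
      proof (cases "0 < t'")
        case True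
        have "?q (indicator (?B t')) (indicator (?B t)) (indicator (?A s')) (indicator (?A s))
            = ?q (indicator (?A s)) (indicator (?A s')) (indicator (?B t)) (indicator (?B t'))"
          by (subst swap(1), simp_all, subst swap(2), simp_all)
        also have "\<dots> \<le> ennreal (c * (layer_weight (measure RZ (?A s)) (measure RZ (?A s')) *
            layer_weight (measure RZ (?B t)) (measure RZ (?B t'))))"
          unfolding c_def using True that
          by (intro restricted_estimate[OF sep assms(2,3) AB] lev level_sub finite_level)
        finally show ?thesis
          using True that \<open>0 \<le> c\<close> by (simp add: \<eta>_def ennreal_mult mult.assoc)
      qed simp
    qed
    finally show ?thesis by (simp add: nn_integral_cmult)
  qed
  have step3: "?q (indicator (?A s)) (indicator (?A s')) ?b ?b \<le> ennreal c * ?l s s' * D"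
    if "0 < s" "0 < s'" for s s'
  proof -
    have "?q (indicator (?A s)) (indicator (?A s')) ?b ?b = ?q ?b ?b (indicator (?A s)) (indicator (?A s'))"
      by (subst swap(2)) simp_all
    also have "\<dots> = (\<integral>\<^sup>+t. ?q (indicator (?B t)) ?b (indicator (?A s)) (indicator (?A s')) * ?pos t \<partial>lborel)"
      by (rule first) (auto simp: nonneg)
    also have "\<dots> \<le> (\<integral>\<^sup>+t. ennreal c * ?l s s' * (\<integral>\<^sup>+t'. \<eta> t t' \<partial>lborel) \<partial>lborel)"
    proof (rule nn_integral_mono)
      fix t :: real
      show "?q (indicator (?B t)) ?b (indicator (?A s)) (indicator (?A s')) * ?pos t
          \<le> ennreal c * ?l s s' * (\<integral>\<^sup>+t'. \<eta> t t' \<partial>lborel)"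
      proof (cases "0 < t")
        case True
        then show ?thesis
          using step4[OF that True] swap(2)[of "indicator (?B t)" ?b "indicator (?A s)" "indicator (?A s')"] by simp
      qed simp
    qed
    finally show ?thesis by (simp add: nn_integral_cmult D_def)
  qed
  have step2: "?q (indicator (?A s)) ?a ?b ?b * ?pos s \<le> ennreal c * D * (\<integral>\<^sup>+s'. \<psi> s s' \<partial>lborel)" for s
  proof (cases "0 < s")
    case True
    have "?q (indicator (?A s)) ?a ?b ?b = ?q ?a (indicator (?A s)) ?b ?b"
      by (rule swap) simp_all
    also have "\<dots> = (\<integral>\<^sup>+s'. ?q (indicator (?A s')) (indicator (?A s)) ?b ?b * ?pos s' \<partial>lborel)"
      by (rule first) (auto simp: nonneg)
    also have "\<dots> \<le> (\<integral>\<^sup>+s'. ennreal c * D * \<psi> s s' \<partial>lborel)"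
    proof (rule nn_integral_mono)
      fix s' :: real
      show "?q (indicator (?A s')) (indicator (?A s)) ?b ?b * ?pos s' \<le> ennreal c * D * \<psi> s s'"
      proof (cases "0 < s'")
        case s': True
        then show ?thesis
          using step3[OF True s'] swap(1)[of "indicator (?A s)" "indicator (?A s')" ?b ?b] True
          by (simp add: \<psi>_def mult_ac)
      qed simp
    qed
    finally show ?thesis using True by (simp add: nn_integral_cmult)
  qed simp
  have "?q ?a ?a ?b ?b = (\<integral>\<^sup>+s. ?q (indicator (?A s)) ?a ?b ?b * ?pos s \<partial>lborel)"
    by (rule first) (auto simp: nonneg)
  also have "\<dots> \<le> (\<integral>\<^sup>+s. ennreal c * D * (\<integral>\<^sup>+s'. \<psi> s s' \<partial>lborel) \<partial>lborel)"
    by (intro nn_integral_mono step2)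
  also have "\<dots> = ennreal c * D * (\<integral>\<^sup>+s. \<integral>\<^sup>+s'. \<psi> s s' \<partial>lborel \<partial>lborel)"
    by (simp add: nn_integral_cmult)
  also have "\<dots> \<le> ennreal c * ennreal (7 * J powr (7/6)) * ennreal (7 * I powr (7/6))"
    unfolding D_def \<psi>_def \<eta>_def by (intro mult_mono bound_a(2) bound_b(2)) auto
  also have "\<dots> = ennreal (c * (7 * J powr (7/6)) * (7 * I powr (7/6)))"
    using \<open>0 \<le> c\<close> by (subst (1 2) ennreal_mult) auto
  also have "c * (7 * J powr (7/6)) * (7 * I powr (7/6)) = 588 * w * \<delta> powr (- (2/3)) * (I powr (7/6) * J powr (7/6))"
    by (simp add: c_def)
  finally show ?thesis .
qed

section \<open>Fourier analysis\<close>

lemma measurable_cnj [measurable]: "cnj \<in> borel_measurable borel"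
  by (intro borel_measurable_continuous_onI continuous_intros)

lemma measurable_cis [measurable]: "cis \<in> borel_measurable borel"
  by (intro borel_measurable_continuous_onI continuous_intros)

section \<open>Squares of oscillatory integrals\<close>

lemma integrable_tensor:
  fixes f :: "'a \<Rightarrow> 'c::{real_normed_field,banach,second_countable_topology}" and g :: "'b \<Rightarrow> 'c"
  assumes "sigma_finite_measure N"
    and f: "integrable M f" and g: "integrable N g"
  shows "integrable (M \<Otimes>\<^sub>M N) (\<lambda>(x, y). f x * g y)"
proof (rule integrableI_bounded)
  interpret N: sigma_finite_measure N by fact
  have [measurable]: "f \<in> borel_measurable M" "g \<in> borel_measurable N"
    using f g by auto
  show "(\<lambda>(x, y). f x * g y) \<in> borel_measurable (M \<Otimes>\<^sub>M N)"
    by measurable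
  have "(\<integral>\<^sup>+p. ennreal (norm (case p of (x, y) \<Rightarrow> f x * g y)) \<partial>(M \<Otimes>\<^sub>M N))
      = (\<integral>\<^sup>+x. \<integral>\<^sup>+y. ennreal (norm (f x)) * ennreal (norm (g y)) \<partial>N \<partial>M)"
    by (subst N.nn_integral_fst[symmetric]) (auto simp: norm_mult ennreal_mult)
  also have "\<dots> = (\<integral>\<^sup>+x. ennreal (norm (f x)) \<partial>M) * (\<integral>\<^sup>+y. ennreal (norm (g y)) \<partial>N)"
    by (simp add: nn_integral_cmult nn_integral_multc)
  also have "\<dots> < \<infinity>"
    using f g by (simp add: integrable_iff_bounded ennreal_mult_less_top)
  finally show "(\<integral>\<^sup>+p. ennreal (norm (case p of (x, y) \<Rightarrow> f x * g y)) \<partial>(M \<Otimes>\<^sub>M N)) < \<infinity>" .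
qed

lemma integral_tensor:
  fixes f :: "'a \<Rightarrow> complex" and g :: "'b \<Rightarrow> complex"
  assumes "sigma_finite_measure M" "sigma_finite_measure N" "integrable M f" "integrable N g"
  shows "(\<integral>(x, y). f x * g y \<partial>(M \<Otimes>\<^sub>M N)) = (\<integral>x. f x \<partial>M) * (\<integral>y. g y \<partial>N)"
proof -
  interpret pair_sigma_finite M N using assms by (intro pair_sigma_finite.intro)
  show ?thesis
    using integral_fst'[OF integrable_tensor[OF assms(2-4)]] by simp
qed

text \<open>Expanding the square and integrating the oscillation first.\<close>

lemma nn_integral_oscillatory_square_le:
  fixes e :: "'a \<Rightarrow> 'b \<Rightarrow> complex" and h :: "'b \<Rightarrow> complex" and g :: "'a \<Rightarrow> real"
  assumes "sigma_finite_measure X" "sigma_finite_measure M"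
    and g: "integrable X g" "\<And>x. 0 \<le> g x" and h: "integrable M h"
    and e [measurable]: "(\<lambda>(x, y). e x y) \<in> borel_measurable (X \<Otimes>\<^sub>M M)" and e1: "\<And>x y. norm (e x y) = 1"
  shows "(\<integral>\<^sup>+x. ennreal (g x * (norm (\<integral>y. e x y * h y \<partial>M))\<^sup>2) \<partial>X)
    \<le> (\<integral>\<^sup>+y. \<integral>\<^sup>+y'. ennreal (norm (h y) * norm (h y') * norm (\<integral>x. g x *\<^sub>R (e x y * cnj (e x y')) \<partial>X)) \<partial>M \<partial>M)"
proof -
  interpret X: sigma_finite_measure X by fact
  interpret M: sigma_finite_measure M by fact
  interpret MM: pair_sigma_finite M M ..
  have MM: "sigma_finite_measure (M \<Otimes>\<^sub>M M)" ..
  interpret XP: pair_sigma_finite X "M \<Otimes>\<^sub>M M"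
    by (intro pair_sigma_finite.intro MM assms)
  have [measurable]: "h \<in> borel_measurable M" "g \<in> borel_measurable X"
    using h g by auto
  have [measurable]: "(\<lambda>(x, y, y'). e x y) \<in> borel_measurable (X \<Otimes>\<^sub>M M \<Otimes>\<^sub>M M)"
    "(\<lambda>(x, y, y'). e x y') \<in> borel_measurable (X \<Otimes>\<^sub>M M \<Otimes>\<^sub>M M)"
  proof -
    have "(\<lambda>p. (\<lambda>(x, y). e x y) (fst p, fst (snd p))) \<in> borel_measurable (X \<Otimes>\<^sub>M M \<Otimes>\<^sub>M M)"
      by measurable
    then show "(\<lambda>(x, y, y'). e x y) \<in> borel_measurable (X \<Otimes>\<^sub>M M \<Otimes>\<^sub>M M)"
      by (simp add: case_prod_unfold)
    have "(\<lambda>p. (\<lambda>(x, y). e x y) (fst p, snd (snd p))) \<in> borel_measurable (X \<Otimes>\<^sub>M M \<Otimes>\<^sub>M M)"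
      by measurable
    then show "(\<lambda>(x, y, y'). e x y') \<in> borel_measurable (X \<Otimes>\<^sub>M M \<Otimes>\<^sub>M M)"
      by (simp add: case_prod_unfold)
  qed
  have ex [measurable]: "e x \<in> borel_measurable M" if "x \<in> space X" for x
    using measurable_Pair2[OF e that] by simp
  \<comment> \<open>The expanded square. It is dominated by g x |h y| |h y'|, which is integrable on
    the triple product and justifies exchanging the integrals.\<close>
  define G where "G x p = (case p of (y, y') \<Rightarrow> g x *\<^sub>R ((e x y * h y) * cnj (e x y' * h y')))" for x p
  define K where "K y y' = (\<integral>x. g x *\<^sub>R (e x y * cnj (e x y')) \<partial>X)" for y y'
  have Gm [measurable]: "(\<lambda>(x, p). G x p) \<in> borel_measurable (X \<Otimes>\<^sub>M M \<Otimes>\<^sub>M M)"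
  proof -
    have "(\<lambda>q. g (fst q) *\<^sub>R (((case q of (x, y, y') \<Rightarrow> e x y) * h (fst (snd q))) *
        cnj ((case q of (x, y, y') \<Rightarrow> e x y') * h (snd (snd q))))) \<in> borel_measurable (X \<Otimes>\<^sub>M M \<Otimes>\<^sub>M M)"
      by measurable
    then show ?thesis
      by (simp add: G_def case_prod_unfold)
  qed
  have hh: "integrable (M \<Otimes>\<^sub>M M) (\<lambda>(y, y'). norm (h y) * norm (h y'))"
    using h by (intro integrable_tensor \<open>sigma_finite_measure M\<close>) auto
  have Gi: "integrable (X \<Otimes>\<^sub>M (M \<Otimes>\<^sub>M M)) (\<lambda>(x, p). G x p)"
  proof (rule Bochner_Integration.integrable_bound)
    show "integrable (X \<Otimes>\<^sub>M (M \<Otimes>\<^sub>M M)) (\<lambda>(x, p). g x * (case p of (y, y') \<Rightarrow> norm (h y) * norm (h y')))"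
      by (rule integrable_tensor[OF MM g(1) hh])
    show "AE x in X \<Otimes>\<^sub>M (M \<Otimes>\<^sub>M M). norm (case x of (x, p) \<Rightarrow> G x p)
        \<le> norm (case x of (x, p) \<Rightarrow> g x * (case p of (y, y') \<Rightarrow> norm (h y) * norm (h y')))"
      by (rule AE_I2) (auto simp: G_def norm_mult e1 split: prod.splits)
  qed (rule Gm)
  have square: "complex_of_real (g x * (norm (\<integral>y. e x y * h y \<partial>M))\<^sup>2) = (\<integral>p. G x p \<partial>(M \<Otimes>\<^sub>M M))"
    if x: "x \<in> space X" for x
  proof -
    have i: "integrable M (\<lambda>y. e x y * h y)"
      by (rule Bochner_Integration.integrable_bound[OF h]) (auto simp: norm_mult e1 x)
    then have "integrable M (\<lambda>y. cnj (e x y * h y))"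
      by (rule integrable_cnj)
    from integral_tensor[OF \<open>sigma_finite_measure M\<close> \<open>sigma_finite_measure M\<close> i this]
    have "(\<integral>(y, y'). (e x y * h y) * cnj (e x y' * h y') \<partial>(M \<Otimes>\<^sub>M M))
      = (\<integral>y. e x y * h y \<partial>M) * cnj (\<integral>y. e x y * h y \<partial>M)"
      by (simp only: Bochner_Integration.integral_cnj)
    then have "(\<integral>p. G x p \<partial>(M \<Otimes>\<^sub>M M)) = g x *\<^sub>R ((\<integral>y. e x y * h y \<partial>M) * cnj (\<integral>y. e x y * h y \<partial>M))"
      unfolding G_def by (simp add: case_prod_unfold)
    then show ?thesis
      by (simp add: complex_norm_square[symmetric] scaleR_conv_of_real)
  qed
  have sq_int: "integrable X (\<lambda>x. g x * (norm (\<integral>y. e x y * h y \<partial>M))\<^sup>2)"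
  proof -
    have "integrable X (\<lambda>x. \<integral>p. G x p \<partial>(M \<Otimes>\<^sub>M M))"
      using XP.integrable_fst'[OF Gi] by simp
    then have "integrable X (\<lambda>x. complex_of_real (g x * (norm (\<integral>y. e x y * h y \<partial>M))\<^sup>2))"
      by (rule Bochner_Integration.integrable_cong[THEN iffD1, rotated 2]) (auto simp: square simp del: of_real_mult of_real_power)
    then show ?thesis by (simp only: complex_of_real_integrable_eq)
  qed
  have "complex_of_real (\<integral>x. g x * (norm (\<integral>y. e x y * h y \<partial>M))\<^sup>2 \<partial>X) = (\<integral>x. \<integral>p. G x p \<partial>(M \<Otimes>\<^sub>M M) \<partial>X)"
    unfolding integral_complex_of_real[symmetric]
    by (rule Bochner_Integration.integral_cong) (auto simp: square simp del: of_real_mult of_real_power)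
  also have "\<dots> = (\<integral>p. \<integral>x. G x p \<partial>X \<partial>(M \<Otimes>\<^sub>M M))"
    by (rule XP.Fubini_integral[symmetric]) (rule Gi)
  also have "\<dots> = (\<integral>p. (case p of (y, y') \<Rightarrow> h y * cnj (h y') * K y y') \<partial>(M \<Otimes>\<^sub>M M))"
  proof (rule Bochner_Integration.integral_cong[OF refl])
    fix p :: "'b \<times> 'b"
    obtain y y' where p: "p = (y, y')" by (cases p)
    have "(\<integral>x. G x p \<partial>X) = (\<integral>x. (h y * cnj (h y')) * (g x *\<^sub>R (e x y * cnj (e x y'))) \<partial>X)"
      by (simp add: G_def p scaleR_conv_of_real mult_ac)
    also have "\<dots> = h y * cnj (h y') * K y y'"
      unfolding K_def by (rule integral_mult_right_zero)
    finally show "(\<integral>x. G x p \<partial>X) = (case p of (y, y') \<Rightarrow> h y * cnj (h y') * K y y')"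
      by (simp add: p)
  qed
  finally have eq: "complex_of_real (\<integral>x. g x * (norm (\<integral>y. e x y * h y \<partial>M))\<^sup>2 \<partial>X)
      = (\<integral>p. (case p of (y, y') \<Rightarrow> h y * cnj (h y') * K y y') \<partial>(M \<Otimes>\<^sub>M M))" .
  have Km: "(\<lambda>(y, y'). K y y') \<in> borel_measurable (M \<Otimes>\<^sub>M M)"
  proof -
    have "(\<lambda>q. g (snd q) *\<^sub>R ((\<lambda>(x, y). e x y) (snd q, fst (fst q)) * cnj ((\<lambda>(x, y). e x y) (snd q, snd (fst q)))))
       \<in> borel_measurable ((M \<Otimes>\<^sub>M M) \<Otimes>\<^sub>M X)"
      by measurable
    then have "(\<lambda>p. \<integral>x. g x *\<^sub>R (e x (fst p) * cnj (e x (snd p))) \<partial>X) \<in> borel_measurable (M \<Otimes>\<^sub>M M)"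
      by (intro X.borel_measurable_lebesgue_integral) (simp add: case_prod_unfold)
    then show ?thesis by (simp add: K_def case_prod_unfold)
  qed
  have "(\<integral>\<^sup>+x. ennreal (g x * (norm (\<integral>y. e x y * h y \<partial>M))\<^sup>2) \<partial>X)
      = ennreal (\<integral>x. g x * (norm (\<integral>y. e x y * h y \<partial>M))\<^sup>2 \<partial>X)"
    using sq_int g by (intro nn_integral_eq_integral) auto
  also have "\<dots> = ennreal (norm (complex_of_real (\<integral>x. g x * (norm (\<integral>y. e x y * h y \<partial>M))\<^sup>2 \<partial>X)))"
    using g by (simp add: integral_nonneg)
  also have "\<dots> \<le> (\<integral>\<^sup>+p. ennreal (norm (case p of (y, y') \<Rightarrow> h y * cnj (h y') * K y y')) \<partial>(M \<Otimes>\<^sub>M M))"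
  proof (cases "integrable (M \<Otimes>\<^sub>M M) (\<lambda>p. case p of (y, y') \<Rightarrow> h y * cnj (h y') * K y y')")
    case True
    then show ?thesis unfolding eq by (rule integral_norm_bound_ennreal)
  next
    \<comment> \<open>A Bochner integral that does not exist is 0 by convention, so the inequality
      is trivial in this case.\<close>
    case False
    then show ?thesis unfolding eq by (simp add: not_integrable_integral_eq)
  qed
  also have "\<dots> = (\<integral>\<^sup>+y. \<integral>\<^sup>+y'. ennreal (norm (h y) * norm (h y') * norm (K y y')) \<partial>M \<partial>M)"
    using Km by (subst M.nn_integral_fst[symmetric]) (auto simp: norm_mult case_prod_unfold)
  finally show ?thesis unfolding K_def .
qed

section \<open>Gaussians and their Fourier transforms\<close>

text \<open>Normalised by the value 1 at 0 and not by mass: it serves as a smooth substitute for an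
  indicator, being at least 1/2 on [0, \<sigma>] and increasing to 1 as \<sigma> grows.\<close>

definition gauss :: "real \<Rightarrow> real \<Rightarrow> real" where
  "gauss \<sigma> x = exp (- x\<^sup>2 / (2 * \<sigma>\<^sup>2))"

lemma gauss_pos [simp]: "0 < gauss \<sigma> x"
  by (simp add: gauss_def)

lemma gauss_normal_density: "0 < \<sigma> \<Longrightarrow> gauss \<sigma> x = sqrt (2 * pi) * \<sigma> * normal_density 0 \<sigma> x"
  by (simp add: gauss_def normal_density_def real_sqrt_mult)

lemma measurable_gauss [measurable]: "gauss \<sigma> \<in> borel_measurable borel"
  unfolding gauss_def by measurable

lemma integrable_gauss:
  assumes "0 < \<sigma>"
  shows "integrable lborel (gauss \<sigma>)"
proof -
  have "gauss \<sigma> = (\<lambda>x. sqrt (2 * pi) * \<sigma> * normal_density 0 \<sigma> x)"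
    using assms by (simp add: fun_eq_iff gauss_normal_density)
  then show ?thesis using assms by simp
qed

lemma gauss_Fourier:
  assumes "0 < \<sigma>"
  shows "(\<integral>x. gauss \<sigma> x *\<^sub>R cis (x * \<theta>) \<partial>lborel) = complex_of_real (sqrt (2 * pi) * \<sigma> * exp (- (\<sigma> * \<theta>)\<^sup>2 / 2))"
proof -
  have "complex_of_real (exp (- (\<sigma> * \<theta>)\<^sup>2 / 2)) = char std_normal_distribution (\<sigma> * \<theta>)"
    by (simp add: char_std_normal_distribution)
  also have "\<dots> = (\<integral>x. std_normal_density x *\<^sub>R cis (\<sigma> * \<theta> * x) \<partial>lborel)"
    unfolding char_def by (subst integral_density) (auto simp: cis_conv_exp)
  finally have std: "(\<integral>x. std_normal_density x *\<^sub>R cis (\<sigma> * \<theta> * x) \<partial>lborel) = complex_of_real (exp (- (\<sigma> * \<theta>)\<^sup>2 / 2))" ..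
  have "(\<integral>x. gauss \<sigma> x *\<^sub>R cis (x * \<theta>) \<partial>lborel) = \<sigma> *\<^sub>R (\<integral>x. gauss \<sigma> (0 + \<sigma> * x) *\<^sub>R cis ((0 + \<sigma> * x) * \<theta>) \<partial>lborel)"
    using \<open>0 < \<sigma>\<close> by (subst lborel_integral_real_affine[where c = \<sigma> and t = 0]) auto
  also have "(\<lambda>x. gauss \<sigma> (0 + \<sigma> * x) *\<^sub>R cis ((0 + \<sigma> * x) * \<theta>))
      = (\<lambda>x. complex_of_real (sqrt (2 * pi)) * (std_normal_density x *\<^sub>R cis (\<sigma> * \<theta> * x)))"
    using \<open>0 < \<sigma>\<close>
    by (auto simp: fun_eq_iff gauss_def std_normal_density_def power_mult_distrib scaleR_conv_of_real mult_ac)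
  also have "(\<integral>x. complex_of_real (sqrt (2 * pi)) * (std_normal_density x *\<^sub>R cis (\<sigma> * \<theta> * x)) \<partial>lborel)
      = complex_of_real (sqrt (2 * pi)) * complex_of_real (exp (- (\<sigma> * \<theta>)\<^sup>2 / 2))"
    unfolding std[symmetric] by (rule integral_mult_right_zero)
  finally show ?thesis
    by (simp add: scaleR_conv_of_real mult_ac)
qed

lemma integral_character_period:
  "(\<integral>x. cis (2 * pi * (x * of_int m)) \<partial>restrict_space lborel {0..<1}) = (if m = 0 then 1 else 0)"
proof -
  have "(\<integral>x. cis (2 * pi * (x * of_int m)) \<partial>restrict_space lborel {0..<1::real})
      = (\<integral>x. indicator {0..<1} x *\<^sub>R cis (2 * pi * (x * of_int m)) \<partial>lborel)"
    by (subst integral_restrict_space) auto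
  also have "\<dots> = (\<integral>x. indicator {0..1} x *\<^sub>R cis (2 * pi * (x * of_int m)) \<partial>lborel)"
  proof (rule integral_cong_AE)
    show "AE x in lborel. indicator {0..<1} x *\<^sub>R cis (2 * pi * (x * of_int m))
        = indicator {0..1} x *\<^sub>R cis (2 * pi * (x * of_int m))"
      by (rule AE_mp[OF AE_lborel_singleton[of 1]]) (auto simp: indicator_def)
  qed measurable
  also have "\<dots> = (if m = 0 then 1 else 0)"
  proof (cases "m = 0")
    case False
    define c where "c = 2 * pi * of_int m"
    have "c \<noteq> 0" using False by (simp add: c_def)
    have "((\<lambda>x. cis (c * x) / (\<i> * complex_of_real c)) has_vector_derivative cis (c * x)) (at x within {0..1})" for x
    proof -
      have "((\<lambda>x. exp (\<i> * complex_of_real c * complex_of_real x) / (\<i> * complex_of_real c)) has_vector_derivative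
          exp (\<i> * complex_of_real c * complex_of_real x)) (at x within {0..1})"
        using \<open>c \<noteq> 0\<close>
        by (auto intro!: derivative_eq_intros has_vector_derivative_real_field)
      then show ?thesis by (simp add: cis_conv_exp mult_ac)
    qed
    then have "(\<integral>x. indicator {0..1} x *\<^sub>R cis (c * x) \<partial>lborel) =
        cis (c * 1) / (\<i> * complex_of_real c) - cis (c * 0) / (\<i> * complex_of_real c)"
      by (intro integral_FTC_Icc) (auto intro!: continuous_intros simp: cis_conv_exp)
    also have "cis (c * 1) = 1"
      by (simp add: c_def cis_multiple_2pi)
    finally show ?thesis using False by (simp add: c_def mult_ac)
  qed simp
  finally show ?thesis .
qed

lemma sigma_finite_period: "sigma_finite_measure (restrict_space lborel {0..<1::real})"
proof -
  have "finite_measure (restrict_space lborel {0..<1::real})"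
    by (rule finite_measureI) (simp add: emeasure_restrict_space space_restrict_space)
  then show ?thesis by (rule finite_measure.sigma_finite_measure)
qed

lemma sigma_finite_RT: "sigma_finite_measure RT"
proof -
  interpret pair_sigma_finite lborel "restrict_space lborel {0..<1::real}"
    by (intro pair_sigma_finite.intro sigma_finite_lborel sigma_finite_period)
  show ?thesis unfolding RT_def ..
qed

lemma measurable_fst_RT [measurable]: "fst \<in> borel_measurable RT"
  and measurable_snd_RT [measurable]: "snd \<in> borel_measurable RT"
proof -
  show "fst \<in> borel_measurable RT"
    unfolding RT_def by measurable
  have "(\<lambda>x::real. x) \<in> borel_measurable (restrict_space lborel {0..<1})"
    by (rule measurable_restrict_space1) simp
  then show "snd \<in> borel_measurable RT"
    unfolding RT_def by (rule measurable_compose[OF measurable_snd])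
qed

section \<open>Characters and the Parseval inequality\<close>

definition character :: "real \<times> real \<Rightarrow> real \<times> int \<Rightarrow> complex" where
  "character x y = cis (2 * pi * (x \<bullet> embed_RZ y))"

lemma character_eq: "character x y = cis (2 * pi * (fst x * fst y + snd x * of_int (snd y)))"
  by (simp add: character_def embed_RZ_def inner_prod_def)

lemma norm_character [simp]: "norm (character x y) = 1"
  by (simp add: character_def)

lemma character_add: "character x (y + z) = character x y * character x z"
  by (simp add: character_eq cis_mult algebra_simps)

lemma measurable_character [measurable]:
  assumes [measurable]: "f \<in> measurable M RT" "g \<in> measurable M RZ"
  shows "(\<lambda>x. character (f x) (g x)) \<in> borel_measurable M"
proof -
  have [measurable]: "(\<lambda>x. fst (f x)) \<in> borel_measurable M" "(\<lambda>x. snd (f x)) \<in> borel_measurable M"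
    "(\<lambda>x. fst (g x)) \<in> borel_measurable M" "(\<lambda>x. snd (g x)) \<in> measurable M (count_space UNIV)"
    by (auto intro: measurable_compose[OF assms(1)] measurable_compose[OF assms(2)])
  show ?thesis unfolding character_eq by measurable
qed

lemma measurable_character' [measurable]: "character x \<in> borel_measurable RZ"
  unfolding character_eq[abs_def] by measurable

text \<open>The Fourier transform, at y - y', of the Gaussian window in the first variable: a
  Kronecker delta in the integer direction and a normal density of deviation 1 / (2 pi \<sigma>) in
  the real one. Its mass is 1 for every \<sigma>, and it concentrates at y' = y as \<sigma>
  grows.\<close>

definition dirac_kernel :: "real \<Rightarrow> real \<times> int \<Rightarrow> real \<times> int \<Rightarrow> real" where
  "dirac_kernel \<sigma> y y' = (if snd y = snd y' then normal_density (fst y) (1 / (2 * pi * \<sigma>)) (fst y') else 0)"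

lemma dirac_kernel_nonneg [simp]: "0 \<le> dirac_kernel \<sigma> y y'"
  by (simp add: dirac_kernel_def)

lemma dirac_kernel_commute: "dirac_kernel \<sigma> y y' = dirac_kernel \<sigma> y' y"
  by (simp add: dirac_kernel_def normal_density_def power2_commute)

lemma measurable_dirac_kernel [measurable]:
  "(\<lambda>(y, y'). dirac_kernel \<sigma> y y') \<in> borel_measurable (RZ \<Otimes>\<^sub>M RZ)"
  unfolding dirac_kernel_def normal_density_def by measurable

lemma nn_integral_dirac_kernel:
  assumes "0 < \<sigma>"
  shows "(\<integral>\<^sup>+y'. ennreal (dirac_kernel \<sigma> y y') \<partial>RZ) = 1"
proof -
  define \<tau> where "\<tau> = 1 / (2 * pi * \<sigma>)"
  have "0 < \<tau>" using assms by (simp add: \<tau>_def)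
  have [measurable]: "(\<lambda>y'. dirac_kernel \<sigma> y y') \<in> borel_measurable RZ"
    unfolding dirac_kernel_def normal_density_def by measurable
  have "(\<integral>\<^sup>+y'. ennreal (dirac_kernel \<sigma> y y') \<partial>RZ)
      = (\<integral>\<^sup>+n. \<integral>\<^sup>+x. indicator {snd y} n * ennreal (normal_density (fst y) \<tau> x) \<partial>lborel \<partial>count_space UNIV)"
    by (subst nn_integral_RZ_snd)
       (auto intro!: nn_integral_cong simp: dirac_kernel_def \<tau>_def indicator_def)
  also have "(\<lambda>n. \<integral>\<^sup>+x. indicator {snd y} n * ennreal (normal_density (fst y) \<tau> x) \<partial>lborel) = indicator {snd y}"
  proof
    fix n
    have "(\<integral>\<^sup>+x. ennreal (normal_density (fst y) \<tau> x) \<partial>lborel) = 1"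
      using \<open>0 < \<tau>\<close> by (subst nn_integral_eq_integral) auto
    then show "(\<integral>\<^sup>+x. indicator {snd y} n * ennreal (normal_density (fst y) \<tau> x) \<partial>lborel) = indicator {snd y} n"
      by (simp add: nn_integral_cmult)
  qed
  finally show ?thesis by simp
qed

text \<open>The integral splits into a Gaussian Fourier integral on the line and an orthogonality
  relation on the circle; the window makes the former converge.\<close>

lemma norm_integral_gauss_character:
  assumes "0 < \<sigma>"
  shows "norm (\<integral>x. gauss \<sigma> (fst x) *\<^sub>R (character x y * cnj (character x y')) \<partial>RT) = dirac_kernel \<sigma> y y'"
proof -
  define \<theta> where "\<theta> = 2 * pi * (fst y - fst y')"
  define m where "m = snd y - snd y'"
  have e: "(\<lambda>x. gauss \<sigma> (fst x) *\<^sub>R (character x y * cnj (character x y')))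
      = (\<lambda>(x, x'). (gauss \<sigma> x *\<^sub>R cis (x * \<theta>)) * cis (2 * pi * (x' * of_int m)))"
    by (auto simp: fun_eq_iff character_eq cis_cnj cis_mult \<theta>_def m_def algebra_simps scaleR_conv_of_real)
  have i1: "integrable lborel (\<lambda>x. gauss \<sigma> x *\<^sub>R cis (x * \<theta>))"
    by (rule Bochner_Integration.integrable_bound[OF integrable_gauss[OF assms]]) auto
  have i2: "integrable (restrict_space lborel {0..<1}) (\<lambda>x. cis (2 * pi * (x * of_int m)))"
  proof (rule integrableI_bounded_set[where A = "{0..<1}" and B = 1])
    show "(\<lambda>x. cis (2 * pi * (x * of_int m))) \<in> borel_measurable (restrict_space lborel {0..<1})"
      by (rule measurable_restrict_space1) measurable
  qed (auto simp: emeasure_restrict_space sets_restrict_space_iff AE_restrict_space_iff)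
  have "(\<integral>x. gauss \<sigma> (fst x) *\<^sub>R (character x y * cnj (character x y')) \<partial>RT)
      = complex_of_real (sqrt (2 * pi) * \<sigma> * exp (- (\<sigma> * \<theta>)\<^sup>2 / 2)) * (if m = 0 then 1 else 0)"
    unfolding e RT_def
    by (subst integral_tensor[OF sigma_finite_lborel sigma_finite_period i1 i2])
       (simp only: gauss_Fourier[OF assms] integral_character_period)
  then have "norm (\<integral>x. gauss \<sigma> (fst x) *\<^sub>R (character x y * cnj (character x y')) \<partial>RT)
      = (if m = 0 then sqrt (2 * pi) * \<sigma> * exp (- (\<sigma> * \<theta>)\<^sup>2 / 2) else 0)"
    using assms by (simp add: norm_mult)
  also have "sqrt (2 * pi) * \<sigma> * exp (- (\<sigma> * \<theta>)\<^sup>2 / 2) = normal_density (fst y) (1 / (2 * pi * \<sigma>)) (fst y')"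
  proof -
    have "1 / sqrt (2 * pi * (1 / (2 * pi * \<sigma>))\<^sup>2) = sqrt (2 * pi) * \<sigma>"
      using assms by (simp add: power_divide power_mult_distrib real_sqrt_divide real_sqrt_mult field_simps power2_eq_square)
    moreover have "- (fst y' - fst y)\<^sup>2 / (2 * (1 / (2 * pi * \<sigma>))\<^sup>2) = - (\<sigma> * \<theta>)\<^sup>2 / 2"
      using assms by (simp add: \<theta>_def power_divide power_mult_distrib power2_commute[of "fst y'"])
    ultimately show ?thesis by (simp add: normal_density_def)
  qed
  finally show ?thesis by (simp add: dirac_kernel_def m_def)
qed

text \<open>Schur's test: |h(y) h(y')| is at most half the sum of the squares, and
  \<open>dirac_kernel\<close> is symmetric with mass 1 in each variable, so no constant is
  lost.\<close>

lemma Parseval_inequality_gauss: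
  assumes "0 < \<sigma>" and h: "integrable RZ h"
  shows "(\<integral>\<^sup>+x. ennreal (gauss \<sigma> (fst x) * (norm (\<integral>y. character x y * h y \<partial>RZ))\<^sup>2) \<partial>RT)
    \<le> (\<integral>\<^sup>+y. ennreal ((norm (h y))\<^sup>2) \<partial>RZ)"
proof -
  have [measurable]: "h \<in> borel_measurable RZ" using h by auto
  have gi: "integrable RT (\<lambda>x. gauss \<sigma> (fst x))"
  proof -
    have "integrable RT (\<lambda>(x, x'). gauss \<sigma> x * (1::real))"
      unfolding RT_def
    proof (rule integrable_tensor[OF sigma_finite_period integrable_gauss[OF assms(1)]])
      show "integrable (restrict_space lborel {0..<1::real}) (\<lambda>_. 1::real)"
        by (rule integrableI_bounded_set[where A = "{0..<1}" and B = 1])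
           (auto simp: emeasure_restrict_space sets_restrict_space_iff AE_restrict_space_iff)
    qed
    then show ?thesis by (simp add: case_prod_unfold)
  qed
  have [measurable]: "(\<lambda>y'. dirac_kernel \<sigma> y y') \<in> borel_measurable RZ" "(\<lambda>y'. dirac_kernel \<sigma> y' y) \<in> borel_measurable RZ" for y
    unfolding dirac_kernel_def normal_density_def by measurable
  let ?N = "\<integral>\<^sup>+y. ennreal ((norm (h y))\<^sup>2 / 2) \<partial>RZ"
  have "(\<integral>\<^sup>+x. ennreal (gauss \<sigma> (fst x) * (norm (\<integral>y. character x y * h y \<partial>RZ))\<^sup>2) \<partial>RT)
    \<le> (\<integral>\<^sup>+y. \<integral>\<^sup>+y'. ennreal (norm (h y) * norm (h y') *
        norm (\<integral>x. gauss \<sigma> (fst x) *\<^sub>R (character x y * cnj (character x y')) \<partial>RT)) \<partial>RZ \<partial>RZ)"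
    by (rule nn_integral_oscillatory_square_le[OF sigma_finite_RT sigma_finite_RZ gi _ h])
       (auto simp: less_imp_le)
  also have "\<dots> = (\<integral>\<^sup>+y. \<integral>\<^sup>+y'. ennreal (norm (h y) * norm (h y') * dirac_kernel \<sigma> y y') \<partial>RZ \<partial>RZ)"
    by (simp add: norm_integral_gauss_character[OF assms(1)])
  also have "\<dots> \<le> (\<integral>\<^sup>+y. \<integral>\<^sup>+y'. ennreal ((norm (h y))\<^sup>2 / 2) * ennreal (dirac_kernel \<sigma> y y') +
      ennreal ((norm (h y'))\<^sup>2 / 2) * ennreal (dirac_kernel \<sigma> y y') \<partial>RZ \<partial>RZ)"
  proof (intro nn_integral_mono)
    fix y y'
    have "norm (h y) * norm (h y') \<le> (norm (h y))\<^sup>2 / 2 + (norm (h y'))\<^sup>2 / 2"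
      using sum_squares_bound[of "norm (h y)" "norm (h y')"] by simp
    then have "norm (h y) * norm (h y') * dirac_kernel \<sigma> y y'
        \<le> ((norm (h y))\<^sup>2 / 2 + (norm (h y'))\<^sup>2 / 2) * dirac_kernel \<sigma> y y'"
      by (rule mult_right_mono) simp
    then have "ennreal (norm (h y) * norm (h y') * dirac_kernel \<sigma> y y')
        \<le> ennreal (((norm (h y))\<^sup>2 / 2 + (norm (h y'))\<^sup>2 / 2) * dirac_kernel \<sigma> y y')"
      by (rule ennreal_leI)
    also have "\<dots> = ennreal ((norm (h y))\<^sup>2 / 2) * ennreal (dirac_kernel \<sigma> y y') +
        ennreal ((norm (h y'))\<^sup>2 / 2) * ennreal (dirac_kernel \<sigma> y y')"
      by (subst ennreal_mult, simp, simp, subst ennreal_plus) (simp_all add: distrib_right)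
    finally show "ennreal (norm (h y) * norm (h y') * dirac_kernel \<sigma> y y')
      \<le> ennreal ((norm (h y))\<^sup>2 / 2) * ennreal (dirac_kernel \<sigma> y y') + ennreal ((norm (h y'))\<^sup>2 / 2) * ennreal (dirac_kernel \<sigma> y y')" .
  qed
  also have "\<dots> = (\<integral>\<^sup>+y. \<integral>\<^sup>+y'. ennreal ((norm (h y))\<^sup>2 / 2) * ennreal (dirac_kernel \<sigma> y y') \<partial>RZ \<partial>RZ) +
      (\<integral>\<^sup>+y. \<integral>\<^sup>+y'. ennreal ((norm (h y'))\<^sup>2 / 2) * ennreal (dirac_kernel \<sigma> y y') \<partial>RZ \<partial>RZ)"
    by (simp add: nn_integral_add)
  also have "(\<integral>\<^sup>+y. \<integral>\<^sup>+y'. ennreal ((norm (h y'))\<^sup>2 / 2) * ennreal (dirac_kernel \<sigma> y y') \<partial>RZ \<partial>RZ)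
      = (\<integral>\<^sup>+y'. \<integral>\<^sup>+y. ennreal ((norm (h y'))\<^sup>2 / 2) * ennreal (dirac_kernel \<sigma> y' y) \<partial>RZ \<partial>RZ)"
    by (subst nn_integral_RZ_swap) (simp_all add: dirac_kernel_commute)
  also have "(\<integral>\<^sup>+y. \<integral>\<^sup>+y'. ennreal ((norm (h y))\<^sup>2 / 2) * ennreal (dirac_kernel \<sigma> y y') \<partial>RZ \<partial>RZ) = ?N"
    by (simp add: nn_integral_cmult nn_integral_dirac_kernel[OF assms(1)])
  also have "?N + ?N = (\<integral>\<^sup>+y. ennreal ((norm (h y))\<^sup>2 / 2) + ennreal ((norm (h y))\<^sup>2 / 2) \<partial>RZ)"
    by (simp add: nn_integral_add)
  also have "\<dots> = (\<integral>\<^sup>+y. ennreal ((norm (h y))\<^sup>2) \<partial>RZ)"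
    by (simp add: ennreal_plus[symmetric] del: ennreal_plus)
  finally show ?thesis .
qed

text \<open>The bound with a Gaussian window does not depend on its width, and the windows increase
  to 1; monotone convergence removes them.\<close>

lemma Parseval_inequality:
  assumes h: "integrable RZ h"
  shows "(\<integral>\<^sup>+x. ennreal ((norm (\<integral>y. character x y * h y \<partial>RZ))\<^sup>2) \<partial>RT)
    \<le> (\<integral>\<^sup>+y. ennreal ((norm (h y))\<^sup>2) \<partial>RZ)"
proof -
  have [measurable]: "h \<in> borel_measurable RZ" using h by auto
  define U where "U x = (norm (\<integral>y. character x y * h y \<partial>RZ))\<^sup>2" for x
  have [measurable]: "U \<in> borel_measurable RT"
    unfolding U_def[abs_def] by measurable
  define f where "f k x = ennreal (gauss (real (Suc k)) (fst x) * U x)" for k x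
  have [measurable]: "f k \<in> borel_measurable RT" for k
    unfolding f_def[abs_def] by measurable
  have "incseq f"
  proof (intro incseq_SucI le_funI)
    fix k and x :: "real \<times> real"
    have "gauss (real (Suc k)) (fst x) \<le> gauss (real (Suc (Suc k))) (fst x)"
      unfolding gauss_def by (simp add: divide_left_mono mult_mono power_mono frac_le)
    then show "f k x \<le> f (Suc k) x"
      unfolding f_def by (intro ennreal_leI mult_right_mono) (auto simp: U_def)
  qed
  have lim: "(SUP k. f k x) = ennreal (U x)" for x
  proof (rule LIMSEQ_unique[OF LIMSEQ_SUP])
    show "incseq (\<lambda>k. f k x)"
      using \<open>incseq f\<close> unfolding incseq_def le_fun_def by blast
    have "(\<lambda>k. gauss (real (Suc k)) (fst x)) \<longlonglongrightarrow> exp 0"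
      unfolding gauss_def by real_asymp
    then have "(\<lambda>k. gauss (real (Suc k)) (fst x) * U x) \<longlonglongrightarrow> exp 0 * U x"
      by (intro tendsto_intros)
    then show "(\<lambda>k. f k x) \<longlonglongrightarrow> ennreal (U x)"
      unfolding f_def by (intro tendsto_ennrealI) simp
  qed
  have "(\<integral>\<^sup>+x. ennreal (U x) \<partial>RT) = (SUP k. \<integral>\<^sup>+x. f k x \<partial>RT)"
    unfolding lim[symmetric] by (rule nn_integral_monotone_convergence_SUP) (auto simp: \<open>incseq f\<close>)
  also have "\<dots> \<le> (\<integral>\<^sup>+y. ennreal ((norm (h y))\<^sup>2) \<partial>RZ)"
    unfolding f_def U_def by (intro SUP_least Parseval_inequality_gauss h) simp
  finally show ?thesis unfolding U_def .
qed

section \<open>Convolutions\<close>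

lemma integral_RZ_shift:
  fixes f :: "real \<times> int \<Rightarrow> complex"
  assumes [measurable]: "f \<in> borel_measurable RZ"
  shows "(\<integral>y. f (y - c) \<partial>RZ) = (\<integral>y. f y \<partial>RZ)"
proof -
  have "distr RZ RZ (\<lambda>y. y - c) = RZ"
  proof (rule measure_eqI)
    fix S assume "S \<in> sets (distr RZ RZ (\<lambda>y. y - c))"
    then have [measurable]: "S \<in> sets RZ" by simp
    have "emeasure (distr RZ RZ (\<lambda>y. y - c)) S = (\<integral>\<^sup>+y. indicator S y \<partial>distr RZ RZ (\<lambda>y. y - c))"
      by simp
    also have "\<dots> = (\<integral>\<^sup>+y. indicator S (y - c) \<partial>RZ)"
      by (rule nn_integral_distr) measurable
    finally show "emeasure (distr RZ RZ (\<lambda>y. y - c)) S = emeasure RZ S"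
      by (simp add: nn_integral_RZ_shift'[where f = "indicator S"])
  qed simp
  then show ?thesis
    using integral_distr[of "\<lambda>y. y - c" RZ RZ f] by simp
qed

lemma integrable_convolution:
  fixes f g :: "real \<times> int \<Rightarrow> complex"
  assumes f: "integrable RZ f" and g: "integrable RZ g"
  shows "integrable (RZ \<Otimes>\<^sub>M RZ) (\<lambda>(\<zeta>, y). f y * g (\<zeta> - y))"
proof (rule integrableI_bounded)
  have [measurable]: "f \<in> borel_measurable RZ" "g \<in> borel_measurable RZ"
    using f g by auto
  show "(\<lambda>(\<zeta>, y). f y * g (\<zeta> - y)) \<in> borel_measurable (RZ \<Otimes>\<^sub>M RZ)"
    by measurable
  have "(\<integral>\<^sup>+p. ennreal (norm (case p of (\<zeta>, y) \<Rightarrow> f y * g (\<zeta> - y))) \<partial>(RZ \<Otimes>\<^sub>M RZ))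
      = (\<integral>\<^sup>+\<zeta>. \<integral>\<^sup>+y. ennreal (norm (f y)) * ennreal (norm (g (\<zeta> - y))) \<partial>RZ \<partial>RZ)"
    by (subst RZ.nn_integral_fst[symmetric]) (auto simp: norm_mult ennreal_mult)
  also have "\<dots> = (\<integral>\<^sup>+y. ennreal (norm (f y)) * (\<integral>\<^sup>+\<zeta>. ennreal (norm (g (\<zeta> - y))) \<partial>RZ) \<partial>RZ)"
    by (subst nn_integral_RZ_swap) (simp_all add: nn_integral_cmult)
  also have "\<dots> = (\<integral>\<^sup>+y. ennreal (norm (f y)) \<partial>RZ) * (\<integral>\<^sup>+\<zeta>. ennreal (norm (g \<zeta>)) \<partial>RZ)"
    by (simp add: nn_integral_RZ_shift'[where f = "\<lambda>\<zeta>. ennreal (norm (g \<zeta>))"] nn_integral_multc)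
  also have "\<dots> < \<infinity>"
    using f g by (simp add: integrable_iff_bounded ennreal_mult_less_top)
  finally show "(\<integral>\<^sup>+p. ennreal (norm (case p of (\<zeta>, y) \<Rightarrow> f y * g (\<zeta> - y))) \<partial>(RZ \<Otimes>\<^sub>M RZ)) < \<infinity>" .
qed

lemma character_integral_mult:
  fixes f g :: "real \<times> int \<Rightarrow> complex"
  assumes f: "integrable RZ f" and g: "integrable RZ g"
  shows "(\<integral>y. character x y * f y \<partial>RZ) * (\<integral>y. character x y * g y \<partial>RZ)
    = (\<integral>\<zeta>. character x \<zeta> * (\<integral>y. f y * g (\<zeta> - y) \<partial>RZ) \<partial>RZ)"
proof -
  have [measurable]: "f \<in> borel_measurable RZ" "g \<in> borel_measurable RZ"
    using f g by auto
  have i: "integrable (RZ \<Otimes>\<^sub>M RZ) (\<lambda>(\<zeta>, y). character x \<zeta> * (f y * g (\<zeta> - y)))"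
    by (rule Bochner_Integration.integrable_bound[OF integrable_convolution[OF f g]])
       (auto simp: norm_mult)
  have "(\<integral>y. character x y * f y \<partial>RZ) * (\<integral>y. character x y * g y \<partial>RZ)
      = (\<integral>y. (character x y * f y) * (\<integral>\<zeta>. character x (\<zeta> - y) * g (\<zeta> - y) \<partial>RZ) \<partial>RZ)"
    by (simp add: integral_RZ_shift[where f = "\<lambda>\<zeta>. character x \<zeta> * g \<zeta>"])
  also have "\<dots> = (\<integral>y. \<integral>\<zeta>. character x \<zeta> * (f y * g (\<zeta> - y)) \<partial>RZ \<partial>RZ)"
  proof (rule Bochner_Integration.integral_cong[OF refl])
    fix y
    have "(character x y * f y) * (\<integral>\<zeta>. character x (\<zeta> - y) * g (\<zeta> - y) \<partial>RZ)
        = (\<integral>\<zeta>. (character x y * f y) * (character x (\<zeta> - y) * g (\<zeta> - y)) \<partial>RZ)"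
      by simp
    also have "\<dots> = (\<integral>\<zeta>. character x \<zeta> * (f y * g (\<zeta> - y)) \<partial>RZ)"
    proof (rule Bochner_Integration.integral_cong[OF refl])
      fix \<zeta>
      show "(character x y * f y) * (character x (\<zeta> - y) * g (\<zeta> - y)) = character x \<zeta> * (f y * g (\<zeta> - y))"
        using character_add[of x y "\<zeta> - y"] by simp
    qed
    finally show "(character x y * f y) * (\<integral>\<zeta>. character x (\<zeta> - y) * g (\<zeta> - y) \<partial>RZ)
        = (\<integral>\<zeta>. character x \<zeta> * (f y * g (\<zeta> - y)) \<partial>RZ)" .
  qed
  also have "\<dots> = (\<integral>\<zeta>. \<integral>y. character x \<zeta> * (f y * g (\<zeta> - y)) \<partial>RZ \<partial>RZ)"
    by (rule RZRZ.Fubini_integral[OF i])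
  finally show ?thesis by simp
qed

section \<open>The Schroedinger evolution\<close>

text \<open>For the least l with |v| \<le> 2^l, either l = 0 or |v| > 2^(l-1), and then exp(-v^2 /
  2) \<le> 2 / v^2 \<le> 8 * 4^(-l). This decay is enough, as the form grows only linearly in the
  width of the layer.\<close>

lemma exp_gauss_le_dyadic:
  fixes v :: real
  shows "ennreal (exp (- v\<^sup>2 / 2)) \<le> (\<Sum>l. ennreal (8 * (1/4) ^ l) * indicator {v. \<bar>v\<bar> \<le> 2 ^ l} v)"
proof -
  obtain n where "\<bar>v\<bar> < 2 ^ n"
    using real_arch_pow[of 2 "\<bar>v\<bar>"] by auto
  then have ex: "\<exists>l. \<bar>v\<bar> \<le> 2 ^ l" by (auto intro: less_imp_le)
  define l where "l = (LEAST l. \<bar>v\<bar> \<le> 2 ^ l)"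
  have l: "\<bar>v\<bar> \<le> 2 ^ l"
    unfolding l_def using ex by (rule LeastI_ex)
  have "exp (- v\<^sup>2 / 2) \<le> 8 * (1/4) ^ l"
  proof (cases l)
    case 0
    have "exp (- v\<^sup>2 / 2) \<le> 1" by simp
    also have "\<dots> \<le> 8 * (1/4) ^ l" using 0 by simp
    finally show ?thesis .
  next
    case (Suc k)
    have "\<not> \<bar>v\<bar> \<le> 2 ^ k"
      using Suc not_less_Least[of k "\<lambda>l. \<bar>v\<bar> \<le> 2 ^ l"] unfolding l_def by auto
    then have "(2 ^ k)\<^sup>2 \<le> \<bar>v\<bar>\<^sup>2"
      by (intro power_mono) auto
    moreover have "(2 ^ k)\<^sup>2 = (4 :: real) ^ k"
      by (simp add: power2_eq_square flip: power_mult_distrib)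
    ultimately have v: "4 ^ k \<le> v\<^sup>2" by simp
    have "0 < v\<^sup>2" by (rule less_le_trans[OF _ v]) simp
    have "v\<^sup>2 / 2 \<le> exp (v\<^sup>2 / 2)"
      using exp_ge_add_one_self[of "v\<^sup>2 / 2"] by linarith
    then have "exp (- v\<^sup>2 / 2) \<le> 1 / (v\<^sup>2 / 2)"
      using \<open>0 < v\<^sup>2\<close> by (simp add: exp_minus field_simps)
    also have "\<dots> = 2 / v\<^sup>2" by simp
    also have "\<dots> \<le> 2 / 4 ^ k"
      using v by (intro divide_left_mono) (auto intro: mult_pos_pos \<open>0 < v\<^sup>2\<close>)
    finally show ?thesis using Suc by (simp add: power_one_over)
  qed
  then have "ennreal (exp (- v\<^sup>2 / 2)) \<le> ennreal (8 * (1/4) ^ l) * indicator {v. \<bar>v\<bar> \<le> 2 ^ l} v"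
    using l by (simp add: ennreal_leI)
  also have "\<dots> = (\<Sum>l\<in>{l}. ennreal (8 * (1/4) ^ l) * indicator {v. \<bar>v\<bar> \<le> 2 ^ l} v)"
    by (simp only: sum.insert[OF finite.emptyI] sum.empty empty_iff not_False_eq_True add_0_right)
  also have "\<dots> \<le> (\<Sum>l. ennreal (8 * (1/4) ^ l) * indicator {v. \<bar>v\<bar> \<le> 2 ^ l} v)"
    by (rule sum_le_suminf) auto
  finally show ?thesis .
qed

lemma quad_form_suminf:
  assumes [measurable]: "\<And>l. K l \<in> borel_measurable RZ3"
    "f \<in> borel_measurable RZ" "f' \<in> borel_measurable RZ" "g \<in> borel_measurable RZ" "g' \<in> borel_measurable RZ"
  shows "quad_form (\<lambda>x. \<Sum>l. c l * K l x) f f' g g' = (\<Sum>l. c l * quad_form (K l) f f' g g')"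
proof -
  have "quad_form (\<lambda>x. \<Sum>l. c l * K l x) f f' g g'
    = (\<integral>\<^sup>+\<zeta>. \<integral>\<^sup>+y. \<integral>\<^sup>+y'. (\<Sum>l. c l * (f y * g (\<zeta> - y) * (f' y' * g' (\<zeta> - y')) * K l (\<zeta>, y, y'))) \<partial>RZ \<partial>RZ \<partial>RZ)"
    unfolding quad_form_def by (simp add: ennreal_suminf_cmult[symmetric] mult_ac)
  also have "\<dots> = (\<Sum>l. c l * quad_form (K l) f f' g g')"
    unfolding quad_form_def by (simp add: nn_integral_suminf nn_integral_cmult)
  finally show ?thesis .
qed

lemma quad_form_mono:
  assumes "\<And>x. K x \<le> L x"
  shows "quad_form K f f' g g' \<le> quad_form L f f' g g'"
  unfolding quad_form_def by (intro nn_integral_mono mult_left_mono assms) simp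

lemma quad_form_cmult:
  assumes [measurable]: "K \<in> borel_measurable RZ3"
    "f \<in> borel_measurable RZ" "f' \<in> borel_measurable RZ" "g \<in> borel_measurable RZ" "g' \<in> borel_measurable RZ"
  shows "quad_form (\<lambda>x. c * K x) f f' g g' = c * quad_form K f f' g g'"
proof -
  have "quad_form (\<lambda>x. c * K x) f f' g g'
    = (\<integral>\<^sup>+\<zeta>. \<integral>\<^sup>+y. \<integral>\<^sup>+y'. c * (f y * g (\<zeta> - y) * (f' y' * g' (\<zeta> - y')) * K (\<zeta>, y, y')) \<partial>RZ \<partial>RZ \<partial>RZ)"
    unfolding quad_form_def by (simp add: mult_ac)
  then show ?thesis
    unfolding quad_form_def by (simp add: nn_integral_cmult)
qed

definition sq_norm :: "real \<times> int \<Rightarrow> real" where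
  "sq_norm y = (fst y)\<^sup>2 + (of_int (snd y))\<^sup>2"

lemma measurable_sq_norm [measurable]: "sq_norm \<in> borel_measurable RZ"
  unfolding sq_norm_def[abs_def] by measurable

lemma sq_norm_resonance:
  "(sq_norm y + sq_norm (\<zeta> - y)) - (sq_norm y' + sq_norm (\<zeta> - y')) = 2 * resonance (\<zeta>, y, y')"
  by (simp add: sq_norm_def resonance_def rz_inner_def power2_eq_square algebra_simps)

text \<open>The Fourier transform in x, at total frequency \<zeta>, of the product of the two
  evolutions at time t. The phase is written as t times a real number to match
  \<open>gauss_Fourier\<close>.\<close>

definition bilinear_profile :: "(real \<times> int \<Rightarrow> complex) \<Rightarrow> (real \<times> int \<Rightarrow> complex) \<Rightarrow> real \<Rightarrow> real \<times> int \<Rightarrow> complex" where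
  "bilinear_profile F G t \<zeta> =
     (\<integral>y. cis (t * (- (4 * pi\<^sup>2 * (sq_norm y + sq_norm (\<zeta> - y))))) * (F y * G (\<zeta> - y)) \<partial>RZ)"

lemma schroedinger_eq:
  "schroedinger F t x = (\<integral>y. character x y * (cis (- (4 * pi\<^sup>2 * t * sq_norm y)) * F y) \<partial>RZ)"
  unfolding schroedinger_def
proof (rule Bochner_Integration.integral_cong[OF refl])
  fix y
  have "2 * pi * (a - 2 * pi * t * b) = 2 * pi * a + - (4 * pi\<^sup>2 * t * b)" for a b
    by (simp add: power2_eq_square algebra_simps)
  then have "cis (2 * pi * (x \<bullet> embed_RZ y - 2 * pi * t * (norm (embed_RZ y))\<^sup>2))
      = character x y * cis (- (4 * pi\<^sup>2 * t * sq_norm y))"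
    unfolding character_def sq_norm_def norm_embed_RZ_sq by (simp only: cis_mult)
  then show "cis (2 * pi * (x \<bullet> embed_RZ y - 2 * pi * t * (norm (embed_RZ y))\<^sup>2)) * F y
      = character x y * (cis (- (4 * pi\<^sup>2 * t * sq_norm y)) * F y)"
    by simp
qed

lemma schroedinger_mult:
  assumes F: "integrable RZ F" and G: "integrable RZ G"
  shows "schroedinger F t x * schroedinger G t x = (\<integral>\<zeta>. character x \<zeta> * bilinear_profile F G t \<zeta> \<partial>RZ)"
    and "integrable RZ (bilinear_profile F G t)"
proof -
  have [measurable]: "F \<in> borel_measurable RZ" "G \<in> borel_measurable RZ"
    using F G by auto
  define e where "e y = cis (- (4 * pi\<^sup>2 * t * sq_norm y))" for y
  have [measurable]: "e \<in> borel_measurable RZ"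
    unfolding e_def[abs_def] by measurable
  have F': "integrable RZ (\<lambda>y. e y * F y)"
    by (rule Bochner_Integration.integrable_bound[OF F]) (auto simp: norm_mult e_def)
  have G': "integrable RZ (\<lambda>y. e y * G y)"
    by (rule Bochner_Integration.integrable_bound[OF G]) (auto simp: norm_mult e_def)
  have eq: "bilinear_profile F G t \<zeta> = (\<integral>y. (e y * F y) * (e (\<zeta> - y) * G (\<zeta> - y)) \<partial>RZ)" for \<zeta>
    unfolding bilinear_profile_def
  proof (rule Bochner_Integration.integral_cong[OF refl])
    fix y
    have "cis (t * (- (4 * pi\<^sup>2 * (sq_norm y + sq_norm (\<zeta> - y))))) = e y * e (\<zeta> - y)"
      by (simp add: e_def cis_mult algebra_simps)
    then show "cis (t * (- (4 * pi\<^sup>2 * (sq_norm y + sq_norm (\<zeta> - y))))) * (F y * G (\<zeta> - y))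
        = (e y * F y) * (e (\<zeta> - y) * G (\<zeta> - y))"
      by (simp add: mult_ac)
  qed
  show "schroedinger F t x * schroedinger G t x = (\<integral>\<zeta>. character x \<zeta> * bilinear_profile F G t \<zeta> \<partial>RZ)"
    unfolding schroedinger_eq eq using character_integral_mult[OF F' G', of x] by (simp add: e_def)
  show "integrable RZ (bilinear_profile F G t)"
    unfolding eq[abs_def] using RZRZ.integrable_fst'[OF integrable_convolution[OF F' G']] by simp
qed

lemma measurable_bilinear_profile [measurable]:
  assumes [measurable]: "F \<in> borel_measurable RZ" "G \<in> borel_measurable RZ"
  shows "(\<lambda>(t, \<zeta>). bilinear_profile F G t \<zeta>) \<in> borel_measurable (lborel \<Otimes>\<^sub>M RZ)"
  unfolding bilinear_profile_def by measurable

text \<open>For each \<zeta> the square is expanded and the time integral is done first. The phases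
  at y and y' differ by 8 pi^2 times the resonance up to sign, so a Gaussian in T times the
  resonance results; 8 pi^2 is lowered to 1, and 3 bounds sqrt(2 pi).\<close>

lemma nn_integral_bilinear_profile_le:
  assumes [measurable]: "F \<in> borel_measurable RZ" "G \<in> borel_measurable RZ"
    and FG: "\<And>\<zeta>. integrable RZ (\<lambda>y. F y * G (\<zeta> - y))" and "0 < T"
  shows "(\<integral>\<^sup>+t. ennreal (gauss T t) * (\<integral>\<^sup>+\<zeta>. ennreal ((norm (bilinear_profile F G t \<zeta>))\<^sup>2) \<partial>RZ) \<partial>lborel)
    \<le> ennreal (3 * T) * quad_form (\<lambda>x. ennreal (exp (- (T * resonance x)\<^sup>2 / 2)))
        (\<lambda>y. ennreal (norm (F y))) (\<lambda>y. ennreal (norm (F y))) (\<lambda>y. ennreal (norm (G y))) (\<lambda>y. ennreal (norm (G y)))"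
proof -
  interpret pair_sigma_finite lborel RZ ..
  let ?D = "\<lambda>\<zeta> y y'. ennreal (norm (F y)) * ennreal (norm (G (\<zeta> - y))) * (ennreal (norm (F y')) * ennreal (norm (G (\<zeta> - y')))) *
      (ennreal (3 * T) * ennreal (exp (- (T * resonance (\<zeta>, y, y'))\<^sup>2 / 2)))"
  have kernel: "norm (\<integral>t. gauss T t *\<^sub>R (cis (t * a) * cnj (cis (t * b))) \<partial>lborel) = sqrt (2 * pi) * T * exp (- (T * (a - b))\<^sup>2 / 2)" for a b
  proof -
    have "(\<lambda>t. gauss T t *\<^sub>R (cis (t * a) * cnj (cis (t * b)))) = (\<lambda>t. gauss T t *\<^sub>R cis (t * (a - b)))"
      by (simp add: fun_eq_iff cis_cnj cis_mult algebra_simps)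
    then show ?thesis
      using \<open>0 < T\<close> by (simp add: gauss_Fourier norm_mult)
  qed
  have sq2pi: "sqrt (2 * pi) \<le> 3"
    using pi_less_4 by (intro real_le_lsqrt) auto
  have "(\<integral>\<^sup>+t. ennreal (gauss T t) * (\<integral>\<^sup>+\<zeta>. ennreal ((norm (bilinear_profile F G t \<zeta>))\<^sup>2) \<partial>RZ) \<partial>lborel)
      = (\<integral>\<^sup>+t. \<integral>\<^sup>+\<zeta>. ennreal (gauss T t * (norm (bilinear_profile F G t \<zeta>))\<^sup>2) \<partial>RZ \<partial>lborel)"
    by (simp add: nn_integral_cmult[symmetric] ennreal_mult less_imp_le)
  also have "\<dots> = (\<integral>\<^sup>+\<zeta>. \<integral>\<^sup>+t. ennreal (gauss T t * (norm (bilinear_profile F G t \<zeta>))\<^sup>2) \<partial>lborel \<partial>RZ)"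
    by (rule Fubini'[symmetric]) measurable
  also have "\<dots> \<le> (\<integral>\<^sup>+\<zeta>. \<integral>\<^sup>+y. \<integral>\<^sup>+y'. ?D \<zeta> y y' \<partial>RZ \<partial>RZ \<partial>RZ)"
  proof (rule nn_integral_mono)
    fix \<zeta>
    let ?\<kappa> = "\<lambda>y. - (4 * pi\<^sup>2 * (sq_norm y + sq_norm (\<zeta> - y)))"
    let ?N = "\<lambda>y y'. norm (F y * G (\<zeta> - y)) * norm (F y' * G (\<zeta> - y')) *
          norm (\<integral>t. gauss T t *\<^sub>R (cis (t * ?\<kappa> y) * cnj (cis (t * ?\<kappa> y'))) \<partial>lborel)"
    have "(\<integral>\<^sup>+t. ennreal (gauss T t * (norm (bilinear_profile F G t \<zeta>))\<^sup>2) \<partial>lborel)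
      \<le> (\<integral>\<^sup>+y. \<integral>\<^sup>+y'. ennreal (?N y y') \<partial>RZ \<partial>RZ)"
      unfolding bilinear_profile_def
      by (rule nn_integral_oscillatory_square_le[OF sigma_finite_lborel sigma_finite_RZ integrable_gauss[OF \<open>0 < T\<close>] _ FG])
         (auto simp: less_imp_le)
    also have "\<dots> \<le> (\<integral>\<^sup>+y. \<integral>\<^sup>+y'. ?D \<zeta> y y' \<partial>RZ \<partial>RZ)"
    proof (intro nn_integral_mono)
      fix y y'
      let ?r = "resonance (\<zeta>, y, y')"
      have "?\<kappa> y - ?\<kappa> y' = - (4 * pi\<^sup>2) * ((sq_norm y + sq_norm (\<zeta> - y)) - (sq_norm y' + sq_norm (\<zeta> - y')))"
        by (simp add: algebra_simps)
      then have \<kappa>: "?\<kappa> y - ?\<kappa> y' = - (8 * pi\<^sup>2) * ?r"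
        unfolding sq_norm_resonance by simp
      have "1 \<le> 8 * pi\<^sup>2"
        using one_le_power[of pi 2] pi_gt3 by linarith
      then have "\<bar>T * ?r\<bar> \<le> \<bar>T * (?\<kappa> y - ?\<kappa> y')\<bar>"
        unfolding \<kappa> abs_mult using mult_right_mono[of 1 "8 * pi\<^sup>2" "\<bar>T\<bar> * \<bar>?r\<bar>"] by (simp add: abs_mult mult_ac)
      then have "(T * ?r)\<^sup>2 \<le> (T * (?\<kappa> y - ?\<kappa> y'))\<^sup>2"
        by (simp add: abs_le_square_iff)
      then have "sqrt (2 * pi) * T * exp (- (T * (?\<kappa> y - ?\<kappa> y'))\<^sup>2 / 2) \<le> 3 * T * exp (- (T * ?r)\<^sup>2 / 2)"
        using sq2pi \<open>0 < T\<close> by (intro mult_mono) auto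
      then have "ennreal (?N y y')
          \<le> ennreal ((norm (F y) * norm (G (\<zeta> - y))) * (norm (F y') * norm (G (\<zeta> - y'))) * (3 * T * exp (- (T * ?r)\<^sup>2 / 2)))"
        unfolding kernel norm_mult by (intro ennreal_leI mult_left_mono) auto
      also have "\<dots> = ?D \<zeta> y y'"
        using \<open>0 < T\<close> by (simp only: ennreal_mult norm_ge_zero mult_nonneg_nonneg exp_ge_zero less_imp_le zero_le_numeral)
      finally show "ennreal (?N y y') \<le>
          ?D \<zeta> y y'" .
    qed
    finally show "(\<integral>\<^sup>+t. ennreal (gauss T t * (norm (bilinear_profile F G t \<zeta>))\<^sup>2) \<partial>lborel) \<le> \<dots>" .
  qed
  also have "\<dots> = ennreal (3 * T) * quad_form (\<lambda>x. ennreal (exp (- (T * resonance x)\<^sup>2 / 2)))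
        (\<lambda>y. ennreal (norm (F y))) (\<lambda>y. ennreal (norm (F y))) (\<lambda>y. ennreal (norm (G y))) (\<lambda>y. ennreal (norm (G y)))"
    by (subst quad_form_cmult[symmetric]) (auto simp: quad_form_def)
  finally show ?thesis .
qed

text \<open>Layer l has width 2^l / T \<ge> 1 / T \<ge> \<delta>. Its share 8 * 4^(-l) * 588 * 2^l /
  T = 4704 * 2^(-l) / T sums to 9408 / T, and the prefactor T removes the dependence on the time
  interval.\<close>

lemma gaussian_form_estimate:
  assumes sep: "separated \<delta> A B" and "0 < \<delta>" "0 < T" "\<delta> \<le> 1 / T"
    and AB [measurable]: "A \<in> sets RZ" "B \<in> sets RZ"
    and ab [measurable]: "a \<in> borel_measurable RZ" "b \<in> borel_measurable RZ"
    and nonneg: "\<And>y. 0 \<le> a y" "\<And>y. 0 \<le> b y"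
    and supp: "\<And>y. y \<notin> A \<Longrightarrow> a y = 0" "\<And>y. y \<notin> B \<Longrightarrow> b y = 0"
    and IJ: "0 \<le> I" "0 \<le> J"
    and I: "(\<integral>\<^sup>+y. ennreal (a y powr (12/7)) \<partial>RZ) = ennreal I"
    and J: "(\<integral>\<^sup>+y. ennreal (b y powr (12/7)) \<partial>RZ) = ennreal J"
  shows "ennreal T * quad_form (\<lambda>x. ennreal (exp (- (T * resonance x)\<^sup>2 / 2)))
      (\<lambda>y. ennreal (a y)) (\<lambda>y. ennreal (a y)) (\<lambda>y. ennreal (b y)) (\<lambda>y. ennreal (b y))
    \<le> ennreal (9408 * \<delta> powr (- (2/3)) * (I powr (7/6) * J powr (7/6)))"
proof -
  let ?q = "\<lambda>K. quad_form K (\<lambda>y. ennreal (a y)) (\<lambda>y. ennreal (a y)) (\<lambda>y. ennreal (b y)) (\<lambda>y. ennreal (b y))"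
  define Z where "Z = \<delta> powr (- (2/3)) * (I powr (7/6) * J powr (7/6))"
  have "0 \<le> Z" by (simp add: Z_def)
  have "?q (\<lambda>x. ennreal (exp (- (T * resonance x)\<^sup>2 / 2)))
      \<le> ?q (\<lambda>x. \<Sum>l. ennreal (8 * (1/4) ^ l) * indicator (resonant (2 ^ l / T)) x)"
  proof (rule quad_form_mono)
    fix x
    have "indicator {v. \<bar>v\<bar> \<le> 2 ^ l} (T * resonance x) = (indicator (resonant (2 ^ l / T)) x :: ennreal)" for l
      using \<open>0 < T\<close> by (simp add: indicator_def resonant_def abs_mult field_simps)
    then show "ennreal (exp (- (T * resonance x)\<^sup>2 / 2)) \<le> (\<Sum>l. ennreal (8 * (1/4) ^ l) * indicator (resonant (2 ^ l / T)) x)"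
      using exp_gauss_le_dyadic[of "T * resonance x"] by simp
  qed
  also have "\<dots> = (\<Sum>l. ennreal (8 * (1/4) ^ l) * ?q (indicator (resonant (2 ^ l / T))))"
    by (rule quad_form_suminf) auto
  also have "\<dots> \<le> (\<Sum>l. ennreal (4704 * Z / T * (1/2) ^ l))"
  proof (rule suminf_le)
    fix l :: nat
    have "\<delta> \<le> 2 ^ l / T"
    proof -
      have "1 / T \<le> 2 ^ l / T" using \<open>0 < T\<close> by (intro divide_right_mono) auto
      then show ?thesis using \<open>\<delta> \<le> 1 / T\<close> by linarith
    qed
    then have "?q (indicator (resonant (2 ^ l / T))) \<le> ennreal (588 * (2 ^ l / T) * \<delta> powr (- (2/3)) * (I powr (7/6) * J powr (7/6)))"
      by (intro resonant_form_estimate[OF sep \<open>0 < \<delta>\<close> _ AB ab nonneg supp IJ I J])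
    then have "ennreal (8 * (1/4) ^ l) * ?q (indicator (resonant (2 ^ l / T)))
        \<le> ennreal (8 * (1/4) ^ l) * ennreal (588 * (2 ^ l / T) * \<delta> powr (- (2/3)) * (I powr (7/6) * J powr (7/6)))"
      by (rule mult_left_mono) simp
    also have "\<dots> = ennreal (8 * (1/4) ^ l * (588 * (2 ^ l / T) * \<delta> powr (- (2/3)) * (I powr (7/6) * J powr (7/6))))"
      using \<open>0 < T\<close> by (intro ennreal_mult[symmetric]) auto
    also have "8 * (1/4) ^ l * (588 * (2 ^ l / T) * \<delta> powr (- (2/3)) * (I powr (7/6) * J powr (7/6)))
        = 4704 * Z / T * ((1/4) ^ l * 2 ^ l)"
      by (simp add: Z_def mult_ac)
    also have "(1/4) ^ l * 2 ^ l = (1/2 :: real) ^ l"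
      by (simp add: power_mult_distrib[symmetric])
    finally show "ennreal (8 * (1/4) ^ l) * ?q (indicator (resonant (2 ^ l / T))) \<le> ennreal (4704 * Z / T * (1/2) ^ l)" .
  qed auto
  also have "\<dots> = ennreal (4704 * Z / T * 2)"
  proof (rule suminf_ennreal_eq)
    have "(\<lambda>l. (1/2 :: real) ^ l) sums 2"
      using geometric_sums[of "1/2 :: real"] by simp
    then show "(\<lambda>l. 4704 * Z / T * (1/2) ^ l) sums (4704 * Z / T * 2)"
      by (rule sums_mult)
  qed (use \<open>0 \<le> Z\<close> \<open>0 < T\<close> in auto)
  finally have "ennreal T * ?q (\<lambda>x. ennreal (exp (- (T * resonance x)\<^sup>2 / 2))) \<le> ennreal T * ennreal (4704 * Z / T * 2)"
    by (rule mult_left_mono) simp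
  also have "\<dots> = ennreal (9408 * Z)"
    using \<open>0 < T\<close> \<open>0 \<le> Z\<close> by (subst ennreal_mult[symmetric]) auto
  finally show ?thesis by (simp add: Z_def mult_ac)
qed

text \<open>Rational boxes generate the topology, so the a.e. complement of the support can be exhausted by
  countably many null sets.\<close>

lemma AE_ess_support:
  assumes "ess_support RZ F \<subseteq> \<theta>"
  shows "AE y in RZ. y \<notin> \<theta> \<longrightarrow> F y = 0"
proof -
  define S where "S = {(q, r, n :: int). q \<in> \<rat> \<and> r \<in> \<rat> \<and> (AE x in RZ. fst x \<in> {q<..<r} \<and> snd x = n \<longrightarrow> F x = 0)}"
  have "S \<subseteq> \<rat> \<times> \<rat> \<times> UNIV" by (auto simp: S_def)
  then have "countable S"
    by (rule countable_subset) (intro countable_SIGMA countable_rat countableI_type)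
  then have "AE x in RZ. \<forall>(q, r, n)\<in>S. fst x \<in> {q<..<r} \<and> snd x = n \<longrightarrow> F x = 0"
    by (subst AE_ball_countable) (auto simp: S_def)
  then show ?thesis
  proof eventually_elim
    case (elim y)
    show ?case
    proof
      assume "y \<notin> \<theta>"
      then obtain U where U: "open U" "y \<in> U" "AE x in RZ. x \<in> U \<longrightarrow> F x = 0"
        using assms by (auto simp: ess_support_def)
      obtain V W where VW: "open V" "open W" "y \<in> V \<times> W" "V \<times> W \<subseteq> U"
        using open_prod_elim[OF U(1,2)] by metis
      then obtain e where "0 < e" and e: "ball (fst y) e \<subseteq> V"
        using open_contains_ball[of V] by (auto simp: mem_Times_iff)
      obtain q where q: "q \<in> \<rat>" "fst y - e < q" "q < fst y"
        using Rats_dense_in_real[of "fst y - e" "fst y"] \<open>0 < e\<close> by auto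
      obtain r where r: "r \<in> \<rat>" "fst y < r" "r < fst y + e"
        using Rats_dense_in_real[of "fst y" "fst y + e"] \<open>0 < e\<close> by auto
      have "x \<in> U" if "fst x \<in> {q<..<r}" "snd x = snd y" for x
      proof -
        have "fst x \<in> ball (fst y) e"
          using that q r by (auto simp: dist_real_def)
        then have "x \<in> V \<times> W"
          using e VW(3) that(2) by (auto simp: mem_Times_iff)
        then show ?thesis using VW(4) by auto
      qed
      then have "AE x in RZ. fst x \<in> {q<..<r} \<and> snd x = snd y \<longrightarrow> F x = 0"
        using U(3) by (auto elim!: eventually_mono)
      then have "(q, r, snd y) \<in> S"
        using q r by (simp add: S_def)
      then show "F y = 0"
        using elim q r by auto
    qed
  qed
qed

section \<open>Squares and square integrable functions on them\<close>

lemma squares_diam: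
  assumes "\<theta> \<in> squares \<delta>" "p \<in> \<theta>" "q \<in> \<theta>"
  shows "\<bar>fst p - fst q\<bar> \<le> real \<delta>" "\<bar>of_int (snd p) - of_int (snd q)\<bar> \<le> real \<delta>"
proof -
  obtain m n where \<theta>: "\<theta> = {real_of_int m * real \<delta> .. real_of_int (m + 1) * real \<delta>} \<times> {n * int \<delta> .. (n + 1) * int \<delta>}"
    using assms(1) by (auto simp: squares_def)
  show "\<bar>fst p - fst q\<bar> \<le> real \<delta>"
    using assms(2,3) unfolding \<theta> by (auto simp: mem_Times_iff abs_le_iff algebra_simps)
  have "\<bar>snd p - snd q\<bar> \<le> int \<delta>"
    using assms(2,3) unfolding \<theta> by (auto simp: mem_Times_iff abs_le_iff algebra_simps)
  then show "\<bar>of_int (snd p) - of_int (snd q)\<bar> \<le> real \<delta>"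
    by linarith
qed

lemma sets_squares: "\<theta> \<in> squares \<delta> \<Longrightarrow> \<theta> \<in> sets RZ"
  unfolding sets_RZ by (auto simp: squares_def)

lemma emeasure_squares_finite:
  assumes "\<theta> \<in> squares \<delta>"
  shows "emeasure RZ \<theta> < \<infinity>"
proof -
  have "emeasure RZ \<theta> \<le> ennreal ((2 * real \<delta> + 1) * (2 * real \<delta>))"
    using squares_diam[OF assms] by (intro emeasure_RZ_le_horizontal sets_squares[OF assms]) auto
  then show ?thesis by (simp add: order.strict_trans1)
qed

lemma separated_squares:
  assumes "\<theta>\<^sub>1 \<in> squares \<delta>" "\<theta>\<^sub>2 \<in> squares \<delta>" "16 * real \<delta> \<le> dist_RZ \<theta>\<^sub>1 \<theta>\<^sub>2"
  shows "separated (real \<delta>) \<theta>\<^sub>1 \<theta>\<^sub>2"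
proof -
  have "16 * real \<delta> \<le> norm (embed_RZ (p - q))" if "p \<in> \<theta>\<^sub>1" "q \<in> \<theta>\<^sub>2" for p q
    using assms(3) setdist_le_dist[of "embed_RZ p" "embed_RZ ` \<theta>\<^sub>1" "embed_RZ q" "embed_RZ ` \<theta>\<^sub>2"] that
    by (simp add: dist_RZ_def embed_RZ_minus dist_norm)
  then show ?thesis
    using squares_diam[OF assms(1)] squares_diam[OF assms(2)] by (auto simp: separated_def)
qed

lemma in_Lp_2D:
  assumes "in_Lp 2 M F"
  shows "F \<in> borel_measurable M" "(\<integral>\<^sup>+y. ennreal ((norm (F y))\<^sup>2) \<partial>M) < \<infinity>"
proof -
  show "F \<in> borel_measurable M" using assms by (simp add: in_Lp_def)
  have "norm z powr 2 = (norm z)\<^sup>2" for z :: complex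
    by (cases "z = 0") (simp_all add: powr_numeral)
  then show "(\<integral>\<^sup>+y. ennreal ((norm (F y))\<^sup>2) \<partial>M) < \<infinity>"
    using assms by (auto simp: in_Lp_def Lp_norm_def Let_def less_top split: if_splits)
qed

text \<open>On the set \<theta> of finite measure |F|^p \<le> 1 + |F|^2. The case p = 1 gives
  absolute convergence of the evolution integral, the case p = 12/7 finiteness of the norms on the
  right-hand side.\<close>

lemma nn_integral_powr_finite_of_square:
  assumes [measurable]: "F \<in> borel_measurable RZ" "\<theta> \<in> sets RZ"
    and fin: "emeasure RZ \<theta> < \<infinity>" and supp: "\<And>y. y \<notin> \<theta> \<Longrightarrow> F y = 0"
    and F2: "(\<integral>\<^sup>+y. ennreal ((norm (F y))\<^sup>2) \<partial>RZ) < \<infinity>" and "0 < p" "p \<le> 2"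
  shows "(\<integral>\<^sup>+y. ennreal (norm (F y) powr p) \<partial>RZ) < \<infinity>"
proof -
  have "(\<integral>\<^sup>+y. ennreal (norm (F y) powr p) \<partial>RZ) \<le> (\<integral>\<^sup>+y. indicator \<theta> y + ennreal ((norm (F y))\<^sup>2) \<partial>RZ)"
  proof (rule nn_integral_mono)
    fix y
    show "ennreal (norm (F y) powr p) \<le> indicator \<theta> y + ennreal ((norm (F y))\<^sup>2)"
    proof (cases "y \<in> \<theta>")
      case True
      have "norm (F y) powr p \<le> 1 + (norm (F y))\<^sup>2"
      proof (cases "norm (F y) \<le> 1")
        case True
        then have "norm (F y) powr p \<le> 1"
          using \<open>0 < p\<close> powr_mono2[of p "norm (F y)" 1] by simp
        then show ?thesis by (simp add: add_increasing2)
      next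
        case False
        then have "norm (F y) powr p \<le> norm (F y) powr 2"
          using \<open>p \<le> 2\<close> by (intro powr_mono) auto
        also have "\<dots> = (norm (F y))\<^sup>2" using False by (simp add: powr_numeral)
        finally show ?thesis by simp
      qed
      then have "ennreal (norm (F y) powr p) \<le> ennreal (1 + (norm (F y))\<^sup>2)"
        by (rule ennreal_leI)
      then show ?thesis using True by simp
    qed (simp add: supp)
  qed
  also have "\<dots> < \<infinity>"
    using fin F2 by (simp add: nn_integral_add)
  finally show ?thesis .
qed

text \<open>Square integrability of both factors gives this for every \<zeta>; integrability of the
  factors would give it only for almost every \<zeta>.\<close>

lemma integrable_mult_shift:
  fixes F G :: "real \<times> int \<Rightarrow> complex"
  assumes [measurable]: "F \<in> borel_measurable RZ" "G \<in> borel_measurable RZ"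
    and F2: "(\<integral>\<^sup>+y. ennreal ((norm (F y))\<^sup>2) \<partial>RZ) < \<infinity>" and G2: "(\<integral>\<^sup>+y. ennreal ((norm (G y))\<^sup>2) \<partial>RZ) < \<infinity>"
  shows "integrable RZ (\<lambda>y. F y * G (\<zeta> - y))"
proof (rule integrableI_bounded)
  have "(\<integral>\<^sup>+y. ennreal (norm (F y * G (\<zeta> - y))) \<partial>RZ)
      \<le> (\<integral>\<^sup>+y. ennreal ((norm (F y))\<^sup>2) + ennreal ((norm (G (\<zeta> - y)))\<^sup>2) \<partial>RZ)"
  proof (rule nn_integral_mono)
    fix y
    have "2 * (norm (F y) * norm (G (\<zeta> - y))) \<le> (norm (F y))\<^sup>2 + (norm (G (\<zeta> - y)))\<^sup>2"
      using sum_squares_bound[of "norm (F y)" "norm (G (\<zeta> - y))"] by simp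
    moreover have "0 \<le> norm (F y) * norm (G (\<zeta> - y))" by simp
    ultimately have "norm (F y * G (\<zeta> - y)) \<le> (norm (F y))\<^sup>2 + (norm (G (\<zeta> - y)))\<^sup>2"
      unfolding norm_mult by linarith
    then show "ennreal (norm (F y * G (\<zeta> - y))) \<le> ennreal ((norm (F y))\<^sup>2) + ennreal ((norm (G (\<zeta> - y)))\<^sup>2)"
      by (subst ennreal_plus[symmetric], simp, simp, intro ennreal_leI)
  qed
  also have "\<dots> < \<infinity>"
    using F2 G2 by (simp add: nn_integral_add nn_integral_RZ_reflect[where f = "\<lambda>y. ennreal ((norm (G y))\<^sup>2)"])
  finally show "(\<integral>\<^sup>+y. ennreal (norm (F y * G (\<zeta> - y))) \<partial>RZ) < \<infinity>" .
qed measurable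

lemma measurable_schroedinger:
  assumes [measurable]: "F \<in> borel_measurable RZ"
  shows "(\<lambda>(t, x). schroedinger F t x) \<in> borel_measurable (restrict_space lborel A \<Otimes>\<^sub>M RT)"
proof -
  have [measurable]: "(\<lambda>t::real. t) \<in> borel_measurable (restrict_space lborel A)"
    by (rule measurable_restrict_space1) simp
  have [measurable]: "(\<lambda>p. fst (fst p)) \<in> borel_measurable ((restrict_space lborel A \<Otimes>\<^sub>M RT) \<Otimes>\<^sub>M RZ)"
    by (rule measurable_compose[OF _ \<open>(\<lambda>t::real. t) \<in> borel_measurable (restrict_space lborel A)\<close>]) measurable
  have "(\<lambda>p. character (snd (fst p)) (snd p) * (cis (- (4 * pi\<^sup>2 * fst (fst p) * sq_norm (snd p))) * F (snd p)))
      \<in> borel_measurable ((restrict_space lborel A \<Otimes>\<^sub>M RT) \<Otimes>\<^sub>M RZ)"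
    by measurable
  then show ?thesis
    unfolding schroedinger_eq case_prod_unfold
    by (intro RZ.borel_measurable_lebesgue_integral) (simp add: case_prod_unfold)
qed

section \<open>Assembly of the bilinear estimate\<close>

text \<open>The constant collects 2 from the majorant of [0, T], 3 from the time integral and 9408
  from the form; 6 * 9408 = 56448 is rounded up to the square 57600 = 240^2.\<close>

lemma bilinear_L2_bound:
  assumes \<theta>: "\<theta>\<^sub>1 \<in> squares \<delta>" "\<theta>\<^sub>2 \<in> squares \<delta>" and sep: "16 * real \<delta> \<le> dist_RZ \<theta>\<^sub>1 \<theta>\<^sub>2"
    and "0 < \<delta>" "0 < T" "real \<delta> \<le> 1 / T"
    and FG [measurable]: "F \<in> borel_measurable RZ" "G \<in> borel_measurable RZ"
    and supp: "\<And>y. y \<notin> \<theta>\<^sub>1 \<Longrightarrow> F y = 0" "\<And>y. y \<notin> \<theta>\<^sub>2 \<Longrightarrow> G y = 0"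
    and F2: "(\<integral>\<^sup>+y. ennreal ((norm (F y))\<^sup>2) \<partial>RZ) < \<infinity>" and G2: "(\<integral>\<^sup>+y. ennreal ((norm (G y))\<^sup>2) \<partial>RZ) < \<infinity>"
    and IJ: "0 \<le> I" "0 \<le> J"
    and I: "(\<integral>\<^sup>+y. ennreal (norm (F y) powr (12/7)) \<partial>RZ) = ennreal I"
    and J: "(\<integral>\<^sup>+y. ennreal (norm (G y) powr (12/7)) \<partial>RZ) = ennreal J"
  shows "(\<integral>\<^sup>+p. ennreal (norm (case p of (t, x) \<Rightarrow> schroedinger F t x * schroedinger G t x) powr 2)
      \<partial>(restrict_space lborel {0..T} \<Otimes>\<^sub>M RT)) \<le> ennreal (57600 * real \<delta> powr (- (2/3)) * (I powr (7/6) * J powr (7/6)))"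
proof -
  interpret RT: sigma_finite_measure RT by (rule sigma_finite_RT)
  have integrable: "integrable RZ H" if "H \<in> borel_measurable RZ" "\<theta> \<in> squares \<delta>" "\<And>y. y \<notin> \<theta> \<Longrightarrow> H y = 0"
    "(\<integral>\<^sup>+y. ennreal ((norm (H y))\<^sup>2) \<partial>RZ) < \<infinity>" for H :: "real \<times> int \<Rightarrow> complex" and \<theta>
    using nn_integral_powr_finite_of_square[OF that(1) sets_squares[OF that(2)] emeasure_squares_finite[OF that(2)] that(3,4), of 1]
      that(1) by (intro integrableI_bounded) auto
  have Fi: "integrable RZ F" and Gi: "integrable RZ G"
    using integrable[OF FG(1) \<theta>(1) _ F2] integrable[OF FG(2) \<theta>(2) _ G2] supp by auto
  let ?P = "\<lambda>t. \<integral>\<^sup>+\<zeta>. ennreal ((norm (bilinear_profile F G t \<zeta>))\<^sup>2) \<partial>RZ"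
  let ?q = "quad_form (\<lambda>x. ennreal (exp (- (T * resonance x)\<^sup>2 / 2)))
      (\<lambda>y. ennreal (norm (F y))) (\<lambda>y. ennreal (norm (F y))) (\<lambda>y. ennreal (norm (G y))) (\<lambda>y. ennreal (norm (G y)))"
  have powr2: "norm z powr 2 = (norm z)\<^sup>2" for z :: complex
    by (cases "z = 0") (simp_all add: powr_numeral)
  have [measurable]: "(\<lambda>p. schroedinger F (fst p) (snd p)) \<in> borel_measurable (restrict_space lborel {0..T} \<Otimes>\<^sub>M RT)"
    "(\<lambda>p. schroedinger G (fst p) (snd p)) \<in> borel_measurable (restrict_space lborel {0..T} \<Otimes>\<^sub>M RT)"
    using measurable_schroedinger[OF FG(1)] measurable_schroedinger[OF FG(2)] by (simp_all add: case_prod_unfold)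
  have "(\<integral>\<^sup>+p. ennreal (norm (case p of (t, x) \<Rightarrow> schroedinger F t x * schroedinger G t x) powr 2)
      \<partial>(restrict_space lborel {0..T} \<Otimes>\<^sub>M RT))
    = (\<integral>\<^sup>+t. \<integral>\<^sup>+x. ennreal ((norm (schroedinger F t x * schroedinger G t x))\<^sup>2) \<partial>RT \<partial>restrict_space lborel {0..T})"
    by (subst RT.nn_integral_fst[symmetric]) (simp_all add: powr2 case_prod_unfold)
  also have "\<dots> \<le> (\<integral>\<^sup>+t. ?P t \<partial>restrict_space lborel {0..T})"
    unfolding schroedinger_mult(1)[OF Fi Gi]
    by (rule nn_integral_mono, rule Parseval_inequality, rule schroedinger_mult(2)[OF Fi Gi])
  also have "\<dots> = (\<integral>\<^sup>+t. ?P t * indicator {0..T} t \<partial>lborel)"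
    by (rule nn_integral_restrict_space) simp
  also have "\<dots> \<le> (\<integral>\<^sup>+t. 2 * (ennreal (gauss T t) * ?P t) \<partial>lborel)"
  proof (rule nn_integral_mono)
    fix t :: real
    show "?P t * indicator {0..T} t \<le> 2 * (ennreal (gauss T t) * ?P t)"
    proof (cases "t \<in> {0..T}")
      case True
      then have "t\<^sup>2 \<le> T\<^sup>2" by (intro power_mono) auto
      then have "- (1/2) \<le> - t\<^sup>2 / (2 * T\<^sup>2)"
        using \<open>0 < T\<close> by (simp add: field_simps)
      then have "1 / 2 \<le> gauss T t"
        unfolding gauss_def using exp_ge_add_one_self[of "- t\<^sup>2 / (2 * T\<^sup>2)"] by linarith
      then have "1 \<le> 2 * ennreal (gauss T t)"
        using ennreal_leI[of 1 "2 * gauss T t"] by (simp add: ennreal_mult less_imp_le)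
      then have "1 * ?P t \<le> 2 * ennreal (gauss T t) * ?P t"
        by (rule mult_right_mono) simp
      then show ?thesis using True by (simp add: mult.assoc)
    qed simp
  qed
  also have "\<dots> = 2 * (\<integral>\<^sup>+t. ennreal (gauss T t) * ?P t \<partial>lborel)"
    by (rule nn_integral_cmult) measurable
  also have "\<dots> \<le> 2 * (ennreal (3 * T) * ?q)"
    using \<open>0 < T\<close>
    by (intro mult_left_mono nn_integral_bilinear_profile_le integrable_mult_shift FG F2 G2) auto
  also have "\<dots> = 6 * (ennreal T * ?q)"
    using \<open>0 < T\<close> by (simp add: ennreal_mult mult.assoc[symmetric])
  also have "\<dots> \<le> 6 * ennreal (9408 * real \<delta> powr (- (2/3)) * (I powr (7/6) * J powr (7/6)))"
    using separated_squares[OF \<theta> sep] \<open>0 < \<delta>\<close> \<open>0 < T\<close> \<open>real \<delta> \<le> 1 / T\<close> sets_squares[OF \<theta>(1)] sets_squares[OF \<theta>(2)] supp IJ I J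
    by (intro mult_left_mono gaussian_form_estimate[where A = \<theta>\<^sub>1 and B = \<theta>\<^sub>2]) auto
  also have "\<dots> = ennreal (6 * (9408 * real \<delta> powr (- (2/3)) * (I powr (7/6) * J powr (7/6))))"
    by (subst ennreal_mult) auto
  also have "\<dots> \<le> ennreal (57600 * real \<delta> powr (- (2/3)) * (I powr (7/6) * J powr (7/6)))"
  proof (rule ennreal_leI)
    have "0 \<le> real \<delta> powr (- (2/3)) * (I powr (7/6) * J powr (7/6))" by simp
    then show "6 * (9408 * real \<delta> powr (- (2/3)) * (I powr (7/6) * J powr (7/6)))
        \<le> 57600 * real \<delta> powr (- (2/3)) * (I powr (7/6) * J powr (7/6))" by simp
  qed
  finally show ?thesis .
qed

lemma Lp_norm_cong_AE:
  assumes "AE y in M. f y = g y"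
  shows "Lp_norm p M f = Lp_norm p M g"
proof -
  have "(\<integral>\<^sup>+y. ennreal (norm (f y) powr p) \<partial>M) = (\<integral>\<^sup>+y. ennreal (norm (g y) powr p) \<partial>M)"
    using assms by (intro nn_integral_cong_AE) (auto elim!: eventually_mono)
  then show ?thesis by (simp add: Lp_norm_def)
qed

lemma schroedinger_cong_AE:
  assumes "AE y in RZ. F y = G y" and [measurable]: "F \<in> borel_measurable RZ" "G \<in> borel_measurable RZ"
  shows "schroedinger F t x = schroedinger G t x"
  unfolding schroedinger_eq using assms(1)
  by (intro integral_cong_AE) (auto elim!: eventually_mono)

theorem theorem1p1:
  fixes p :: real
  assumes "p = 12 / 7"
  shows "\<exists>c C\<^sub>0 C :: real. 0 < c \<and> c < 1 \<and> 1 \<le> C\<^sub>0 \<and> 0 < C \<and>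
    (\<forall>(\<delta>::nat) (T::real) \<theta>\<^sub>1 \<theta>\<^sub>2 f g F G.
       (\<exists>k::nat. \<delta> = 2 ^ k) \<longrightarrow> 0 < T \<longrightarrow> C\<^sub>0 \<le> real \<delta> \<longrightarrow> real \<delta> \<le> c * inverse T \<longrightarrow>
       \<theta>\<^sub>1 \<in> squares \<delta> \<longrightarrow> \<theta>\<^sub>2 \<in> squares \<delta> \<longrightarrow> C\<^sub>0 * real \<delta> \<le> dist_RZ \<theta>\<^sub>1 \<theta>\<^sub>2 \<longrightarrow>
       f \<in> L2_RT \<longrightarrow> g \<in> L2_RT \<longrightarrow>
       f has_fourier_transform F \<longrightarrow> g has_fourier_transform G \<longrightarrow>
       ess_support RZ F \<subseteq> \<theta>\<^sub>1 \<longrightarrow> ess_support RZ G \<subseteq> \<theta>\<^sub>2 \<longrightarrow>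
       Lp_norm 2 (restrict_space lborel {0..T} \<Otimes>\<^sub>M RT)
           (\<lambda>(t, x). schroedinger F t x * schroedinger G t x)
         \<le> ennreal (C * real \<delta> powr (2 - 4 / p)) * Lp_norm p RZ F * Lp_norm p RZ G)"
proof -
  have main: "Lp_norm 2 (restrict_space lborel {0..T} \<Otimes>\<^sub>M RT) (\<lambda>(t, x). schroedinger F t x * schroedinger G t x)
      \<le> ennreal (240 * real \<delta> powr (2 - 4 / p)) * Lp_norm p RZ F * Lp_norm p RZ G"
    if "0 < T" "16 \<le> real \<delta>" "real \<delta> \<le> 1/2 * inverse T" and \<theta>: "\<theta>\<^sub>1 \<in> squares \<delta>" "\<theta>\<^sub>2 \<in> squares \<delta>"
      and sep: "16 * real \<delta> \<le> dist_RZ \<theta>\<^sub>1 \<theta>\<^sub>2"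
      and ft: "f has_fourier_transform F" "g has_fourier_transform G"
      and supp: "ess_support RZ F \<subseteq> \<theta>\<^sub>1" "ess_support RZ G \<subseteq> \<theta>\<^sub>2"
    for \<delta> :: nat and T :: real and \<theta>\<^sub>1 \<theta>\<^sub>2 f g F G
  proof -
    have F: "F \<in> borel_measurable RZ" "(\<integral>\<^sup>+y. ennreal ((norm (F y))\<^sup>2) \<partial>RZ) < \<infinity>"
      and G: "G \<in> borel_measurable RZ" "(\<integral>\<^sup>+y. ennreal ((norm (G y))\<^sup>2) \<partial>RZ) < \<infinity>"
      using ft in_Lp_2D unfolding has_fourier_transform_def by blast+
    note [measurable] = F(1) G(1) sets_squares[OF \<theta>(1)] sets_squares[OF \<theta>(2)]
    \<comment> \<open>The support hypothesis only gives vanishing almost everywhere outside the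
      squares, while the estimates ask for it at every point. Neither the norms nor the evolutions
      see this change of representative.\<close>
    define F' G' where "F' y = indicator \<theta>\<^sub>1 y * F y" and "G' y = indicator \<theta>\<^sub>2 y * G y" for y
    have [measurable]: "F' \<in> borel_measurable RZ" "G' \<in> borel_measurable RZ"
      unfolding F'_def[abs_def] G'_def[abs_def] by measurable
    have eqF: "AE y in RZ. F y = F' y"
      using AE_ess_support[OF supp(1)] by eventually_elim (auto simp: F'_def indicator_def)
    have eqG: "AE y in RZ. G y = G' y"
      using AE_ess_support[OF supp(2)] by eventually_elim (auto simp: G'_def indicator_def)
    have supp': "F' y = 0" if "y \<notin> \<theta>\<^sub>1" for y using that by (simp add: F'_def)
    have supp'': "G' y = 0" if "y \<notin> \<theta>\<^sub>2" for y using that by (simp add: G'_def)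
    have F2: "(\<integral>\<^sup>+y. ennreal ((norm (F' y))\<^sup>2) \<partial>RZ) < \<infinity>"
      using F(2) by (rule order.strict_trans1[rotated]) (auto intro!: nn_integral_mono ennreal_leI simp: F'_def indicator_def)
    have G2: "(\<integral>\<^sup>+y. ennreal ((norm (G' y))\<^sup>2) \<partial>RZ) < \<infinity>"
      using G(2) by (rule order.strict_trans1[rotated]) (auto intro!: nn_integral_mono ennreal_leI simp: G'_def indicator_def)
    define I J where "I = enn2real (\<integral>\<^sup>+y. ennreal (norm (F' y) powr (12/7)) \<partial>RZ)"
      and "J = enn2real (\<integral>\<^sup>+y. ennreal (norm (G' y) powr (12/7)) \<partial>RZ)"
    have "0 \<le> I" "0 \<le> J" by (simp_all add: I_def J_def)
    have I: "(\<integral>\<^sup>+y. ennreal (norm (F' y) powr (12/7)) \<partial>RZ) = ennreal I"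
      using nn_integral_powr_finite_of_square[OF _ sets_squares[OF \<theta>(1)] emeasure_squares_finite[OF \<theta>(1)] supp' F2, of "12/7"]
      by (simp add: I_def)
    have J: "(\<integral>\<^sup>+y. ennreal (norm (G' y) powr (12/7)) \<partial>RZ) = ennreal J"
      using nn_integral_powr_finite_of_square[OF _ sets_squares[OF \<theta>(2)] emeasure_squares_finite[OF \<theta>(2)] supp'' G2, of "12/7"]
      by (simp add: J_def)
    have LpF: "Lp_norm p RZ F = ennreal (I powr (7/12))"
      using I \<open>0 \<le> I\<close> unfolding Lp_norm_cong_AE[OF eqF] by (simp add: Lp_norm_def assms)
    have LpG: "Lp_norm p RZ G = ennreal (J powr (7/12))"
      using J \<open>0 \<le> J\<close> unfolding Lp_norm_cong_AE[OF eqG] by (simp add: Lp_norm_def assms)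
    have sch: "schroedinger F t x = schroedinger F' t x" "schroedinger G t x = schroedinger G' t x" for t x
      by (rule schroedinger_cong_AE eqF eqG; measurable)+
    define N where "N = (\<integral>\<^sup>+q. ennreal (norm (case q of (t, x) \<Rightarrow> schroedinger F' t x * schroedinger G' t x) powr 2)
      \<partial>(restrict_space lborel {0..T} \<Otimes>\<^sub>M RT))"
    define B where "B = 57600 * real \<delta> powr (- (2/3)) * (I powr (7/6) * J powr (7/6))"
    have "real \<delta> \<le> 1 / T"
    proof -
      have "1/2 * inverse T \<le> 1 / T" using \<open>0 < T\<close> by (simp add: field_simps)
      then show ?thesis using that(3) by linarith
    qed
    then have N: "N \<le> ennreal B"
      unfolding N_def B_def using that(1,2) supp' supp'' F2 G2 I J \<open>0 \<le> I\<close> \<open>0 \<le> J\<close>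
      by (intro bilinear_L2_bound[OF \<theta> sep]) auto
    have "0 \<le> B" by (simp add: B_def)
    \<comment> \<open>\<open>Lp_norm\<close> returns \<infinity> on a divergent integral; finiteness
      selects its other branch.\<close>
    have "N \<noteq> \<infinity>" using N by (auto simp: top_unique)
    then have "Lp_norm 2 (restrict_space lborel {0..T} \<Otimes>\<^sub>M RT) (\<lambda>(t, x). schroedinger F t x * schroedinger G t x)
        = ennreal (enn2real N powr (1/2))"
      unfolding sch Lp_norm_def N_def by (simp add: Let_def)
    also have "\<dots> \<le> ennreal (B powr (1/2))"
    proof (intro ennreal_leI powr_mono2)
      show "enn2real N \<le> B" using enn2real_mono[OF N] \<open>0 \<le> B\<close> by simp
    qed auto
    \<comment> \<open>The root turns I^(7/6) into I^(7/12), which is the norm because 7/12 = 1/p,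
      and \<delta>^(-2/3) into \<delta>^(-1/3), where -1/3 = 2 - 4/p.\<close>
    also have "B powr (1/2) = 240 * real \<delta> powr (2 - 4 / p) * I powr (7/12) * J powr (7/12)"
    proof -
      have "(57600::real) powr (1/2) = 240"
        by (simp add: powr_half_sqrt real_sqrt_unique[of 240])
      then show ?thesis
        by (simp add: B_def powr_mult powr_powr assms)
    qed
    also have "ennreal (240 * real \<delta> powr (2 - 4 / p) * I powr (7/12) * J powr (7/12))
        = ennreal (240 * real \<delta> powr (2 - 4 / p)) * Lp_norm p RZ F * Lp_norm p RZ G"
      unfolding LpF LpG by (simp only: ennreal_mult mult_nonneg_nonneg powr_ge_zero zero_le_numeral)
    finally show ?thesis .
  qed
  \<comment> \<open>16 is the separation demanded by \<open>separated\<close>, 240 is the root of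
    57600, and c = 1/2 gives \<delta> \<le> 1 / T, so every layer is at least \<delta> wide.\<close>
  show ?thesis
    by (rule exI[of _ "1/2"], rule exI[of _ 16], rule exI[of _ 240]) (use main in auto)
qed

end
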